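(* Let $\Omega_1'=\{\mathcal{D}_\eta\mid\eta\in\mathbb{A}^{n-1}\}\subseteq W_{n-1}$ and consider the morphism $$\theta:G'\times\Omega_1'\to W_{n-1},\qquad (g,x)\mapsto g.x.$$ All tangent maps $(d\theta)_{(g,x)}$ with $(g,x)\in G'\times\Omega_1'$ are surjective. In particular, $\theta$ is a smooth morphism.
   Context: $k$ is an algebraically closed field of characteristic $p>3$, $n\ge3$, $B_{n-1}=k[x_1,\dots,x_{n-1}]/(x_1^p,\dots,x_{n-1}^p)$, $D_i=\partial/\partial x_i$, and $W_{n-1}=\mathrm{Der}(B_{n-1})$ is the Jacobson-Witt algebra. $G'=\mathrm{Aut}(W_{n-1})$ is its restricted automorphism group, a connected algebraic group; $G'\cong\mathrm{Aut}(B_{n-1})$ with $\phi\in\mathrm{Aut}(B_{n-1})$ acting by $D\mapsto\phi\circ D\circ\phi^{-1}$. For $\eta=(\eta_1,\dots,\eta_{n-1})\in\mathbb{A}^{n-1}$ let $$\mathcal{D}_\eta=D_1+x_1^{p-1}D_2+\cdots+x_1^{p-1}\cdots x_{n-2}^{p-1}D_{n-1}+x_1^{p-1}\cdots x_{n-1}^{p-1}\sum_{i=1}^{n-1}(-1)^{n-i}\eta_iD_i\in W_{n-1}.$$ $\Omega_1'$ is an affine subspace of $W_{n-1}$. *)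

theory Defs
  imports
    "HOL-Algebra.QuotRing"
    "HOL-Algebra.Generated_Rings"
    "HOL-Library.Poly_Mapping"
    "HOL-Library.Cardinality"
    "HOL-Computational_Algebra.Polynomial"
    "HOL-Computational_Algebra.Primes"
begin

section \<open>Truncated polynomial rings\<close>

type_synonym ('k, 'i) mpoly = "('i \<Rightarrow>\<^sub>0 nat) \<Rightarrow>\<^sub>0 'k"

definition mvar :: "'i \<Rightarrow> ('k::comm_ring_1, 'i) mpoly" where
  "mvar i = Poly_Mapping.single (Poly_Mapping.single i 1) 1"

definition mconst :: "'k \<Rightarrow> ('k::comm_ring_1, 'i) mpoly" where
  "mconst c = Poly_Mapping.single 0 c"

text \<open>The ideal generated by the powers \<open>x\<^sub>i\<^sup>p\<close>, where \<open>p\<close> is the characteristic of the ground field.\<close>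

definition pth_power_ideal :: "('k::comm_ring_1, 'i::finite) mpoly set" where
  "pth_power_ideal = {\<Sum>i\<in>UNIV. q i * mvar i ^ CHAR('k) | q. True}"

lemma pth_power_ideal_iff:
  "f \<in> pth_power_ideal \<longleftrightarrow> (\<exists>q. f = (\<Sum>i\<in>UNIV. q i * mvar i ^ CHAR('k)))"
  for f :: "('k::comm_ring_1, 'i::finite) mpoly"
  by (auto simp: pth_power_ideal_def)

lemma pth_power_ideal_0: "0 \<in> pth_power_ideal"
  unfolding pth_power_ideal_iff by (rule exI[of _ "\<lambda>_. 0"]) simp

lemma pth_power_ideal_add:
  fixes f :: "('k::comm_ring_1, 'i::finite) mpoly"
  assumes "f \<in> pth_power_ideal" "g \<in> pth_power_ideal" shows "f + g \<in> pth_power_ideal"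
proof -
  from assms obtain q r where "f = (\<Sum>i\<in>UNIV. q i * mvar i ^ CHAR('k))"
    "g = (\<Sum>i\<in>UNIV. r i * mvar i ^ CHAR('k))" unfolding pth_power_ideal_iff by blast
  then have "f + g = (\<Sum>i\<in>UNIV. (q i + r i) * mvar i ^ CHAR('k))"
    by (simp add: sum.distrib distrib_right)
  then show ?thesis
    unfolding pth_power_ideal_iff by (intro exI[of _ "\<lambda>i. q i + r i"])
qed

lemma pth_power_ideal_mult:
  fixes f :: "('k::comm_ring_1, 'i::finite) mpoly"
  assumes "f \<in> pth_power_ideal" shows "h * f \<in> pth_power_ideal"
proof -
  from assms obtain q where "f = (\<Sum>i\<in>UNIV. q i * mvar i ^ CHAR('k))"
    unfolding pth_power_ideal_iff by blast
  then have "h * f = (\<Sum>i\<in>UNIV. (h * q i) * mvar i ^ CHAR('k))"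
    by (simp add: sum_distrib_left mult.assoc)
  then show ?thesis
    unfolding pth_power_ideal_iff by (intro exI[of _ "\<lambda>i. h * q i"])
qed

lemma pth_power_ideal_uminus: "f \<in> pth_power_ideal \<Longrightarrow> - f \<in> pth_power_ideal"
  using pth_power_ideal_mult[of f "- 1"] by simp

lemma mvar_power: "mvar i ^ n = Poly_Mapping.single (Poly_Mapping.single i n) 1"
  by (induction n) (simp_all add: mvar_def mult_single flip: single_add)

lemma one_notin_pth_power_ideal:
  "(1 :: ('k::field_prime_char, 'i::finite) mpoly) \<notin> pth_power_ideal"
proof
  assume "(1 :: ('k, 'i) mpoly) \<in> pth_power_ideal"
  then obtain q :: "'i \<Rightarrow> ('k, 'i) mpoly"
    where q: "1 = (\<Sum>i\<in>UNIV. q i * mvar i ^ CHAR('k))" unfolding pth_power_ideal_iff by blast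
  have "0 \<notin> Poly_Mapping.keys (q i * mvar i ^ CHAR('k))" for i
  proof
    assume "0 \<in> Poly_Mapping.keys (q i * mvar i ^ CHAR('k))"
    then obtain a b where "0 = a + b" "b \<in> Poly_Mapping.keys (mvar i ^ CHAR('k) :: ('k, 'i) mpoly)"
      using keys_mult[of "q i" "mvar i ^ CHAR('k)"] by blast
    then have "0 = a + Poly_Mapping.single i CHAR('k)"
      by (simp add: mvar_power)
    then have "Poly_Mapping.lookup (0 :: 'i \<Rightarrow>\<^sub>0 nat) i = Poly_Mapping.lookup (a + Poly_Mapping.single i CHAR('k)) i"
      by simp
    then show False by (simp add: lookup_add)
  qed
  then have "Poly_Mapping.lookup (q i * mvar i ^ CHAR('k)) 0 = 0" for i
    by (simp add: in_keys_iff)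
  then have "Poly_Mapping.lookup (1 :: ('k, 'i) mpoly) 0 = 0"
    by (subst q) (simp add: lookup_sum)
  then show False by simp
qed

quotient_type (overloaded) ('k, 'i) trunc_poly = "('k::field_prime_char, 'i::finite) mpoly" /
  "\<lambda>f g. f - g \<in> pth_power_ideal"
proof (rule equivpI)
  show "reflp (\<lambda>f g :: ('k, 'i) mpoly. f - g \<in> pth_power_ideal)"
    by (rule reflpI) (simp add: pth_power_ideal_0)
  show "symp (\<lambda>f g :: ('k, 'i) mpoly. f - g \<in> pth_power_ideal)"
    by (rule sympI) (metis minus_diff_eq pth_power_ideal_uminus)
  show "transp (\<lambda>f g :: ('k, 'i) mpoly. f - g \<in> pth_power_ideal)"
  proof (rule transpI)
    fix f g h :: "('k, 'i) mpoly"
    assume "f - g \<in> pth_power_ideal" "g - h \<in> pth_power_ideal"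
    from pth_power_ideal_add[OF this] show "f - h \<in> pth_power_ideal" by simp
  qed
qed

instantiation trunc_poly :: (field_prime_char, finite) comm_ring_1
begin

lift_definition zero_trunc_poly :: "('a, 'b) trunc_poly" is 0 .
lift_definition one_trunc_poly :: "('a, 'b) trunc_poly" is 1 .
lift_definition plus_trunc_poly :: "('a, 'b) trunc_poly \<Rightarrow> ('a, 'b) trunc_poly \<Rightarrow> ('a, 'b) trunc_poly"
  is "(+)"
  by (metis add_diff_add pth_power_ideal_add)
lift_definition uminus_trunc_poly :: "('a, 'b) trunc_poly \<Rightarrow> ('a, 'b) trunc_poly" is uminus
  by (metis minus_diff_minus pth_power_ideal_uminus)
lift_definition minus_trunc_poly :: "('a, 'b) trunc_poly \<Rightarrow> ('a, 'b) trunc_poly \<Rightarrow> ('a, 'b) trunc_poly"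
  is "(-)"
proof -
  fix f f' g g' :: "('a, 'b) mpoly"
  assume "f - f' \<in> pth_power_ideal" "g - g' \<in> pth_power_ideal"
  from pth_power_ideal_add[OF this(1) pth_power_ideal_uminus[OF this(2)]]
  show "f - g - (f' - g') \<in> pth_power_ideal" by (simp add: algebra_simps)
qed
lift_definition times_trunc_poly :: "('a, 'b) trunc_poly \<Rightarrow> ('a, 'b) trunc_poly \<Rightarrow> ('a, 'b) trunc_poly"
  is "(*)"
proof -
  fix f f' g g' :: "('a, 'b) mpoly"
  assume "f - f' \<in> pth_power_ideal" "g - g' \<in> pth_power_ideal"
  from pth_power_ideal_add[OF pth_power_ideal_mult[OF this(1), of g] pth_power_ideal_mult[OF this(2), of f']]
  show "f * g - f' * g' \<in> pth_power_ideal" by (simp add: algebra_simps)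
qed

instance
proof
  show "(0 :: ('a, 'b) trunc_poly) \<noteq> 1"
    by transfer (use pth_power_ideal_uminus one_notin_pth_power_ideal in force)
qed (transfer; simp add: algebra_simps pth_power_ideal_0)+

end

lift_definition tconst :: "'k::field_prime_char \<Rightarrow> ('k, 'i::finite) trunc_poly" is mconst .

lift_definition tvar :: "'i \<Rightarrow> ('k::field_prime_char, 'i::finite) trunc_poly" is mvar .

definition tscale :: "'k \<Rightarrow> ('k, 'i) trunc_poly \<Rightarrow> ('k::field_prime_char, 'i::finite) trunc_poly" where
  "tscale c f = tconst c * f"

lemma tconst_add: "tconst (a + b) = tconst a + tconst b"
  by transfer (simp add: mconst_def single_add pth_power_ideal_0)

lemma tconst_mult: "tconst (a * b) = tconst a * tconst b"
  by transfer (simp add: mconst_def mult_single pth_power_ideal_0)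

lemma tconst_1: "tconst 1 = 1"
  by transfer (simp add: mconst_def pth_power_ideal_0)

lemma vector_space_tscale: "vector_space tscale"
  by standard (simp_all add: tscale_def tconst_add tconst_mult tconst_1 algebra_simps)

text \<open>The coefficient of \<open>x\<^sup>a\<close> in \<open>\<partial>f/\<partial>x\<^sub>i\<close> is \<open>a\<^sub>i + 1\<close> times the coefficient of
  \<open>x\<^sup>a x\<^sub>i\<close> in \<open>f\<close>.\<close>

lift_definition mpderiv :: "'i \<Rightarrow> ('k::comm_ring_1, 'i) mpoly \<Rightarrow> ('k, 'i) mpoly" is
  "\<lambda>i f a. of_nat (Suc (Poly_Mapping.lookup a i)) * f (a + Poly_Mapping.single i 1)"
proof -
  fix i :: 'i and f :: "('i \<Rightarrow>\<^sub>0 nat) \<Rightarrow> 'k"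
  assume "finite {a. f a \<noteq> 0}"
  then have "finite ((\<lambda>a. a + Poly_Mapping.single i 1) -` {a. f a \<noteq> 0})"
    by (rule finite_vimageI) (simp add: inj_on_def)
  then show "finite {a. of_nat (Suc (Poly_Mapping.lookup a i)) * f (a + Poly_Mapping.single i 1) \<noteq> 0}"
    by (rule rev_finite_subset) auto
qed

lemma mpderiv_add: "mpderiv i (f + g) = mpderiv i f + mpderiv i g"
  by (rule poly_mapping_eqI) (simp add: mpderiv.rep_eq lookup_add algebra_simps)

lemma mpderiv_single:
  "mpderiv i (Poly_Mapping.single a c) =
    Poly_Mapping.single (a - Poly_Mapping.single i 1) (of_nat (Poly_Mapping.lookup a i) * c)"
proof (rule poly_mapping_eqI)
  fix b
  show "Poly_Mapping.lookup (mpderiv i (Poly_Mapping.single a c)) b =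
    Poly_Mapping.lookup (Poly_Mapping.single (a - Poly_Mapping.single i 1) (of_nat (Poly_Mapping.lookup a i) * c)) b"
  proof (cases "Poly_Mapping.lookup a i = 0")
    case True
    then have "a \<noteq> b + Poly_Mapping.single i 1"
      by (auto simp: lookup_add)
    with True show ?thesis by (simp add: mpderiv.rep_eq lookup_single when_def)
  next
    case False
    then have "a - Poly_Mapping.single i 1 + Poly_Mapping.single i 1 = a"
      by (intro poly_mapping_eqI) (auto simp: lookup_add lookup_minus lookup_single when_def)
    then have "a - Poly_Mapping.single i 1 = b \<longleftrightarrow> a = b + Poly_Mapping.single i 1"
      by (metis add_diff_cancel_right')
    then show ?thesis
      by (auto simp: mpderiv.rep_eq lookup_single when_def lookup_add)
  qed
qed

lemma mpoly_induct [case_names single add]: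
  fixes f :: "('k::comm_ring_1, 'i) mpoly"
  assumes "\<And>a c. P (Poly_Mapping.single a c)" "\<And>f g. P f \<Longrightarrow> P g \<Longrightarrow> P (f + g)"
  shows "P f"
proof (induction f rule: update_induct)
  case const
  show ?case using assms(1)[of 0 0] by simp
next
  case (update f a b)
  have "Poly_Mapping.update a b f = f + Poly_Mapping.single a b"
    using update by (intro poly_mapping_eqI)
      (auto simp: lookup_update lookup_add lookup_single when_def in_keys_iff)
  then show ?case using assms update by simp
qed

lemma mpderiv_mult: "mpderiv i (f * g) = mpderiv i f * g + f * mpderiv i g"
proof (induction f rule: mpoly_induct)
  case (single a c)
  show ?case
  proof (induction g rule: mpoly_induct)
    case (single b d)
    have *: "x - Poly_Mapping.single i (Suc 0) + y = x + y - Poly_Mapping.single i (Suc 0)"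
      if "Poly_Mapping.lookup x i \<noteq> 0" for x y :: "'a \<Rightarrow>\<^sub>0 nat"
      using that by (intro poly_mapping_eqI) (auto simp: lookup_add lookup_minus lookup_single when_def)
    have "Poly_Mapping.single (a - Poly_Mapping.single i (Suc 0) + b) (of_nat (Poly_Mapping.lookup a i) * (c * d))
      = Poly_Mapping.single (a + b - Poly_Mapping.single i (Suc 0)) (of_nat (Poly_Mapping.lookup a i) * (c * d))"
      by (cases "Poly_Mapping.lookup a i = 0") (simp_all add: *)
    moreover have "Poly_Mapping.single (a + (b - Poly_Mapping.single i (Suc 0))) (of_nat (Poly_Mapping.lookup b i) * (c * d))
      = Poly_Mapping.single (a + b - Poly_Mapping.single i (Suc 0)) (of_nat (Poly_Mapping.lookup b i) * (c * d))"
      using *[of b a] by (cases "Poly_Mapping.lookup b i = 0") (simp_all add: add.commute)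
    ultimately show ?case
      by (simp add: mult_single mpderiv_single lookup_add algebra_simps flip: single_add)
  next
    case (add f g)
    then show ?case by (simp add: mpderiv_add algebra_simps)
  qed
next
  case (add f g)
  then show ?case by (simp add: mpderiv_add algebra_simps)
qed

lemma mpderiv_sum: "finite A \<Longrightarrow> mpderiv i (\<Sum>j\<in>A. f j) = (\<Sum>j\<in>A. mpderiv i (f j))"
  by (induction A rule: finite_induct)
     (simp_all add: mpderiv_add, simp add: poly_mapping_eq_iff mpderiv.rep_eq fun_eq_iff)

lemma mpderiv_pth_power_ideal:
  fixes f :: "('k::comm_ring_1, 'i::finite) mpoly"
  assumes "f \<in> pth_power_ideal" shows "mpderiv i f \<in> pth_power_ideal"
proof -
  from assms obtain q where f: "f = (\<Sum>j\<in>UNIV. q j * mvar j ^ CHAR('k))"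
    unfolding pth_power_ideal_iff by blast
  have "mpderiv i (mvar j ^ CHAR('k) :: ('k, 'i) mpoly) = 0" for j
    by (cases "j = i") (simp_all add: mvar_power mpderiv_single lookup_single)
  then have "mpderiv i f = (\<Sum>j\<in>UNIV. mpderiv i (q j) * mvar j ^ CHAR('k))"
    by (simp add: f mpderiv_sum mpderiv_mult)
  then show ?thesis
    unfolding pth_power_ideal_iff by (intro exI[of _ "\<lambda>j. mpderiv i (q j)"])
qed

lift_definition tpderiv :: "'i \<Rightarrow> ('k::field_prime_char, 'i::finite) trunc_poly \<Rightarrow> ('k, 'i) trunc_poly"
  is mpderiv
proof -
  fix i :: 'i and f g :: "('k, 'i) mpoly"
  assume "f - g \<in> pth_power_ideal"
  moreover have "mpderiv i f = mpderiv i (f - g) + mpderiv i g"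
    by (simp flip: mpderiv_add)
  ultimately show "mpderiv i f - mpderiv i g \<in> pth_power_ideal"
    by (simp add: mpderiv_pth_power_ideal)
qed


section \<open>The Jacobson-Witt algebra\<close>

definition derivation :: "(('k, 'i) trunc_poly \<Rightarrow> ('k::field_prime_char, 'i::finite) trunc_poly) \<Rightarrow> bool" where
  "derivation D \<longleftrightarrow> Vector_Spaces.linear tscale tscale D \<and> (\<forall>f g. D (f * g) = D f * g + f * D g)"

lemma derivationI:
  assumes "\<And>f g. D (f + g) = D f + D g" "\<And>f g. D (f * g) = D f * g + f * D g"
    "\<And>c. D (tconst c) = 0"
  shows "derivation D"
  unfolding derivation_def Vector_Spaces.linear_def module_hom_axioms_def module_hom_def
  using assms vector_space_tscale
  by (auto simp: tscale_def module_iff_vector_space)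

lemma derivationD:
  assumes "derivation D"
  shows "D (f + g) = D f + D g" "D (f * g) = D f * g + f * D g" "D (tconst c) = 0"
    "D 0 = 0" "D (f - g) = D f - D g" "D (- f) = - D f"
proof -
  interpret Vector_Spaces.linear tscale tscale D using assms by (simp add: derivation_def)
  show mult: "D (f * g) = D f * g + f * D g" for f g using assms by (simp add: derivation_def)
  show "D (f + g) = D f + D g" "D 0 = 0" "D (f - g) = D f - D g" "D (- f) = - D f"
    by (simp_all add: add diff neg)
  have "D (1 * 1) = D 1 + D 1" unfolding mult by simp
  then have "D 1 = 0" by simp
  then show "D (tconst c) = 0" using scale[of c 1] by (simp add: tscale_def)
qed

typedef (overloaded) ('k, 'i) witt =
  "{D :: ('k::field_prime_char, 'i::finite) trunc_poly \<Rightarrow> ('k, 'i) trunc_poly. derivation D}"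
  morphisms wapply Abs_witt
  by (rule exI[of _ "\<lambda>_. 0"]) (auto intro: derivationI)

setup_lifting type_definition_witt

lemma derivation_wapply: "derivation (wapply D)"
  using wapply[of D] by simp

instantiation witt :: (field_prime_char, finite) ab_group_add
begin

lift_definition zero_witt :: "('a, 'b) witt" is "\<lambda>_. 0"
  by (auto intro: derivationI)
lift_definition plus_witt :: "('a, 'b) witt \<Rightarrow> ('a, 'b) witt \<Rightarrow> ('a, 'b) witt" is "\<lambda>D E f. D f + E f"
  by (auto intro!: derivationI simp: derivationD algebra_simps)
lift_definition uminus_witt :: "('a, 'b) witt \<Rightarrow> ('a, 'b) witt" is "\<lambda>D f. - D f"
  by (auto intro!: derivationI simp: derivationD algebra_simps)
lift_definition minus_witt :: "('a, 'b) witt \<Rightarrow> ('a, 'b) witt \<Rightarrow> ('a, 'b) witt" is "\<lambda>D E f. D f - E f"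
  by (auto intro!: derivationI simp: derivationD algebra_simps)

instance by standard (transfer; simp add: fun_eq_iff)+

end

definition wmult :: "('k, 'i) trunc_poly \<Rightarrow> ('k, 'i) witt \<Rightarrow> ('k::field_prime_char, 'i::finite) witt" where
  "wmult b D = Abs_witt (\<lambda>f. b * wapply D f)"

lemma wapply_wmult: "wapply (wmult b D) f = b * wapply D f"
proof -
  have "derivation (\<lambda>f. b * wapply D f)"
    by (rule derivationI) (simp_all add: derivationD[OF derivation_wapply] algebra_simps)
  then show ?thesis by (simp add: wmult_def Abs_witt_inverse)
qed

definition wscale :: "'k \<Rightarrow> ('k, 'i) witt \<Rightarrow> ('k::field_prime_char, 'i::finite) witt" where
  "wscale c D = wmult (tconst c) D"

lemma vector_space_wscale: "vector_space wscale"
  by standard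
    (simp_all add: wscale_def wapply_inject[symmetric] fun_eq_iff wapply_wmult plus_witt.rep_eq
      tconst_add tconst_mult tconst_1 algebra_simps)

lift_definition wbracket :: "('k, 'i) witt \<Rightarrow> ('k, 'i) witt \<Rightarrow> ('k::field_prime_char, 'i::finite) witt"
  is "\<lambda>D E f. D (E f) - E (D f)"
  by (auto intro!: derivationI simp: derivationD algebra_simps)

lemma derivation_funpow_mult:
  assumes "derivation D"
  shows "(D ^^ n) (f * g) = (\<Sum>j\<le>n. of_nat (n choose j) * ((D ^^ j) f * (D ^^ (n - j)) g))"
proof (induction n)
  case (Suc n)
  note D = derivationD[OF assms]
  have D_of_nat: "D (of_nat m * h) = of_nat m * D h" for m h
    by (induction m) (simp_all add: D distrib_right)
  have D_sum: "D (\<Sum>j\<in>A. h j) = (\<Sum>j\<in>A. D (h j))" for A :: "nat set" and h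
    by (induction A rule: infinite_finite_induct) (simp_all add: D)
  define t where "t j = (D ^^ j) f * (D ^^ (Suc n - j)) g" for j
  have D_t: "D ((D ^^ j) f * (D ^^ (n - j)) g) = t (Suc j) + t j" if "j \<le> n" for j
    using that by (simp add: D t_def Suc_diff_le)
  have "(D ^^ Suc n) (f * g) = (\<Sum>j\<le>n. of_nat (n choose j) * (t (Suc j) + t j))"
    by (simp add: Suc.IH D_sum D_of_nat D_t)
  also have "\<dots> = (\<Sum>j\<le>n. of_nat (n choose j) * t (Suc j)) + (\<Sum>j\<le>Suc n. of_nat (n choose j) * t j)"
    by (simp add: distrib_left sum.distrib binomial_eq_0)
  also have "\<dots> = t 0 + (\<Sum>j\<le>n. of_nat (Suc n choose Suc j) * t (Suc j))"
    by (subst sum.atMost_Suc_shift) (simp add: distrib_right sum.distrib add_ac)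
  also have "\<dots> = (\<Sum>j\<le>Suc n. of_nat (Suc n choose j) * t j)"
    by (subst sum.atMost_Suc_shift) simp
  finally show ?case by (simp add: t_def)
qed simp

lemma of_nat_CHAR_trunc_poly:
  "(of_nat CHAR('k) :: ('k::field_prime_char, 'i::finite) trunc_poly) = 0"
proof -
  have "(of_nat m :: ('k, 'i) trunc_poly) = tconst (of_nat m)" for m
  proof (induction m)
    case 0
    show ?case using tconst_add[of 0 0] by simp
  next
    case (Suc m)
    then show ?case by (simp add: tconst_add tconst_1)
  qed
  moreover have "tconst 0 = (0 :: ('k, 'i) trunc_poly)" using tconst_add[of 0 0] by simp
  ultimately show ?thesis by simp
qed

lemma derivation_funpow_CHAR:
  fixes D :: "('k::field_prime_char, 'i::finite) trunc_poly \<Rightarrow> ('k, 'i) trunc_poly"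
  assumes "derivation D"
  shows "derivation (D ^^ CHAR('k))"
proof (rule derivationI)
  note D = derivationD[OF assms]
  have add: "(D ^^ m) (f + g) = (D ^^ m) f + (D ^^ m) g" for m f g
    by (induction m) (simp_all add: D)
  show "(D ^^ CHAR('k)) (f + g) = (D ^^ CHAR('k)) f + (D ^^ CHAR('k)) g" for f g by (rule add)
  have "(D ^^ Suc m) (tconst c) = 0" for m c
    by (induction m) (simp_all add: D)
  from this[of "CHAR('k) - 1"] show "(D ^^ CHAR('k)) (tconst c) = 0" for c by simp
  fix f g
  have zero: "of_nat (CHAR('k) choose j) * h = 0" if "j \<notin> {0, CHAR('k)}" "j \<le> CHAR('k)"
    for j and h :: "('k, 'i) trunc_poly"
  proof -
    from that have "CHAR('k) dvd (CHAR('k) choose j)"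
      by (intro dvd_choose_prime) auto
    then show ?thesis by (auto simp: of_nat_CHAR_trunc_poly elim!: dvdE)
  qed
  have "(D ^^ CHAR('k)) (f * g) =
    (\<Sum>j\<le>CHAR('k). of_nat (CHAR('k) choose j) * ((D ^^ j) f * (D ^^ (CHAR('k) - j)) g))"
    by (rule derivation_funpow_mult[OF assms])
  also have "\<dots> = (\<Sum>j\<in>{0, CHAR('k)}.
      of_nat (CHAR('k) choose j) * ((D ^^ j) f * (D ^^ (CHAR('k) - j)) g))"
    using zero by (intro sum.mono_neutral_right) auto
  also have "\<dots> = (D ^^ CHAR('k)) f * g + f * (D ^^ CHAR('k)) g"
    by (simp add: add.commute)
  finally show "(D ^^ CHAR('k)) (f * g) = (D ^^ CHAR('k)) f * g + f * (D ^^ CHAR('k)) g" .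
qed

lift_definition wpower :: "('k, 'i) witt \<Rightarrow> ('k::field_prime_char, 'i::finite) witt"
  is "\<lambda>D. D ^^ CHAR('k)"
  by (rule derivation_funpow_CHAR)

lemma derivation_tpderiv: "derivation (tpderiv i)"
proof (rule derivationI)
  show "tpderiv i (f + g) = tpderiv i f + tpderiv i g" for f g
    by transfer (simp add: mpderiv_add pth_power_ideal_0)
  show "tpderiv i (f * g) = tpderiv i f * g + f * tpderiv i g" for f g
    by transfer (simp add: mpderiv_mult pth_power_ideal_0)
  show "tpderiv i (tconst c) = 0" for c
    by transfer (simp add: mconst_def mpderiv_single pth_power_ideal_0)
qed

lift_definition wpartial :: "'i \<Rightarrow> ('k::field_prime_char, 'i::finite) witt" is tpderiv
  by (rule derivation_tpderiv)

text \<open>Restricted automorphisms: linear bijections compatible with the bracket and with the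
  \<open>p\<close>-map \<open>D \<mapsto> D\<^sup>p\<close>.\<close>

definition witt_aut :: "(('k, 'i) witt \<Rightarrow> ('k::field_prime_char, 'i::finite) witt) set" where
  "witt_aut = {g. Vector_Spaces.linear wscale wscale g \<and> bij g \<and>
    (\<forall>D E. g (wbracket D E) = wbracket (g D) (g E)) \<and>
    (\<forall>D. g (wpower D) = wpower (g D))}"

text \<open>The variables are indexed by a finite linear order; \<open>var_pos i\<close> is the number of the
  variable \<open>i\<close> when they are enumerated as \<open>x\<^sub>1, \<dots>, x\<^bsub>n-1\<^esub>\<close> in increasing order, so that
  \<open>n = CARD('i) + 1\<close>.\<close>

definition var_pos :: "'i::{finite, linorder} \<Rightarrow> nat" where
  "var_pos i = card {j. j \<le> i}"

definition D_eta :: "('i \<Rightarrow> 'k) \<Rightarrow> ('k::field_prime_char, 'i::{finite, linorder}) witt" where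
  "D_eta \<eta> =
    (\<Sum>i\<in>UNIV. wmult (\<Prod>j | j < i. tvar j ^ (CHAR('k) - 1)) (wpartial i)) +
    wmult (\<Prod>j\<in>UNIV. tvar j ^ (CHAR('k) - 1))
      (\<Sum>i\<in>UNIV. wscale ((-1) ^ (CARD('i) + 1 - var_pos i) * \<eta> i) (wpartial i))"

definition Omega1 :: "('k::field_prime_char, 'i::{finite, linorder}) witt set" where
  "Omega1 = {D_eta \<eta> | \<eta>. True}"


section \<open>Affine varieties, tangent maps and smoothness\<close>

text \<open>An affine variety over \<open>'k\<close> (algebraically closed) is given by its set of points and its
  coordinate ring, a finitely generated algebra of functions on the points. Functions are
  \<^const>\<open>undefined\<close> outside the points.\<close>

record ('x, 'k) variety =
  points :: "'x set"
  regular :: "('x \<Rightarrow> 'k) set"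

inductive_set fun_algebra :: "('x \<Rightarrow> 'k::field) set \<Rightarrow> ('x \<Rightarrow> 'k) set" for S where
  const: "(\<lambda>_. c) \<in> fun_algebra S"
| gen: "f \<in> S \<Longrightarrow> f \<in> fun_algebra S"
| add: "f \<in> fun_algebra S \<Longrightarrow> g \<in> fun_algebra S \<Longrightarrow> (\<lambda>x. f x + g x) \<in> fun_algebra S"
| mult: "f \<in> fun_algebra S \<Longrightarrow> g \<in> fun_algebra S \<Longrightarrow> (\<lambda>x. f x * g x) \<in> fun_algebra S"

definition variety_of :: "'x set \<Rightarrow> ('x \<Rightarrow> 'k::field) set \<Rightarrow> ('x, 'k) variety" where
  "variety_of X S = \<lparr>points = X, regular = (\<lambda>f. restrict f X) ` fun_algebra S\<rparr>"

definition coord_ring :: "('x, 'k::field) variety \<Rightarrow> ('x \<Rightarrow> 'k) ring" where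
  "coord_ring V = \<lparr>carrier = regular V,
    monoid.mult = (\<lambda>f g. \<lambda>x\<in>points V. f x * g x), one = (\<lambda>x\<in>points V. 1),
    zero = (\<lambda>x\<in>points V. 0), add = (\<lambda>f g. \<lambda>x\<in>points V. f x + g x)\<rparr>"

definition product_variety ::
  "('x, 'k::field) variety \<Rightarrow> ('y, 'k) variety \<Rightarrow> ('x \<times> 'y, 'k) variety" where
  "product_variety V W = variety_of (points V \<times> points W)
    ({\<lambda>z. f (fst z) | f. f \<in> regular V} \<union> {\<lambda>z. g (snd z) | g. g \<in> regular W})"

definition pullback :: "('x, 'k) variety \<Rightarrow> ('x \<Rightarrow> 'y) \<Rightarrow> ('y \<Rightarrow> 'k) \<Rightarrow> 'x \<Rightarrow> 'k" where
  "pullback V \<phi> h = restrict (h \<circ> \<phi>) (points V)"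

definition morphism :: "('x, 'k) variety \<Rightarrow> ('y, 'k) variety \<Rightarrow> ('x \<Rightarrow> 'y) \<Rightarrow> bool" where
  "morphism V W \<phi> \<longleftrightarrow> \<phi> \<in> points V \<rightarrow> points W \<and> pullback V \<phi> \<in> regular W \<rightarrow> regular V"

text \<open>The Zariski tangent space, as the space of point derivations of the coordinate ring.\<close>

definition tangent_space :: "('x, 'k::field) variety \<Rightarrow> 'x \<Rightarrow> (('x \<Rightarrow> 'k) \<Rightarrow> 'k) set" where
  "tangent_space V x = {\<delta> \<in> extensional (regular V).
    (\<forall>c. \<forall>f\<in>regular V. \<delta> (\<lambda>z\<in>points V. c * f z) = c * \<delta> f) \<and>
    (\<forall>f\<in>regular V. \<forall>g\<in>regular V. \<delta> (\<lambda>z\<in>points V. f z + g z) = \<delta> f + \<delta> g) \<and>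
    (\<forall>f\<in>regular V. \<forall>g\<in>regular V. \<delta> (\<lambda>z\<in>points V. f z * g z) = f x * \<delta> g + g x * \<delta> f)}"

definition tangent_map :: "('x, 'k) variety \<Rightarrow> ('y, 'k) variety \<Rightarrow> ('x \<Rightarrow> 'y) \<Rightarrow>
    (('x \<Rightarrow> 'k) \<Rightarrow> 'k) \<Rightarrow> ('y \<Rightarrow> 'k) \<Rightarrow> 'k" where
  "tangent_map V W \<phi> \<delta> = (\<lambda>h\<in>regular W. \<delta> (pullback V \<phi> h))"

text \<open>Smoothness of a ring homomorphism \<open>\<phi> : A \<rightarrow> B\<close> is formal smoothness (the infinitesimal
  lifting property against square-zero ideals \<open>J\<close> of \<open>A\<close>-algebras \<open>C\<close>) together with finite
  presentation. The coordinate rings of varieties are Noetherian, so there finite presentation amounts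
  to finite type. The test rings \<open>C\<close> range over all commutative rings with carrier in the type
  \<open>'c\<close>; a statement of smoothness for a free type variable \<open>'c\<close> covers all test rings.\<close>

definition formally_smooth ::
  "'c itself \<Rightarrow> ('a, 'm) ring_scheme \<Rightarrow> ('b, 'n) ring_scheme \<Rightarrow> ('a \<Rightarrow> 'b) \<Rightarrow> bool" where
  "formally_smooth _ A B \<phi> \<longleftrightarrow>
    (\<forall>(C :: 'c ring) J u v.
      cring C \<and> ideal J C \<and> (\<forall>a\<in>J. \<forall>b\<in>J. a \<otimes>\<^bsub>C\<^esub> b = \<zero>\<^bsub>C\<^esub>) \<and>
      u \<in> ring_hom A C \<and> v \<in> ring_hom B (C Quot J) \<and>
      (\<forall>a\<in>carrier A. v (\<phi> a) = J +>\<^bsub>C\<^esub> u a) \<longrightarrow>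
      (\<exists>w \<in> ring_hom B C.
        (\<forall>a\<in>carrier A. w (\<phi> a) = u a) \<and> (\<forall>b\<in>carrier B. v b = J +>\<^bsub>C\<^esub> w b)))"

definition finite_type :: "('a, 'm) ring_scheme \<Rightarrow> ('b, 'n) ring_scheme \<Rightarrow> ('a \<Rightarrow> 'b) \<Rightarrow> bool" where
  "finite_type A B \<phi> \<longleftrightarrow>
    (\<exists>F. finite F \<and> F \<subseteq> carrier B \<and> carrier B = generate_ring B (\<phi> ` carrier A \<union> F))"

definition smooth_morphism ::
  "'c itself \<Rightarrow> ('x, 'k::field) variety \<Rightarrow> ('y, 'k) variety \<Rightarrow> ('x \<Rightarrow> 'y) \<Rightarrow> bool" where
  "smooth_morphism c V W \<phi> \<longleftrightarrow> morphism V W \<phi> \<and>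
    formally_smooth c (coord_ring W) (coord_ring V) (pullback V \<phi>) \<and>
    finite_type (coord_ring W) (coord_ring V) (pullback V \<phi>)"


section \<open>The orbit map\<close>

definition witt_functionals :: "(('k::field_prime_char, 'i::finite) witt \<Rightarrow> 'k) set" where
  "witt_functionals = {l. Vector_Spaces.linear wscale (*) l}"

definition witt_variety :: "(('k::field_prime_char, 'i::finite) witt, 'k) variety" where
  "witt_variety = variety_of UNIV witt_functionals"

definition Omega1_variety :: "(('k::field_prime_char, 'i::{finite, linorder}) witt, 'k) variety" where
  "Omega1_variety = variety_of Omega1 witt_functionals"

text \<open>The closed subgroup structure inherited from the general linear group of the Witt algebra,
  whose coordinate ring is generated by the matrix coefficients of \<open>g\<close> and the inverse of the
  determinant, equivalently by the matrix coefficients of \<open>g\<close> and of the inverse of \<open>g\<close>.\<close>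

definition witt_aut_variety ::
  "(('k, 'i) witt \<Rightarrow> ('k::field_prime_char, 'i::finite) witt, 'k) variety" where
  "witt_aut_variety = variety_of witt_aut
    ({\<lambda>g. l (g D) | l D. l \<in> witt_functionals} \<union> {\<lambda>g. l (inv_into UNIV g D) | l D. l \<in> witt_functionals})"

definition orbit_source ::
  "((('k, 'i) witt \<Rightarrow> ('k::field_prime_char, 'i::{finite, linorder}) witt) \<times> ('k, 'i) witt, 'k) variety"
  where "orbit_source = product_variety witt_aut_variety Omega1_variety"

definition orbit_map :: "(('k, 'i) witt \<Rightarrow> ('k::field_prime_char, 'i::finite) witt) \<times> ('k, 'i) witt
    \<Rightarrow> ('k, 'i) witt" where
  "orbit_map = (\<lambda>(g, x). g x)"

end

theory Submission
  imports Defs "Jordan_Normal_Form.Determinant"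
begin

text \<open>
  Let \<open>B\<close> be the truncated polynomial ring in the variables \<open>x\<^sub>i\<close>, \<open>W\<close> its Lie algebra of derivations,
  \<open>W\<^sub>0\<close> the subalgebra of the derivations that preserve the maximal ideal of \<open>B\<close>, and \<open>x\<^sup>\<tau>\<close> the product of
  all \<open>x\<^sub>i\<^sup>p\<^sup>-\<^sup>1\<close>.

  At \<open>(\<phi>, \<D>\<^sub>\<eta>)\<close> a tangent vector of the source is a pair of some \<open>F \<in> W\<^sub>0\<close> and a direction \<open>c\<close> for \<open>\<eta>\<close>; its
  image under the orbit map is \<open>\<phi> . ([F, \<D>\<^sub>\<eta>] + \<Sum> \<plusminus>c\<^sub>i x\<^sup>\<tau> D\<^sub>i)\<close>. So surjectivity means that \<open>[F, \<D>\<^sub>\<eta>] = Y\<close> has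
  a solution modulo \<open>x\<^sup>\<tau>\<close> for every \<open>Y\<close>. Modulo \<open>x\<^sup>\<tau>\<close> the parameter \<open>\<eta>\<close> disappears, and the equation is
  triangular: the component along \<open>x\<^sub>i\<close> asks for \<open>\<D>\<^sub>0 f\<^sub>i = r\<^sub>i\<close>, where \<open>r\<^sub>i\<close> depends on \<open>Y\<close> and on the earlier
  components. As \<open>\<D>\<^sub>0\<close> acts on monomials, read as base \<open>p\<close> numerals, like the predecessor map, this can be
  solved up to the top monomial (\<open>linearised_orbit_solvable\<close>). The solution is linear in \<open>Y\<close>, so every
  constant vector field on \<open>W\<close> lifts to a regular vector field on the source
  (\<open>lifted_deriv_orbit_map\<close>). Its values give the surjectivity of all tangent maps.

  For smoothness the coordinate ring of the source has to be known. It is that of the reduced group of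
  all restricted automorphisms of \<open>W\<close>, so the first point is that these are the automorphisms of
  \<open>B\<close> (\<open>witt_aut_eq_wconj\<close>). An automorphism \<open>g\<close> preserves the set of sandwich elements \<open>c\<close>, defined by
  \<open>(ad c)\<^sup>2 = 0\<close>, and \<open>W\<^sub>0\<close> is the normalizer of their span, so \<open>g\<close> preserves \<open>W\<^sub>0\<close>. As \<open>g\<close> is restricted, the
  derivations \<open>g(D\<^sub>i)\<close> commute and have \<open>p\<close>-th power \<open>0\<close>, and such derivations have dual coordinates in \<open>B\<close>
  (\<open>dual_coordinates\<close>). The change of variables to these coordinates agrees with \<open>g\<close> on all \<open>D\<^sub>i\<close>, hence
  everywhere.

  The source is therefore the principal open set, in an affine space with coordinates the coefficients of
  the \<open>\<phi>(x\<^sub>j)\<close> and the \<open>\<eta>\<^sub>j\<close>, on which the determinant of \<open>\<phi>\<close> does not vanish, also as far as regular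
  functions are concerned (\<open>regular_orbit_source_iff\<close>). Given a lifting problem against a square-zero
  ideal, coordinates can be lifted arbitrarily, which gives a homomorphism on the coordinate ring of the
  source that is compatible with the constants. It differs from the given homomorphism on the coordinate
  ring of \<open>W\<close> by a derivation into the ideal, and the lifted vector fields extend this derivation to the
  source (\<open>corrected_lift\<close>).
\<close>

section \<open>The truncated polynomial ring\<close>

abbreviation lk :: "('a \<Rightarrow>\<^sub>0 'b::zero) \<Rightarrow> 'a \<Rightarrow> 'b" where "lk \<equiv> Poly_Mapping.lookup"

text \<open>The exponents of the monomials that form a basis of the truncated polynomial ring.\<close>

definition reduced :: "nat \<Rightarrow> ('i \<Rightarrow>\<^sub>0 nat) set" where
  "reduced p = {a. \<forall>i. lk a i < p}"

lemma finite_reduced [simp]: "finite (reduced p :: ('i::finite \<Rightarrow>\<^sub>0 nat) set)"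
proof -
  have "lk ` (reduced p :: ('i \<Rightarrow>\<^sub>0 nat) set) \<subseteq> PiE UNIV (\<lambda>_. {..<p})"
    by (auto simp: reduced_def)
  then have "finite (lk ` (reduced p :: ('i \<Rightarrow>\<^sub>0 nat) set))"
    by (rule finite_subset) (simp add: finite_PiE)
  moreover have "inj_on lk (reduced p :: ('i \<Rightarrow>\<^sub>0 nat) set)"
    by (auto simp: inj_on_def)
  ultimately show ?thesis by (rule finite_imageD)
qed

lemma zero_reduced [simp]: "0 \<in> reduced CHAR('k::field_prime_char)"
  by (simp add: reduced_def)

lemma prime_CHAR: "prime CHAR('k::field_prime_char)"
  by simp

lemma lookup_pth_power_ideal:
  fixes f :: "('k::field_prime_char, 'i::finite) mpoly"
  assumes "f \<in> pth_power_ideal" "a \<in> reduced CHAR('k)"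
  shows "lk f a = 0"
proof -
  from assms obtain q :: "'i \<Rightarrow> ('k, 'i) mpoly"
    where q: "f = (\<Sum>i\<in>UNIV. q i * mvar i ^ CHAR('k))" unfolding pth_power_ideal_iff by blast
  have "a \<notin> Poly_Mapping.keys (q i * mvar i ^ CHAR('k))" for i
  proof
    assume "a \<in> Poly_Mapping.keys (q i * mvar i ^ CHAR('k))"
    then obtain c b where "a = c + b" "b \<in> Poly_Mapping.keys (mvar i ^ CHAR('k) :: ('k, 'i) mpoly)"
      using keys_mult[of "q i" "mvar i ^ CHAR('k)"] by blast
    then have "lk a i = lk (c + Poly_Mapping.single i CHAR('k)) i"
      by (simp add: mvar_power)
    then show False using assms(2) unfolding reduced_def by (simp add: lookup_add) (metis not_add_less2)
  qed
  then show ?thesis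
    by (subst q) (simp add: lookup_sum in_keys_iff)
qed

text \<open>Only at reduced exponents is the coefficient the same for all representatives.\<close>

definition tcoeff :: "('k::field_prime_char, 'i::finite) trunc_poly \<Rightarrow> ('i \<Rightarrow>\<^sub>0 nat) \<Rightarrow> 'k" where
  "tcoeff f a = (if a \<in> reduced CHAR('k) then lk (rep_trunc_poly f) a else 0)"

definition tmon :: "('i \<Rightarrow>\<^sub>0 nat) \<Rightarrow> ('k::field_prime_char, 'i::finite) trunc_poly" where
  "tmon a = abs_trunc_poly (Poly_Mapping.single a 1)"

lemma tcoeff_abs:
  fixes q :: "('k::field_prime_char, 'i::finite) mpoly"
  shows "tcoeff (abs_trunc_poly q) a = (if a \<in> reduced CHAR('k) then lk q a else 0)"
proof -
  have "rep_trunc_poly (abs_trunc_poly q) - q \<in> pth_power_ideal"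
    by (rule rep_abs_rsp_left[OF Quotient3_trunc_poly]) (simp add: pth_power_ideal_0)
  then show ?thesis
    using lookup_pth_power_ideal[of "rep_trunc_poly (abs_trunc_poly q) - q" a]
    by (simp add: tcoeff_def lookup_minus)
qed

lemma abs_trunc_poly_cases: obtains q where "f = abs_trunc_poly q"
  by (rule that[OF Quotient3_abs_rep[OF Quotient3_trunc_poly, symmetric]])

lemmas trunc_poly_abs_eq = plus_trunc_poly.abs_eq uminus_trunc_poly.abs_eq minus_trunc_poly.abs_eq
  zero_trunc_poly.abs_eq one_trunc_poly.abs_eq times_trunc_poly.abs_eq tconst.abs_eq tvar.abs_eq tpderiv.abs_eq

lemma tcoeff_add [simp]: "tcoeff (f + g) a = tcoeff f a + tcoeff g a"
  by (cases f rule: abs_trunc_poly_cases; cases g rule: abs_trunc_poly_cases)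
     (simp add: trunc_poly_abs_eq tcoeff_abs lookup_add)

lemma tcoeff_uminus [simp]: "tcoeff (- f) a = - tcoeff f a"
  by (cases f rule: abs_trunc_poly_cases) (simp add: trunc_poly_abs_eq tcoeff_abs)

lemma tcoeff_diff [simp]: "tcoeff (f - g) a = tcoeff f a - tcoeff g a"
  using tcoeff_add[of f "- g" a] by simp

lemma tcoeff_0 [simp]: "tcoeff 0 a = 0"
  by (simp add: trunc_poly_abs_eq tcoeff_abs)

lemma tcoeff_sum [simp]: "tcoeff (sum f A) a = (\<Sum>x\<in>A. tcoeff (f x) a)"
  by (induction A rule: infinite_finite_induct) simp_all

lemma lookup_mconst_mult: "lk (mconst c * f) a = c * lk f a"
proof (induction f rule: mpoly_induct)
  case (single b d)
  then show ?case by (simp add: mconst_def mult_single lookup_single when_def)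
next
  case (add f g)
  then show ?case by (simp add: distrib_left lookup_add)
qed

lemma tcoeff_tscale [simp]: "tcoeff (tscale c f) a = c * tcoeff f a"
  by (cases f rule: abs_trunc_poly_cases)
     (simp add: trunc_poly_abs_eq tcoeff_abs tscale_def lookup_mconst_mult)

lemma tcoeff_tconst_mult [simp]: "tcoeff (tconst c * f) a = c * tcoeff f a"
  using tcoeff_tscale by (simp add: tscale_def)

lemma tmon_0 [simp]: "tmon 0 = 1"
  by (simp add: tmon_def trunc_poly_abs_eq)

lemma tmon_add: "tmon (a + b) = tmon a * tmon b"
  by (simp add: tmon_def trunc_poly_abs_eq mult_single)

lemma tmon_single_1: "tmon (Poly_Mapping.single i 1) = tvar i"
  by (simp add: tmon_def trunc_poly_abs_eq mvar_def)

lemma tmon_single: "tmon (Poly_Mapping.single i n) = tvar i ^ n"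
proof (induction n)
  case (Suc n)
  have "Poly_Mapping.single i (Suc n) = Poly_Mapping.single i 1 + Poly_Mapping.single i n"
    by (simp flip: single_add)
  then show ?case by (simp only: tmon_add tmon_single_1 Suc.IH power_Suc)
qed simp

lemma tmon_sum: "finite A \<Longrightarrow> tmon (sum f A) = (\<Prod>x\<in>A. tmon (f x))"
  by (induction A rule: finite_induct) (simp_all add: tmon_add)

lemma exponent_sum: "a = (\<Sum>i\<in>UNIV. Poly_Mapping.single i (lk a i))"
  for a :: "'i::finite \<Rightarrow>\<^sub>0 nat"
  by (rule poly_mapping_eqI) (simp add: lookup_sum lookup_single when_def)

lemma tmon_prod: "tmon a = (\<Prod>i\<in>UNIV. tvar i ^ lk a i)"
  by (subst exponent_sum) (simp add: tmon_sum tmon_single)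

lemma tvar_CHAR [simp]: "(tvar i :: ('k::field_prime_char, 'i::finite) trunc_poly) ^ CHAR('k) = 0"
proof -
  have "mvar i ^ CHAR('k) = (\<Sum>j\<in>UNIV. (if j = i then 1 else 0) * mvar j ^ CHAR('k) :: ('k, 'i) mpoly)"
    by (simp add: if_distrib if_distribR cong: if_cong)
  then have *: "mvar i ^ CHAR('k) \<in> (pth_power_ideal :: ('k, 'i) mpoly set)"
    unfolding pth_power_ideal_iff by (rule exI[of _ "\<lambda>j. if j = i then 1 else 0"])
  then have "abs_trunc_poly (mvar i ^ CHAR('k)) = (0 :: ('k, 'i) trunc_poly)"
    by (simp add: zero_trunc_poly_def trunc_poly.abs_eq_iff)
  then show ?thesis unfolding tmon_single[symmetric]
    by (simp add: tmon_def mvar_power)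
qed

lemma tvar_power_zero: "CHAR('k) \<le> n \<Longrightarrow> (tvar i :: ('k::field_prime_char, 'i::finite) trunc_poly) ^ n = 0"
  by (metis le_add_diff_inverse mult_zero_left power_add tvar_CHAR)

lemma tmon_not_reduced:
  fixes a :: "'i::finite \<Rightarrow>\<^sub>0 nat"
  assumes "a \<notin> reduced CHAR('k::field_prime_char)"
  shows "(tmon a :: ('k, 'i) trunc_poly) = 0"
proof -
  from assms obtain i where "CHAR('k) \<le> lk a i"
    by (auto simp: reduced_def not_less)
  then have "(tvar i :: ('k, 'i) trunc_poly) ^ lk a i = 0"
    by (rule tvar_power_zero)
  then show ?thesis unfolding tmon_prod
    by (auto intro!: prod_zero)
qed

lemma tcoeff_tmon:
  "tcoeff (tmon b :: ('k::field_prime_char, 'i::finite) trunc_poly) a =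
    (if a = b \<and> a \<in> reduced CHAR('k) then 1 else 0)"
  by (simp add: tmon_def tcoeff_abs lookup_single when_def)

lemma tcoeff_not_reduced: "a \<notin> reduced CHAR('k) \<Longrightarrow>
    tcoeff (f :: ('k::field_prime_char, 'i::finite) trunc_poly) a = 0"
  by (simp add: tcoeff_def)

lemma trunc_poly_induct [case_names mon add]:
  fixes f :: "('k::field_prime_char, 'i::finite) trunc_poly"
  assumes "\<And>c a. P (tscale c (tmon a))" "\<And>f g. P f \<Longrightarrow> P g \<Longrightarrow> P (f + g)"
  shows "P f"
proof -
  have "P (abs_trunc_poly q)" for q :: "('k, 'i) mpoly"
  proof (induction q rule: mpoly_induct)
    case (single a c)
    have "abs_trunc_poly (Poly_Mapping.single a c) = tscale c (tmon a)"
      unfolding tscale_def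
      by (simp add: trunc_poly_abs_eq tmon_def mconst_def mult_single)
    then show ?case using assms(1) by simp
  next
    case (add f g)
    then show ?case using assms(2) by (simp flip: plus_trunc_poly.abs_eq)
  qed
  then show ?thesis
    by (metis abs_trunc_poly_cases)
qed

lemma tconst_0 [simp]: "tconst 0 = 0"
  using tconst_add[of 0 0] by simp

lemma tconst_sum: "tconst (sum f A) = (\<Sum>x\<in>A. tconst (f x))"
  by (induction A rule: infinite_finite_induct) (simp_all add: tconst_add)

lemma tscale_simps [simp]: "tscale 0 f = 0" "tscale c 0 = 0" "tscale 1 f = f"
  by (simp_all add: tscale_def tconst_1)

lemma tscale_add: "tscale c (f + g) = tscale c f + tscale c g" "tscale (c + d) f = tscale c f + tscale d f"
  by (simp_all add: tscale_def tconst_add algebra_simps)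

lemma tscale_sum: "tscale c (sum f A) = (\<Sum>x\<in>A. tscale c (f x))"
  by (induction A rule: infinite_finite_induct) (simp_all add: tscale_add)

lemma trunc_poly_expand:
  "f = (\<Sum>a\<in>reduced CHAR('k). tscale (tcoeff f a) (tmon a))"
  for f :: "('k::field_prime_char, 'i::finite) trunc_poly"
proof (induction f rule: trunc_poly_induct)
  case (mon c b)
  show ?case
  proof (cases "b \<in> reduced CHAR('k)")
    case True
    have "(\<Sum>a\<in>reduced CHAR('k). tscale (tcoeff (tscale c (tmon b)) a) (tmon a)) =
      (\<Sum>a\<in>reduced CHAR('k). if a = b then tscale c (tmon b) else (0 :: ('k, 'i) trunc_poly))"
      by (intro sum.cong) (simp_all add: tcoeff_tmon)
    then show ?thesis using True by simp
  next
    case False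
    then show ?thesis by (simp add: tmon_not_reduced)
  qed
next
  case (add f g)
  then show ?case by (simp add: tscale_add sum.distrib)
qed

lemma tcoeff_eqI:
  fixes f g :: "('k::field_prime_char, 'i::finite) trunc_poly"
  assumes "\<And>a. a \<in> reduced CHAR('k) \<Longrightarrow> tcoeff f a = tcoeff g a"
  shows "f = g"
  by (subst trunc_poly_expand, subst (2) trunc_poly_expand) (simp add: assms)

lemma trunc_poly_gen_induct [case_names const var add mult]:
  fixes f :: "('k::field_prime_char, 'i::finite) trunc_poly"
  assumes "\<And>c. P (tconst c)" "\<And>i. P (tvar i)" "\<And>f g. P f \<Longrightarrow> P g \<Longrightarrow> P (f + g)"
    "\<And>f g. P f \<Longrightarrow> P g \<Longrightarrow> P (f * g)"
  shows "P f"
proof (induction f rule: trunc_poly_induct)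
  case (mon c a)
  have 1: "P 1" using assms(1)[of 1] by (simp add: tconst_1)
  have pow: "P (tvar i ^ n)" for i n
    by (induction n) (simp_all add: 1 assms(2,4))
  have "P (\<Prod>i\<in>A. tvar i ^ lk a i)" for A
    by (induction A rule: infinite_finite_induct) (simp_all add: 1 assms(4) pow)
  then have "P (tmon a)" by (simp add: tmon_prod)
  then show ?case by (simp add: tscale_def assms)
qed (rule assms(3))

lemma CHAR_trunc_poly: "CHAR(('k::field_prime_char, 'i::finite) trunc_poly) = CHAR('k)"
proof -
  have "CHAR(('k, 'i) trunc_poly) dvd CHAR('k)"
    by (simp add: of_nat_CHAR_trunc_poly flip: of_nat_eq_0_iff_char_dvd)
  moreover have "CHAR(('k, 'i) trunc_poly) \<noteq> 1"
    using of_nat_CHAR[where 'a = "('k, 'i) trunc_poly"] by (metis of_nat_1 zero_neq_one)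
  ultimately show ?thesis
    using prime_CHAR[where 'k='k] prime_nat_iff by blast
qed

definition eps :: "('k::field_prime_char, 'i::finite) trunc_poly \<Rightarrow> 'k" where
  "eps f = tcoeff f 0"

lemma eps_simps [simp]: "eps (f + g) = eps f + eps g" "eps (f - g) = eps f - eps g" "eps (- f) = - eps f"
  "eps 0 = 0" "eps (tscale c f) = c * eps f" "eps (sum h A) = (\<Sum>x\<in>A. eps (h x))"
  by (simp_all add: eps_def)

lemma eps_tmon: "eps (tmon a) = (if a = 0 then 1 else 0)"
  by (auto simp: eps_def tcoeff_tmon)

lemma eps_1 [simp]: "eps 1 = 1"
  using eps_tmon[of 0] by simp

lemma eps_tconst [simp]: "eps (tconst c) = c"
  using eps_simps(5)[of c 1] by (simp only: tscale_def) simp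

lemma eps_tvar [simp]: "eps (tvar i) = 0"
  using eps_tmon[of "Poly_Mapping.single i 1"]
  by (metis lookup_single_eq lookup_zero tmon_single_1 zero_neq_one)

lemma exponent_add_0: "a + b = 0 \<longleftrightarrow> a = 0 \<and> b = 0" for a b :: "'i \<Rightarrow>\<^sub>0 nat"
  by (auto simp: poly_mapping_eq_iff fun_eq_iff lookup_add)

lemma eps_mult [simp]: "eps (f * g) = eps f * eps g"
proof (induction f rule: trunc_poly_induct)
  case (mon c a)
  show ?case
  proof (induction g rule: trunc_poly_induct)
    case (mon d b)
    have "tscale c (tmon a) * tscale d (tmon b) = tscale (c * d) (tmon (a + b))"
      by (simp add: tscale_def tmon_add tconst_mult mult_ac)
    then show ?case by (simp add: eps_tmon exponent_add_0)
  qed (simp add: distrib_left)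
qed (simp add: distrib_right)

lemma eps_power [simp]: "eps (f ^ n) = eps f ^ n"
  by (induction n) simp_all

lemma tmon_power: "tmon a ^ n = tmon (\<Sum>i\<in>UNIV. Poly_Mapping.single i (n * lk a i))"
  by (simp add: tmon_prod prod_power_distrib lookup_sum lookup_single when_def power_mult[symmetric] mult.commute)

text \<open>The maximal ideal is nil because the Frobenius map sends every nonconstant monomial to \<open>0\<close>.\<close>

lemma nil_maximal_ideal:
  fixes f :: "('k::field_prime_char, 'i::finite) trunc_poly"
  assumes "eps f = 0" shows "f ^ CHAR('k) = 0"
proof -
  have "f ^ CHAR('k) = (\<Sum>a\<in>reduced CHAR('k). tscale (tcoeff f a) (tmon a)) ^ CHAR('k)"
    by (subst trunc_poly_expand[of f]) simp
  also have "\<dots> = (\<Sum>a\<in>reduced CHAR('k). tscale (tcoeff f a) (tmon a) ^ CHAR('k))"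
    by (rule freshmans_dream_sum) (simp_all add: CHAR_trunc_poly)
  also have "\<dots> = 0"
  proof (intro sum.neutral ballI)
    fix a :: "'i \<Rightarrow>\<^sub>0 nat" assume "a \<in> reduced CHAR('k)"
    show "tscale (tcoeff f a) (tmon a) ^ CHAR('k) = 0"
    proof (cases "a = 0")
      case True
      then show ?thesis using assms by (simp add: eps_def power_0_left)
    next
      case False
      then obtain i where "lk a i \<noteq> 0" by (auto simp: poly_mapping_eq_iff fun_eq_iff)
      then have "CHAR('k) \<le> lk (\<Sum>i\<in>UNIV. Poly_Mapping.single i (CHAR('k) * lk a i)) i"
        by (simp add: lookup_sum lookup_single when_def)
      then have "(\<Sum>i\<in>UNIV. Poly_Mapping.single i (CHAR('k) * lk a i)) \<notin> reduced CHAR('k)"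
        unfolding reduced_def using linorder_not_le by blast
      then show ?thesis
        by (simp add: tscale_def power_mult_distrib tmon_power tmon_not_reduced)
    qed
  qed
  finally show ?thesis .
qed

definition alg_hom :: "(('k, 'i) trunc_poly \<Rightarrow> ('k::field_prime_char, 'i::finite) trunc_poly) \<Rightarrow> bool" where
  "alg_hom \<phi> \<longleftrightarrow> (\<forall>f g. \<phi> (f + g) = \<phi> f + \<phi> g) \<and> (\<forall>f g. \<phi> (f * g) = \<phi> f * \<phi> g) \<and> (\<forall>c. \<phi> (tconst c) = tconst c)"

lemma alg_homD:
  assumes "alg_hom \<phi>"
  shows "\<phi> (f + g) = \<phi> f + \<phi> g" "\<phi> (f * g) = \<phi> f * \<phi> g" "\<phi> (tconst c) = tconst c"
    "\<phi> 1 = 1" "\<phi> 0 = 0" "\<phi> (tscale c f) = tscale c (\<phi> f)" "\<phi> (- f) = - \<phi> f" "\<phi> (f - g) = \<phi> f - \<phi> g"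
    "\<phi> (f ^ n) = \<phi> f ^ n"
proof -
  show add: "\<phi> (f + g) = \<phi> f + \<phi> g" and mult: "\<phi> (f * g) = \<phi> f * \<phi> g"
    and const: "\<phi> (tconst c) = tconst c" for f g c
    using assms by (auto simp: alg_hom_def)
  show 1: "\<phi> 1 = 1" using const[of 1] by (simp add: tconst_1)
  show 0: "\<phi> 0 = 0" using const[of 0] by simp
  show "\<phi> (tscale c f) = tscale c (\<phi> f)" by (simp add: tscale_def mult const)
  show minus: "\<phi> (- f) = - \<phi> f" for f
    using add[of f "- f"] 0 by (simp add: eq_neg_iff_add_eq_0 add.commute)
  show "\<phi> (f - g) = \<phi> f - \<phi> g"
    using add[of f "- g"] minus by simp
  show "\<phi> (f ^ n) = \<phi> f ^ n"
    by (induction n) (simp_all add: 1 mult)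
qed

lemma alg_hom_ext:
  assumes "alg_hom \<phi>" "alg_hom \<psi>" "\<And>i. \<phi> (tvar i) = \<psi> (tvar i)"
  shows "\<phi> = \<psi>"
proof
  fix f show "\<phi> f = \<psi> f"
    by (induction f rule: trunc_poly_gen_induct) (simp_all add: alg_homD assms)
qed

text \<open>The variables are nilpotent, hence so are their images.\<close>

lemma alg_hom_eps:
  assumes "alg_hom \<phi>" shows "eps (\<phi> f) = eps f"
proof (induction f rule: trunc_poly_gen_induct)
  case (var i)
  have "eps (\<phi> (tvar i) ^ CHAR('a)) = 0"
    by (simp only: alg_homD(9)[OF assms, symmetric] tvar_CHAR alg_homD(5)[OF assms] eps_simps)
  then show ?case by (simp del: eps_power add: eps_power)
qed (simp_all add: alg_homD[OF assms])

text \<open>Substitution is defined on the basis of monomials, hence linear for every \<open>y\<close>; it is multiplicative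
  once all \<open>y\<^sub>i\<close> lie in the maximal ideal, because then \<open>y\<^sub>i\<^sup>p = 0\<close>.\<close>

definition tsubst :: "('i \<Rightarrow> ('k, 'i) trunc_poly) \<Rightarrow> ('k, 'i) trunc_poly \<Rightarrow> ('k::field_prime_char, 'i::finite) trunc_poly" where
  "tsubst y f = (\<Sum>a\<in>reduced CHAR('k). tscale (tcoeff f a) (\<Prod>i\<in>UNIV. y i ^ lk a i))"

lemma tsubst_add: "tsubst y (f + g) = tsubst y f + tsubst y g"
  by (simp add: tsubst_def tscale_add sum.distrib)

lemma tscale_tscale [simp]: "tscale c (tscale d f) = tscale (c * d) f"
  by (simp add: tscale_def tconst_mult mult_ac)

lemma tsubst_tscale: "tsubst y (tscale c f) = tscale c (tsubst y f)"
  by (simp add: tsubst_def tscale_sum)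

lemma tsubst_tmon:
  fixes y :: "'i::finite \<Rightarrow> ('k::field_prime_char, 'i) trunc_poly"
  assumes "\<And>i. eps (y i) = 0"
  shows "tsubst y (tmon a) = (\<Prod>i\<in>UNIV. y i ^ lk a i)"
proof (cases "a \<in> reduced CHAR('k)")
  case True
  have "tsubst y (tmon a) = (\<Sum>b\<in>reduced CHAR('k). if b = a then \<Prod>i\<in>UNIV. y i ^ lk a i else 0)"
    unfolding tsubst_def by (intro sum.cong) (simp_all add: tcoeff_tmon)
  then show ?thesis using True by simp
next
  case False
  then obtain i where "CHAR('k) \<le> lk a i"
    by (auto simp: reduced_def not_less)
  then have "y i ^ lk a i = 0"
    using nil_maximal_ideal[of "y i"] assms
    by (metis le_add_diff_inverse mult_zero_left power_add)
  then have "(\<Prod>i\<in>UNIV. y i ^ lk a i) = 0"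
    by (auto intro!: prod_zero)
  then show ?thesis using False by (simp add: tmon_not_reduced tsubst_def)
qed

lemma alg_hom_tsubst:
  fixes y :: "'i::finite \<Rightarrow> ('k::field_prime_char, 'i) trunc_poly"
  assumes y: "\<And>i. eps (y i) = 0"
  shows "alg_hom (tsubst y)"
  unfolding alg_hom_def
proof (intro conjI allI)
  fix f g :: "('k, 'i) trunc_poly" and c
  show "tsubst y (f + g) = tsubst y f + tsubst y g" by (rule tsubst_add)
  have "tsubst y (tscale c (tmon 0)) = tscale c (tsubst y (tmon 0))"
    by (rule tsubst_tscale)
  then show "tsubst y (tconst c) = tconst c"
    by (simp only: tsubst_tmon[OF y]) (simp add: tscale_def)
  show "tsubst y (f * g) = tsubst y f * tsubst y g"
  proof (induction f rule: trunc_poly_induct)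
    case (mon c a)
    show ?case
    proof (induction g rule: trunc_poly_induct)
      case (mon d b)
      have "tscale c (tmon a) * tscale d (tmon b) = tscale (c * d) (tmon (a + b) :: ('k, 'i) trunc_poly)"
        by (simp add: tscale_def tmon_add tconst_mult mult_ac)
      then show ?case
        by (simp only: tsubst_tscale tsubst_tmon[OF y])
          (simp add: tscale_def tconst_mult lookup_add power_add prod.distrib mult_ac)
    qed (simp add: distrib_left tsubst_add)
  qed (simp add: distrib_right tsubst_add)
qed

lemma tsubst_tvar:
  assumes "\<And>i. eps (y i) = 0"
  shows "tsubst y (tvar j) = y j"
proof -
  have "(\<Prod>i\<in>UNIV. y i ^ lk (Poly_Mapping.single j 1) i) = (\<Prod>i\<in>UNIV. if i = j then y j else 1)"
    by (intro prod.cong) (auto simp: lookup_single when_def)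
  then show ?thesis
    using tsubst_tmon[OF assms, where a = "Poly_Mapping.single j 1"] by (simp only: tmon_single_1) simp
qed

section \<open>Derivations\<close>

lemma wapply_simps [simp]:
  "wapply D (f + g) = wapply D f + wapply D g"
  "wapply D (tconst c) = 0" "wapply D 0 = 0" "wapply D (f - g) = wapply D f - wapply D g"
  "wapply D (- f) = - wapply D f" "wapply D (tscale c f) = tscale c (wapply D f)" "wapply D 1 = 0"
  using derivationD[OF derivation_wapply[of D]] by (simp_all add: tscale_def flip: tconst_1)

lemma wapply_mult: "wapply D (f * g) = wapply D f * g + f * wapply D g"
  using derivationD(2)[OF derivation_wapply[of D]] .

lemma wapply_sum [simp]: "wapply D (sum f A) = (\<Sum>x\<in>A. wapply D (f x))"
  by (induction A rule: infinite_finite_induct) simp_all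

lemma wapply_power: "wapply D (f ^ n) = of_nat n * f ^ (n - 1) * wapply D f"
proof (induction n)
  case (Suc n)
  then show ?case by (cases n) (simp_all add: wapply_mult algebra_simps)
qed simp

lemma wapply_witt [simp]:
  "wapply (D + E) f = wapply D f + wapply E f" "wapply (- D) f = - wapply D f"
  "wapply (D - E) f = wapply D f - wapply E f" "wapply 0 f = 0"
  "wapply (wmult b D) f = b * wapply D f" "wapply (wscale c D) f = tscale c (wapply D f)"
  by (simp_all add: plus_witt.rep_eq uminus_witt.rep_eq minus_witt.rep_eq zero_witt.rep_eq
      wapply_wmult wscale_def tscale_def)

lemma wapply_sum_witt [simp]: "wapply (sum D A) f = (\<Sum>x\<in>A. wapply (D x) f)"
  by (induction A rule: infinite_finite_induct) simp_all

lemma wapply_wbracket [simp]: "wapply (wbracket D E) f = wapply D (wapply E f) - wapply E (wapply D f)"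
  by (simp add: wbracket.rep_eq)

lemma wapply_wpartial: "wapply (wpartial i) = tpderiv i"
  by (simp add: wpartial.rep_eq)

lemma witt_eqI: "(\<And>f. wapply D f = wapply E f) \<Longrightarrow> D = E"
  by (simp add: wapply_inject[symmetric] fun_eq_iff)

lemma witt_eqI_var:
  assumes "\<And>i. wapply D (tvar i) = wapply E (tvar i)" shows "D = E"
proof (rule witt_eqI)
  fix f show "wapply D f = wapply E f"
    by (induction f rule: trunc_poly_gen_induct) (simp_all add: wapply_mult assms)
qed

lemma tpderiv_tmon:
  "tpderiv i (tmon a) = tscale (of_nat (lk a i)) (tmon (a - Poly_Mapping.single i 1))"
  by (simp add: tscale_def tmon_def trunc_poly_abs_eq mpderiv_single mconst_def mult_single
      del: single_of_nat)

lemma tpderiv_tvar [simp]: "tpderiv i (tvar j) = (if i = j then 1 else 0)"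
  unfolding tmon_single_1[symmetric] tpderiv_tmon
  by (auto simp: lookup_single when_def)

definition wfield :: "('i \<Rightarrow> ('k, 'i) trunc_poly) \<Rightarrow> ('k::field_prime_char, 'i::finite) witt" where
  "wfield f = (\<Sum>i\<in>UNIV. wmult (f i) (wpartial i))"

lemma wapply_wfield_tvar [simp]: "wapply (wfield f) (tvar j) = f j"
  by (simp add: wfield_def wapply_wpartial if_distrib cong: if_cong)

definition wbasis :: "'i \<times> ('i \<Rightarrow>\<^sub>0 nat) \<Rightarrow> ('k::field_prime_char, 'i::finite) witt" where
  "wbasis r = wmult (tmon (snd r)) (wpartial (fst r))"

definition wcoord :: "'i \<times> ('i \<Rightarrow>\<^sub>0 nat) \<Rightarrow> ('k::field_prime_char, 'i::finite) witt \<Rightarrow> 'k" where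
  "wcoord r D = tcoeff (wapply D (tvar (fst r))) (snd r)"

lemma wapply_wbasis_tvar: "wapply (wbasis (i, a)) (tvar j) = (if i = j then tmon a else 0)"
  by (simp add: wbasis_def wapply_wpartial)

lemma wcoord_simps [simp]: "wcoord r (D + E) = wcoord r D + wcoord r E" "wcoord r (wscale c D) = c * wcoord r D"
  "wcoord r (D - E) = wcoord r D - wcoord r E" "wcoord r 0 = 0"
  by (simp_all add: wcoord_def)

lemma witt_expand:
  "D = (\<Sum>r\<in>UNIV \<times> reduced CHAR('k). wscale (wcoord r D) (wbasis r))"
  for D :: "('k::field_prime_char, 'i::finite) witt"
proof (rule witt_eqI_var)
  fix j
  have "wapply (\<Sum>r\<in>UNIV \<times> reduced CHAR('k). wscale (wcoord r D) (wbasis r)) (tvar j) =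
    (\<Sum>i\<in>UNIV. \<Sum>a\<in>reduced CHAR('k). tscale (wcoord (i, a) D) (wapply (wbasis (i, a)) (tvar j)))"
    by (simp add: sum.cartesian_product)
  also have "\<dots> = (\<Sum>i\<in>UNIV. if i = j then \<Sum>a\<in>reduced CHAR('k). tscale (wcoord (i, a) D) (tmon a) else 0)"
    by (intro sum.cong refl) (simp add: wapply_wbasis_tvar)
  also have "\<dots> = wapply D (tvar j)"
    by (subst (2) trunc_poly_expand) (simp add: wcoord_def)
  finally show "wapply D (tvar j) = wapply (\<Sum>r\<in>UNIV \<times> reduced CHAR('k). wscale (wcoord r D) (wbasis r)) (tvar j)"
    by simp
qed

lemma wcoord_wbasis: "s \<in> UNIV \<times> reduced CHAR('k) \<Longrightarrow>
    wcoord r (wbasis s :: ('k::field_prime_char, 'i::finite) witt) = (if r = s then 1 else 0)"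
  by (cases r; cases s) (auto simp: wcoord_def wapply_wbasis_tvar tcoeff_tmon)

definition wlin :: "(('k::field_prime_char, 'i::finite) witt \<Rightarrow> 'k) \<Rightarrow> bool" where
  "wlin l \<longleftrightarrow> (\<forall>D E. l (D + E) = l D + l E) \<and> (\<forall>c D. l (wscale c D) = c * l D)"

lemma witt_functionals_iff: "l \<in> witt_functionals \<longleftrightarrow> wlin l"
proof -
  have "vector_space ((*) :: 'a \<Rightarrow> 'a \<Rightarrow> 'a)"
    by standard (simp_all add: algebra_simps)
  then show ?thesis
    by (auto simp: witt_functionals_def wlin_def Vector_Spaces.linear_def module_hom_def
      module_hom_axioms_def vector_space_wscale module_iff_vector_space)
qed

lemma witt_linear_iff: "Vector_Spaces.linear wscale wscale g \<longleftrightarrow>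
    (\<forall>D E. g (D + E) = g D + g E) \<and> (\<forall>c D. g (wscale c D) = wscale c (g D))"
  by (auto simp: Vector_Spaces.linear_def module_hom_def
      module_hom_axioms_def vector_space_wscale module_iff_vector_space)

lemma wlin_wcoord: "wlin (wcoord r)"
  by (simp add: wlin_def)

lemma wlin_sum: "wlin l \<Longrightarrow> l (sum f A) = (\<Sum>x\<in>A. l (f x))"
proof (induction A rule: infinite_finite_induct)
  have "l (wscale 0 0) = 0" if "wlin l" for l :: "('a, 'b) witt \<Rightarrow> 'a"
    using that unfolding wlin_def by (metis mult_zero_left)
  moreover have "wscale 0 0 = (0 :: ('a, 'b) witt)"
    by (rule witt_eqI) simp
  ultimately have 0: "wlin l \<Longrightarrow> l 0 = 0" by simp
  { case (infinite A) then show ?case using 0 by simp }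
  { case empty then show ?case using 0 by simp }
  case (insert x F)
  then show ?case by (simp add: wlin_def)
qed

lemma wlin_expand:
  fixes D :: "('k::field_prime_char, 'i::finite) witt"
  assumes "wlin l"
  shows "l D = (\<Sum>r\<in>UNIV \<times> reduced CHAR('k). wcoord r D * l (wbasis r))"
proof -
  have "l D = l (\<Sum>r\<in>UNIV \<times> reduced CHAR('k). wscale (wcoord r D) (wbasis r))"
    by (subst witt_expand[of D]) simp
  also have "\<dots> = (\<Sum>r\<in>UNIV \<times> reduced CHAR('k). wcoord r D * l (wbasis r))"
    using assms by (simp add: wlin_sum) (simp add: wlin_def)
  finally show ?thesis .
qed

section \<open>Solving the linearised orbit equation\<close>

text \<open>Multiples of the top monomial (\<open>soc_eq\<close>), characterized by annihilation, a form from which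
  the closure properties are immediate.\<close>

definition in_socle :: "('k::field_prime_char, 'i::finite) trunc_poly \<Rightarrow> bool" where
  "in_socle h \<longleftrightarrow> (\<forall>l. tvar l * h = 0)"

lemma soc_simps: "in_socle 0" "in_socle f \<Longrightarrow> in_socle g \<Longrightarrow> in_socle (f + g)" "in_socle f \<Longrightarrow> in_socle g \<Longrightarrow> in_socle (f - g)"
  "in_socle f \<Longrightarrow> in_socle (- f)" "in_socle f \<Longrightarrow> in_socle (h * f)" "in_socle f \<Longrightarrow> in_socle (tscale c f)"
proof -
  show mult: "in_socle (h * f)" if "in_socle f" for h f
    using that unfolding in_socle_def by (metis mult.left_commute mult_zero_right)
  then show "in_socle f \<Longrightarrow> in_socle (tscale c f)" by (simp add: tscale_def)
qed (simp_all add: in_socle_def distrib_left right_diff_distrib)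

definition tau :: "nat \<Rightarrow> ('i::finite \<Rightarrow>\<^sub>0 nat)" where
  "tau p = (\<Sum>i\<in>UNIV. Poly_Mapping.single i (p - 1))"

lemma lookup_tau [simp]: "lk (tau p) i = p - 1"
  by (simp add: tau_def lookup_sum lookup_single when_def)

lemma tau_reduced [simp]: "tau CHAR('k::field_prime_char) \<in> reduced CHAR('k)"
  by (simp add: reduced_def)

definition xtau :: "('k::field_prime_char, 'i::finite) trunc_poly" where
  "xtau = (\<Prod>i\<in>UNIV. tvar i ^ (CHAR('k) - 1))"

lemma xtau_eq: "(xtau :: ('k::field_prime_char, 'i::finite) trunc_poly) = tmon (tau CHAR('k))"
  by (simp add: xtau_def tmon_prod)

lemma exponent_decompose:
  fixes a :: "'i \<Rightarrow>\<^sub>0 nat"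
  assumes "lk a i \<noteq> 0"
  shows "a = Poly_Mapping.single i 1 + (a - Poly_Mapping.single i 1)"
  using assms by (intro poly_mapping_eqI) (auto simp: lookup_add lookup_minus lookup_single when_def)

lemma tmon_factor:
  assumes "lk a i \<noteq> 0"
  shows "tmon a = tvar i * tmon (a - Poly_Mapping.single i 1)"
  using exponent_decompose[OF assms] tmon_add tmon_single_1 by metis

lemma tmon_mult_0I:
  assumes "CHAR('k) \<le> lk a i + lk b i"
  shows "(tmon a * tmon b :: ('k::field_prime_char, 'i::finite) trunc_poly) = 0"
proof -
  have "a + b \<notin> reduced CHAR('k)"
    using assms unfolding reduced_def by (auto simp: lookup_add not_less intro!: exI[of _ i])
  then show ?thesis by (simp add: tmon_not_reduced flip: tmon_add)
qed

lemma soc_xtau: "in_socle (xtau :: ('k::field_prime_char, 'i::finite) trunc_poly)"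
  unfolding in_socle_def
proof
  fix l :: 'i
  have "CHAR('k) \<le> lk (Poly_Mapping.single l 1) l + lk (tau CHAR('k)) l" by simp
  from tmon_mult_0I[OF this] show "tvar l * (xtau :: ('k, 'i) trunc_poly) = 0"
    by (simp only: tmon_single_1 xtau_eq)
qed

lemma mult_soc:
  fixes f h :: "('k::field_prime_char, 'i::finite) trunc_poly"
  assumes "eps f = 0" "in_socle h"
  shows "f * h = 0"
proof -
  have "tscale (tcoeff f a) (tmon a) * h = 0" for a
  proof (cases "a = 0")
    case True
    then show ?thesis using assms(1) by (simp add: eps_def)
  next
    case False
    then obtain i where "lk a i \<noteq> 0" by (auto simp: poly_mapping_eq_iff fun_eq_iff)
    then have "tmon a * h = tmon (a - Poly_Mapping.single i 1) * (tvar i * h)"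
      by (subst tmon_factor) (simp_all add: mult_ac)
    also have "\<dots> = 0" using assms(2) by (simp add: in_socle_def)
    finally show ?thesis by (simp add: tscale_def mult.assoc)
  qed
  then show ?thesis
    by (subst trunc_poly_expand[of f]) (simp add: sum_distrib_right)
qed

lemma tcoeff_tvar_mult:
  fixes h :: "('k::field_prime_char, 'i::finite) trunc_poly"
  assumes "a + Poly_Mapping.single l 1 \<in> reduced CHAR('k)"
  shows "tcoeff (tvar l * h) (a + Poly_Mapping.single l 1) = tcoeff h a"
proof (induction h rule: trunc_poly_induct)
  case (mon c b)
  have "lk a i < CHAR('k)" for i
    using assms unfolding reduced_def by (metis (mono_tags, lifting) add_lessD1 lookup_add mem_Collect_eq)
  then have a: "a \<in> reduced CHAR('k)" by (simp add: reduced_def)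
  have "tvar l * tscale c (tmon b) = tscale c (tmon (b + Poly_Mapping.single l 1))"
    unfolding tmon_add tmon_single_1 by (simp add: tscale_def mult_ac)
  then show ?case using assms a
    by (simp del: One_nat_def add: tcoeff_tmon)
next
  case (add f g)
  then show ?case by (simp del: One_nat_def add: distrib_left)
qed

text \<open>At any exponent other than the top one some variable still has room, and multiplication by it would
  preserve a nonzero coefficient.\<close>

lemma soc_eq:
  fixes h :: "('k::field_prime_char, 'i::finite) trunc_poly"
  assumes "in_socle h"
  shows "h = tscale (tcoeff h (tau CHAR('k))) xtau"
proof (rule tcoeff_eqI)
  fix a :: "'i \<Rightarrow>\<^sub>0 nat" assume a: "a \<in> reduced CHAR('k)"
  show "tcoeff h a = tcoeff (tscale (tcoeff h (tau CHAR('k))) xtau) a"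
  proof (cases "a = tau CHAR('k)")
    case True
    then show ?thesis by (simp add: xtau_eq tcoeff_tmon)
  next
    case False
    then obtain l where "lk a l \<noteq> CHAR('k) - 1" by (auto simp: poly_mapping_eq_iff fun_eq_iff)
    moreover have lt: "lk a i < CHAR('k)" for i using a by (simp add: reduced_def)
    ultimately have "Suc (lk a l) < CHAR('k)" using lt[of l] by linarith
    then have "a + Poly_Mapping.single l 1 \<in> reduced CHAR('k)"
      using lt by (auto simp: reduced_def lookup_add lookup_single when_def)
    from tcoeff_tvar_mult[OF this, of h] have "tcoeff h a = 0"
      using assms by (simp add: in_socle_def)
    then show ?thesis using False by (simp add: xtau_eq tcoeff_tmon)
  qed
qed

text \<open>The standard maximal subalgebra. Constants have derivative \<open>0\<close>, so it makes no difference whether \<open>f\<close> ranges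
  over the maximal ideal or over the whole ring.\<close>

definition W0 :: "('k::field_prime_char, 'i::finite) witt set" where
  "W0 = {D. \<forall>f. eps (wapply D f) = 0}"

lemma W0_iff: "D \<in> W0 \<longleftrightarrow> (\<forall>i. eps (wapply D (tvar i)) = 0)"
proof
  assume *: "\<forall>i. eps (wapply D (tvar i)) = 0"
  have "eps (wapply D f) = 0" for f
    by (induction f rule: trunc_poly_gen_induct) (simp_all add: * wapply_mult)
  then show "D \<in> W0" by (simp add: W0_def)
qed (simp add: W0_def)

text \<open>By the Leibniz rule \<open>x\<^sub>l D(h) = D(x\<^sub>l h) - D(x\<^sub>l) h\<close>, and both terms vanish.\<close>

lemma soc_wapply:
  assumes "D \<in> W0" "in_socle h"
  shows "in_socle (wapply D h)"
  unfolding in_socle_def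
proof
  fix l
  have "tvar l * wapply D h = wapply D (tvar l * h) - wapply D (tvar l) * h"
    by (simp add: wapply_mult)
  also have "tvar l * h = 0" using assms(2) by (simp add: in_socle_def)
  also have "wapply D (tvar l) * h = 0"
    using assms by (intro mult_soc) (simp_all add: W0_def)
  finally show "tvar l * wapply D h = 0" by simp
qed

definition lowvars :: "'i \<Rightarrow> ('k::field_prime_char, 'i::{finite, linorder}) trunc_poly" where
  "lowvars i = (\<Prod>j | j < i. tvar j ^ (CHAR('k) - 1))"

definition eta_sign :: "'i::{finite, linorder} \<Rightarrow> 'k::field_prime_char" where
  "eta_sign i = (-1) ^ (CARD('i) + 1 - var_pos i)"

lemma eta_sign_square [simp]:
  fixes c :: "'k::field_prime_char"
  shows "eta_sign i * eta_sign i = (1 :: 'k)" "eta_sign i * (eta_sign i * c) = c"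
proof -
  show "eta_sign i * eta_sign i = (1 :: 'k)"
    by (simp add: eta_sign_def flip: power_add power_mult_distrib)
  then show "eta_sign i * (eta_sign i * c) = c"
    by (simp flip: mult.assoc)
qed

lemma wapply_D_eta: "wapply (D_eta \<eta>) f = wapply (wfield lowvars) f +
    xtau * wapply (wfield (\<lambda>i. tconst (eta_sign i * \<eta> i))) f"
  by (simp add: D_eta_def wfield_def lowvars_def xtau_def eta_sign_def wscale_def)

lemma wapply_D_eta_tvar: "wapply (D_eta \<eta>) (tvar i) = lowvars i + tscale (eta_sign i * \<eta> i) xtau"
  by (simp add: wapply_D_eta tscale_def mult.commute)

lemma lowvars_eq: "(lowvars i :: ('k::field_prime_char, 'i::{finite, linorder}) trunc_poly) =
    tmon (\<Sum>j | j < i. Poly_Mapping.single j (CHAR('k) - 1))"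
  by (simp add: lowvars_def tmon_sum tmon_single)

lemma lookup_lowvars: "lk (\<Sum>j | j < i. Poly_Mapping.single j n) l = (if l < i then n else (0::nat))"
  for i :: "'i::{finite, linorder}"
  by (simp add: lookup_sum lookup_single when_def)

lemma wapply_wfield: "wapply (wfield f) h = (\<Sum>i\<in>UNIV. f i * tpderiv i h)"
  by (simp add: wfield_def wapply_wpartial)

lemma tpderiv_lowvars: "\<not> j < i \<Longrightarrow> tpderiv j (lowvars i) = 0"
  by (simp add: lowvars_eq tpderiv_tmon lookup_lowvars)

text \<open>On monomials, read as base \<open>p\<close> numerals, \<open>D\<^sub>1 + x\<^sub>1\<^sup>p\<^sup>-\<^sup>1 D\<^sub>2 + \<dots>\<close> is the predecessor map up to nonzero
  factors, so that it hits everything except the top monomial.\<close>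

lemma lowvars_field_surj:
  fixes e :: "('k::field_prime_char, 'i::{finite, linorder}) trunc_poly"
  shows "\<exists>f. eps f = 0 \<and> in_socle (wapply (wfield lowvars) f - e)"
proof (induction e rule: trunc_poly_induct)
  case (mon c b)
  let ?p = "CHAR('k)"
  show ?case
  proof (cases "b \<in> reduced ?p \<and> b \<noteq> tau ?p")
    case False
    then have "in_socle (tscale c (tmon b :: ('k, 'i) trunc_poly))"
      by (auto simp: tmon_not_reduced soc_simps soc_xtau simp flip: xtau_eq)
    then show ?thesis by (intro exI[of _ 0]) (simp add: soc_simps)
  next
    case True
    then have b: "lk b i < ?p" for i by (simp add: reduced_def)
    define I where "I = {i. lk b i \<noteq> ?p - 1}"
    have "I \<noteq> {}" using True by (auto simp: poly_mapping_eq_iff fun_eq_iff I_def)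
    define i where "i = Min I"
    have i: "i \<in> I" "\<And>j. j < i \<Longrightarrow> lk b j = ?p - 1"
      using \<open>I \<noteq> {}\<close> Min_in[of I] Min_le[of I] by (auto simp: i_def I_def)
    define n where "n = Suc (lk b i)"
    have n: "n < ?p" using i(1) b[of i] by (auto simp: I_def n_def)
    then have n0: "(of_nat n :: 'k) \<noteq> 0"
      unfolding of_nat_eq_0_iff_char_dvd by (simp add: n_def nat_dvd_not_less)
    (* The successor of b: the entries p - 1 before position i turn into 0 and entry i increases. *)
    define a where "a = Poly_Mapping.single i n + (\<Sum>j | i < j. Poly_Mapping.single j (lk b j))"
    have a: "lk a j = (if j < i then 0 else if j = i then n else lk b j)" for j
      by (auto simp: a_def lookup_add lookup_sum lookup_single when_def)
    have summand: "lowvars l * tpderiv l (tmon a) = (if l = i then tscale (of_nat n) (tmon b) else 0 :: ('k, 'i) trunc_poly)" for l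
    proof (cases l i rule: linorder_cases)
      case less
      then show ?thesis by (simp add: tpderiv_tmon a)
    next
      case equal
      have "(\<Sum>j | j < i. Poly_Mapping.single j (?p - 1)) + (a - Poly_Mapping.single i 1) = b"
        by (rule poly_mapping_eqI) (auto simp: lookup_add lookup_lowvars lookup_minus a lookup_single when_def n_def i(2))
      then show ?thesis using equal
        by (simp add: tpderiv_tmon lowvars_eq a tscale_def mult.left_commute flip: tmon_add)
    next
      case greater
      have "?p \<le> lk (\<Sum>j | j < l. Poly_Mapping.single j (?p - 1)) i + lk (a - Poly_Mapping.single l 1) i"
        using greater n by (simp add: lookup_lowvars lookup_minus lookup_single a n_def when_def)
      from tmon_mult_0I[OF this] greater show ?thesis
        by (simp add: tpderiv_tmon lowvars_eq tscale_def mult.left_commute)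
    qed
    have "a \<noteq> 0" using a[of i] by (auto simp: n_def)
    moreover have "wapply (wfield lowvars) (tscale (c / of_nat n) (tmon a)) = tscale c (tmon b)"
      using n0 by (simp add: wapply_wfield summand)
    ultimately show ?thesis
      by (intro exI[of _ "tscale (c / of_nat n) (tmon a)"]) (simp add: eps_tmon soc_simps)
  qed
next
  case (add e1 e2)
  then obtain f1 f2 where "eps f1 = 0" "in_socle (wapply (wfield lowvars) f1 - e1)"
    "eps f2 = 0" "in_socle (wapply (wfield lowvars) f2 - e2)" by blast
  then show ?case
    using soc_simps(2)[of "wapply (wfield lowvars) f1 - e1" "wapply (wfield lowvars) f2 - e2"]
    by (intro exI[of _ "f1 + f2"]) (simp add: algebra_simps)
qed

text \<open>The equation is triangular: the component along \<open>x\<^sub>i\<close> involves only the components of \<open>F\<close> along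
  smaller variables. One \<open>F\<close> serves all \<open>\<eta>\<close>, because the terms that contain \<open>\<eta>\<close> are multiples of the top
  monomial.\<close>

theorem linearised_orbit_solvable:
  fixes Y :: "('k::field_prime_char, 'i::{finite, linorder}) witt"
  shows "\<exists>F\<in>W0. \<forall>\<eta> i. in_socle (wapply (wbracket F (D_eta \<eta>) - Y) (tvar i))"
proof -
  let ?P = "\<lambda>f i r. eps r = 0 \<and>
    in_socle (wapply (wfield lowvars) r - ((\<Sum>j | j < i. f j * tpderiv j (lowvars i)) - wapply Y (tvar i)))"
  have "wf {(j, i :: 'i). j < i}"
    by (rule wf_subset[OF wf_measure[of "\<lambda>i. card {j. j < i}"]])
       (auto simp: intro!: psubset_card_mono)
  then have "\<exists>f. \<forall>i. ?P f i (f i)"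
  proof (rule dependent_wf_choice)
    show "?P f x r = ?P g x r" if "\<And>z. (z, x) \<in> {(j, i :: 'i). j < i} \<Longrightarrow> f z = g z" for f g x r
    proof -
      have "(\<Sum>j | j < x. f j * tpderiv j (lowvars x)) = (\<Sum>j | j < x. g j * tpderiv j (lowvars x))"
        using that by (intro sum.cong) auto
      then show ?thesis by simp
    qed
  qed (rule lowvars_field_surj)
  then obtain f where f: "\<And>i. ?P f i (f i)" by blast
  define F where "F = wfield f"
  have F: "F \<in> W0" using f by (simp add: W0_iff F_def)
  moreover have "in_socle (wapply (wbracket F (D_eta \<eta>) - Y) (tvar i))" for \<eta> i
  proof -
    have "(\<Sum>j\<in>UNIV. f j * tpderiv j (lowvars i)) = (\<Sum>j | j < i. f j * tpderiv j (lowvars i))"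
      by (intro sum.mono_neutral_right) (auto simp: tpderiv_lowvars)
    then have "wapply (wbracket F (D_eta \<eta>) - Y) (tvar i) =
      - (wapply (wfield lowvars) (f i) - ((\<Sum>j | j < i. f j * tpderiv j (lowvars i)) - wapply Y (tvar i)))
      + tscale (eta_sign i * \<eta> i) (wapply F xtau) - wapply (wfield (\<lambda>i. tconst (eta_sign i * \<eta> i))) (f i) * xtau"
      by (simp add: wapply_D_eta_tvar F_def) (simp add: wapply_D_eta wapply_wfield[of f] mult.commute)
    also have "in_socle \<dots>"
      using f[of i] soc_wapply[OF F soc_xtau] soc_xtau
      by (intro soc_simps(3)[OF soc_simps(2)[OF soc_simps(4) soc_simps(6)] soc_simps(5)]) auto
    finally show ?thesis .
  qed
  ultimately show ?thesis by blast
qed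

section \<open>Polynomial expressions and the identity principle\<close>

text \<open>Regular functions are represented by polynomial expressions. Evaluation in an arbitrary ring and
  differentiation are then recursions for which the homomorphism and Leibniz rules hold by definition, and
  the identity principle below shows that the choice of the expression does not matter.\<close>

datatype ('k, 'v) expr = EConst 'k | EVar 'v | EAdd "('k, 'v) expr" "('k, 'v) expr" | EMult "('k, 'v) expr" "('k, 'v) expr"

primrec eval_field :: "('v \<Rightarrow> 'k::comm_ring_1) \<Rightarrow> ('k, 'v) expr \<Rightarrow> 'k" where
  "eval_field z (EConst a) = a"
| "eval_field z (EVar v) = z v"
| "eval_field z (EAdd a b) = eval_field z a + eval_field z b"
| "eval_field z (EMult a b) = eval_field z a * eval_field z b"

primrec eval_ring :: "('c, 'm) ring_scheme \<Rightarrow> ('k \<Rightarrow> 'c) \<Rightarrow> ('v \<Rightarrow> 'c) \<Rightarrow> ('k, 'v) expr \<Rightarrow> 'c" where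
  "eval_ring R \<kappa> c (EConst a) = \<kappa> a"
| "eval_ring R \<kappa> c (EVar v) = c v"
| "eval_ring R \<kappa> c (EAdd a b) = eval_ring R \<kappa> c a \<oplus>\<^bsub>R\<^esub> eval_ring R \<kappa> c b"
| "eval_ring R \<kappa> c (EMult a b) = eval_ring R \<kappa> c a \<otimes>\<^bsub>R\<^esub> eval_ring R \<kappa> c b"

primrec epow :: "('k::comm_ring_1, 'v) expr \<Rightarrow> nat \<Rightarrow> ('k, 'v) expr" where
  "epow e 0 = EConst 1"
| "epow e (Suc n) = EMult (epow e n) e"

lemma eval_field_epow [simp]: "eval_field z (epow e n) = eval_field z e ^ n"
  by (induction n) (simp_all add: mult.commute)

fun coeffs_add :: "('k, 'v) expr list \<Rightarrow> ('k, 'v) expr list \<Rightarrow> ('k, 'v) expr list" where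
  "coeffs_add [] bs = bs"
| "coeffs_add as [] = as"
| "coeffs_add (a # as) (b # bs) = EAdd a b # coeffs_add as bs"

fun coeffs_mult :: "('k::comm_ring_1, 'v) expr list \<Rightarrow> ('k, 'v) expr list \<Rightarrow> ('k, 'v) expr list" where
  "coeffs_mult [] bs = []"
| "coeffs_mult (a # as) bs = coeffs_add (map (EMult a) bs) (EConst 0 # coeffs_mult as bs)"

text \<open>The coefficients of an expression, as a polynomial in the single variable \<open>v\<close>; they do not contain \<open>v\<close>.\<close>

primrec expr_coeffs :: "'v \<Rightarrow> ('k::comm_ring_1, 'v) expr \<Rightarrow> ('k, 'v) expr list" where
  "expr_coeffs v (EConst a) = [EConst a]"
| "expr_coeffs v (EVar w) = (if w = v then [EConst 0, EConst 1] else [EVar w])"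
| "expr_coeffs v (EAdd a b) = coeffs_add (expr_coeffs v a) (expr_coeffs v b)"
| "expr_coeffs v (EMult a b) = coeffs_mult (expr_coeffs v a) (expr_coeffs v b)"

primrec horner_field :: "('v \<Rightarrow> 'k::comm_ring_1) \<Rightarrow> 'k \<Rightarrow> ('k, 'v) expr list \<Rightarrow> 'k" where
  "horner_field z t [] = 0"
| "horner_field z t (e # es) = eval_field z e + t * horner_field z t es"

primrec horner_ring :: "('c, 'm) ring_scheme \<Rightarrow> ('k \<Rightarrow> 'c) \<Rightarrow> ('v \<Rightarrow> 'c) \<Rightarrow> 'c \<Rightarrow> ('k, 'v) expr list \<Rightarrow> 'c" where
  "horner_ring R \<kappa> c t [] = \<zero>\<^bsub>R\<^esub>"
| "horner_ring R \<kappa> c t (e # es) = eval_ring R \<kappa> c e \<oplus>\<^bsub>R\<^esub> (t \<otimes>\<^bsub>R\<^esub> horner_ring R \<kappa> c t es)"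

lemma horner_field_add: "horner_field z t (coeffs_add as bs) = horner_field z t as + horner_field z t bs"
  by (induction as bs rule: coeffs_add.induct) (simp_all add: algebra_simps)

lemma horner_field_scale: "horner_field z t (map (EMult a) bs) = eval_field z a * horner_field z t bs"
  by (induction bs) (simp_all add: algebra_simps)

lemma horner_field_mult: "horner_field z t (coeffs_mult as bs) = horner_field z t as * horner_field z t bs"
  by (induction as bs rule: coeffs_mult.induct) (simp_all add: horner_field_add horner_field_scale algebra_simps)

lemma eval_field_coeffs: "eval_field (z(v := t)) e = horner_field z t (expr_coeffs v e)"
  by (induction e) (simp_all add: horner_field_add horner_field_mult)

lemma horner_field_poly: "horner_field z t es = poly (Poly (map (eval_field z) es)) t"
  by (induction es) simp_all

lemma Poly_eq_0D: "Poly as = 0 \<Longrightarrow> x \<in> set as \<Longrightarrow> x = 0"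
  by (induction as) auto

lemma horner_field_vanish:
  fixes z :: "'v \<Rightarrow> 'k::field"
  assumes "infinite (UNIV :: 'k set)" "\<And>t. horner_field z t es = 0" "e \<in> set es"
  shows "eval_field z e = 0"
proof -
  have "Poly (map (eval_field z) es) = 0"
  proof (rule ccontr)
    assume "Poly (map (eval_field z) es) \<noteq> 0"
    then have "finite {t. poly (Poly (map (eval_field z) es)) t = 0}" by (rule poly_roots_finite)
    then show False using assms(1,2) by (simp add: horner_field_poly)
  qed
  then show ?thesis using Poly_eq_0D[of "map (eval_field z) es" "eval_field z e"] assms(3) by simp
qed

locale const_ring = cring C for C :: "('c, 'm) ring_scheme" (structure) +
  fixes \<kappa> :: "'k::field \<Rightarrow> 'c"
  assumes const_closed [simp]: "\<kappa> a \<in> carrier C"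
    and const_add: "\<kappa> (a + b) = \<kappa> a \<oplus> \<kappa> b"
    and const_mult: "\<kappa> (a * b) = \<kappa> a \<otimes> \<kappa> b"
    and const_one: "\<kappa> 1 = \<one>"
begin

lemma const_zero: "\<kappa> 0 = \<zero>"
proof -
  have "\<kappa> 0 \<oplus> \<kappa> 0 = \<kappa> 0" by (simp flip: const_add)
  then show ?thesis using add.l_cancel_one[of "\<kappa> 0" "\<kappa> 0"] by simp
qed

lemma eval_ring_closed [simp]: "(\<And>v. c v \<in> carrier C) \<Longrightarrow> eval_ring C \<kappa> c e \<in> carrier C"
  by (induction e) simp_all

lemma horner_ring_closed [simp]: "(\<And>v. c v \<in> carrier C) \<Longrightarrow> t \<in> carrier C \<Longrightarrow> horner_ring C \<kappa> c t es \<in> carrier C"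
  by (induction es) simp_all

lemma eval_ring_epow: "(\<And>v. c v \<in> carrier C) \<Longrightarrow> eval_ring C \<kappa> c (epow e n) = eval_ring C \<kappa> c e [^] n"
  by (induction n) (simp_all add: const_one)

context
  fixes c :: "'v \<Rightarrow> 'c" and t
  assumes c [simp]: "\<And>v. c v \<in> carrier C" and t [simp]: "t \<in> carrier C"
begin

lemma horner_ring_add: "horner_ring C \<kappa> c t (coeffs_add as bs) = horner_ring C \<kappa> c t as \<oplus> horner_ring C \<kappa> c t bs"
  by (induction as bs rule: coeffs_add.induct) (simp_all add: r_distr a_ac)

lemma horner_ring_scale: "horner_ring C \<kappa> c t (map (EMult a) bs) = eval_ring C \<kappa> c a \<otimes> horner_ring C \<kappa> c t bs"
  by (induction bs) (simp_all add: r_distr m_ac)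

lemma horner_ring_mult: "horner_ring C \<kappa> c t (coeffs_mult as bs) = horner_ring C \<kappa> c t as \<otimes> horner_ring C \<kappa> c t bs"
  by (induction as bs rule: coeffs_mult.induct) (simp_all add: horner_ring_add horner_ring_scale l_distr r_distr m_ac const_zero)

lemma eval_ring_coeffs: "eval_ring C \<kappa> (c(v := t)) e = horner_ring C \<kappa> c t (expr_coeffs v e)"
  by (induction e) (simp_all add: horner_ring_add horner_ring_mult const_one const_zero)

end

lemma horner_ring_zero:
  assumes "t \<in> carrier C" "\<And>e. e \<in> set es \<Longrightarrow> eval_ring C \<kappa> c e = \<zero>"
  shows "horner_ring C \<kappa> c t es = \<zero>"
  using assms(2) by (induction es) (simp_all add: assms(1))

lemma eval_ring_zero_env: "eval_ring C \<kappa> (\<lambda>_. \<zero>) e = \<kappa> (eval_field (\<lambda>_. 0) e)"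
  by (induction e) (simp_all add: const_zero const_add const_mult)

text \<open>Induction on the variables: a polynomial in one variable over an infinite field that vanishes
  everywhere has zero coefficients, and the coefficients are expressions in the other variables.\<close>

theorem identity_principle:
  fixes e :: "('k, 'v) expr"
  assumes inf: "infinite (UNIV :: 'k set)"
    and "\<And>z. (\<And>v. v \<notin> set vs \<Longrightarrow> z v = 0) \<Longrightarrow> eval_field z e = 0"
    and "\<And>v. c v \<in> carrier C" "\<And>v. v \<notin> set vs \<Longrightarrow> c v = \<zero>"
  shows "eval_ring C \<kappa> c e = \<zero>"
  using assms(2-)
proof (induction vs arbitrary: e c)
  case Nil
  from Nil(3) have "c = (\<lambda>_. \<zero>)" by auto
  then show ?case using Nil(1)[of "\<lambda>_. 0"] by (simp add: eval_ring_zero_env const_zero)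
next
  case (Cons v vs)
  show ?case
  proof (cases "v \<in> set vs")
    case True
    show ?thesis
      by (rule Cons.IH) (use Cons.prems True in \<open>auto simp: insert_absorb\<close>)
  next
    case False
    let ?c = "c(v := \<zero>)"
    have "eval_ring C \<kappa> ?c e' = \<zero>" if e': "e' \<in> set (expr_coeffs v e)" for e'
    proof (rule Cons.IH)
      fix z :: "'v \<Rightarrow> 'k" assume z: "\<And>v. v \<notin> set vs \<Longrightarrow> z v = 0"
      have "horner_field z t (expr_coeffs v e) = 0" for t
        unfolding eval_field_coeffs[symmetric] by (rule Cons.prems(1)) (use z in auto)
      then show "eval_field z e' = 0" by (rule horner_field_vanish[OF inf _ e'])
    qed (use Cons.prems in auto)
    then have "horner_ring C \<kappa> ?c (c v) (expr_coeffs v e) = \<zero>"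
      by (intro horner_ring_zero) (use Cons.prems in auto)
    moreover have "eval_ring C \<kappa> (?c(v := c v)) e = horner_ring C \<kappa> ?c (c v) (expr_coeffs v e)"
      by (rule eval_ring_coeffs) (use Cons.prems in auto)
    ultimately show ?thesis by simp
  qed
qed

end

section \<open>Functions on a principal open set\<close>

text \<open>The extra variable \<open>None\<close> stands for the inverse of \<open>d\<close>.\<close>

definition loc_env :: "('k::field, 'v) expr \<Rightarrow> ('v \<Rightarrow> 'k) \<Rightarrow> 'v option \<Rightarrow> 'k" where
  "loc_env d z = case_option (inverse (eval_field z d)) z"

lemma loc_env_simps [simp]: "loc_env d z None = inverse (eval_field z d)" "loc_env d z (Some v) = z v"
  by (simp_all add: loc_env_def)

context const_ring
begin

lemma clear_denominator:
  fixes e :: "('k, 'v option) expr" and d :: "('k, 'v) expr"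
  shows "\<exists>N e'. (\<forall>z. eval_field z d \<noteq> 0 \<longrightarrow> eval_field z d ^ N * eval_field (loc_env d z) e = eval_field z e') \<and>
    (\<forall>c. (\<forall>v. c v \<in> carrier C) \<longrightarrow> c None \<otimes> eval_ring C \<kappa> (c \<circ> Some) d = \<one> \<longrightarrow>
      eval_ring C \<kappa> (c \<circ> Some) d [^] (N :: nat) \<otimes> eval_ring C \<kappa> c e = eval_ring C \<kappa> (c \<circ> Some) e')"
proof (induction e)
  case (EConst a)
  show ?case by (intro exI[of _ 0] exI[of _ "EConst a"]) simp
next
  case (EVar w)
  show ?case
  proof (cases w)
    case None
    then show ?thesis
      by (intro exI[of _ 1] exI[of _ "EConst 1"]) (simp add: const_one m_comm)
  next
    case (Some v)
    then show ?thesis by (intro exI[of _ 0] exI[of _ "EVar v"]) simp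
  qed
next
  case (EAdd e1 e2)
  then obtain N1 e1' N2 e2' where
    1: "\<And>z. eval_field z d \<noteq> 0 \<Longrightarrow> eval_field z d ^ N1 * eval_field (loc_env d z) e1 = eval_field z e1'"
    "\<And>c. (\<forall>v. c v \<in> carrier C) \<Longrightarrow> c None \<otimes> eval_ring C \<kappa> (c \<circ> Some) d = \<one> \<Longrightarrow>
      eval_ring C \<kappa> (c \<circ> Some) d [^] (N1 :: nat) \<otimes> eval_ring C \<kappa> c e1 = eval_ring C \<kappa> (c \<circ> Some) e1'" and
    2: "\<And>z. eval_field z d \<noteq> 0 \<Longrightarrow> eval_field z d ^ N2 * eval_field (loc_env d z) e2 = eval_field z e2'"
    "\<And>c. (\<forall>v. c v \<in> carrier C) \<Longrightarrow> c None \<otimes> eval_ring C \<kappa> (c \<circ> Some) d = \<one> \<Longrightarrow>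
      eval_ring C \<kappa> (c \<circ> Some) d [^] (N2 :: nat) \<otimes> eval_ring C \<kappa> c e2 = eval_ring C \<kappa> (c \<circ> Some) e2'"
    by blast
  show ?case
  proof (intro exI[of _ "N1 + N2"] exI[of _ "EAdd (EMult (epow d N2) e1') (EMult (epow d N1) e2')"] conjI allI impI)
    fix z assume "eval_field z d \<noteq> 0"
    then show "eval_field z d ^ (N1 + N2) * eval_field (loc_env d z) (EAdd e1 e2) = eval_field z (EAdd (EMult (epow d N2) e1') (EMult (epow d N1) e2'))"
      by (simp add: 1(1)[symmetric] 2(1)[symmetric] power_add algebra_simps)
  next
    fix c :: "'v option \<Rightarrow> 'c"
    assume c: "\<forall>v. c v \<in> carrier C" "c None \<otimes> eval_ring C \<kappa> (c \<circ> Some) d = \<one>"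
    then show "eval_ring C \<kappa> (c \<circ> Some) d [^] (N1 + N2) \<otimes> eval_ring C \<kappa> c (EAdd e1 e2) =
      eval_ring C \<kappa> (c \<circ> Some) (EAdd (EMult (epow d N2) e1') (EMult (epow d N1) e2'))"
      by (simp add: 1(2)[OF c, symmetric] 2(2)[OF c, symmetric] eval_ring_epow r_distr m_ac flip: nat_pow_mult)
  qed
next
  case (EMult e1 e2)
  then obtain N1 e1' N2 e2' where
    1: "\<And>z. eval_field z d \<noteq> 0 \<Longrightarrow> eval_field z d ^ N1 * eval_field (loc_env d z) e1 = eval_field z e1'"
    "\<And>c. (\<forall>v. c v \<in> carrier C) \<Longrightarrow> c None \<otimes> eval_ring C \<kappa> (c \<circ> Some) d = \<one> \<Longrightarrow>
      eval_ring C \<kappa> (c \<circ> Some) d [^] (N1 :: nat) \<otimes> eval_ring C \<kappa> c e1 = eval_ring C \<kappa> (c \<circ> Some) e1'" and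
    2: "\<And>z. eval_field z d \<noteq> 0 \<Longrightarrow> eval_field z d ^ N2 * eval_field (loc_env d z) e2 = eval_field z e2'"
    "\<And>c. (\<forall>v. c v \<in> carrier C) \<Longrightarrow> c None \<otimes> eval_ring C \<kappa> (c \<circ> Some) d = \<one> \<Longrightarrow>
      eval_ring C \<kappa> (c \<circ> Some) d [^] (N2 :: nat) \<otimes> eval_ring C \<kappa> c e2 = eval_ring C \<kappa> (c \<circ> Some) e2'"
    by blast
  show ?case
  proof (intro exI[of _ "N1 + N2"] exI[of _ "EMult e1' e2'"] conjI allI impI)
    fix z assume "eval_field z d \<noteq> 0"
    then show "eval_field z d ^ (N1 + N2) * eval_field (loc_env d z) (EMult e1 e2) = eval_field z (EMult e1' e2')"
      by (simp add: 1(1)[symmetric] 2(1)[symmetric] power_add algebra_simps)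
  next
    fix c :: "'v option \<Rightarrow> 'c"
    assume c: "\<forall>v. c v \<in> carrier C" "c None \<otimes> eval_ring C \<kappa> (c \<circ> Some) d = \<one>"
    then show "eval_ring C \<kappa> (c \<circ> Some) d [^] (N1 + N2) \<otimes> eval_ring C \<kappa> c (EMult e1 e2) =
      eval_ring C \<kappa> (c \<circ> Some) (EMult e1' e2')"
      by (simp add: 1(2)[OF c, symmetric] 2(2)[OF c, symmetric] m_ac flip: nat_pow_mult)
  qed
qed

text \<open>After clearing denominators and multiplying by \<open>d\<close> the expression vanishes on the whole affine space,
  and \<open>d\<close> is a unit in the target ring.\<close>

theorem loc_identity_principle:
  fixes e :: "('k, 'v option) expr" and d :: "('k, 'v) expr"
  assumes inf: "infinite (UNIV :: 'k set)"
    and vanish: "\<And>z. (\<And>v. v \<notin> set vs \<Longrightarrow> z v = 0) \<Longrightarrow> eval_field z d \<noteq> 0 \<Longrightarrow> eval_field (loc_env d z) e = 0"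
    and c: "\<And>v. c v \<in> carrier C" "\<And>v. v \<notin> set vs \<Longrightarrow> c (Some v) = \<zero>"
    and unit: "c None \<otimes> eval_ring C \<kappa> (c \<circ> Some) d = \<one>"
  shows "eval_ring C \<kappa> c e = \<zero>"
proof -
  obtain N e' where
    z: "\<And>z. eval_field z d \<noteq> 0 \<Longrightarrow> eval_field z d ^ N * eval_field (loc_env d z) e = eval_field z e'" and
    C: "eval_ring C \<kappa> (c \<circ> Some) d [^] (N :: nat) \<otimes> eval_ring C \<kappa> c e = eval_ring C \<kappa> (c \<circ> Some) e'"
    using clear_denominator[of d e] c unit by blast
  let ?d = "eval_ring C \<kappa> (c \<circ> Some) d"
  have "eval_ring C \<kappa> (c \<circ> Some) (EMult d e') = \<zero>"
  proof (rule identity_principle[OF inf])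
    show "eval_field z (EMult d e') = 0" if "\<And>v. v \<notin> set vs \<Longrightarrow> z v = 0" for z :: "'v \<Rightarrow> 'k"
      using z[of z] vanish[OF that] by (cases "eval_field z d = 0") simp_all
  qed (use c in auto)
  then have zero: "?d [^] Suc N \<otimes> eval_ring C \<kappa> c e = \<zero>"
    using c by (simp add: C[symmetric] m_ac)
  have unit_pow: "c None [^] n \<otimes> ?d [^] n = \<one>" for n :: nat
    using c unit nat_pow_distrib[of "c None" ?d n] by simp
  then have "eval_ring C \<kappa> c e = (c None [^] Suc N \<otimes> ?d [^] Suc N) \<otimes> eval_ring C \<kappa> c e"
    unfolding unit_pow using c by simp
  also have "\<dots> = c None [^] Suc N \<otimes> (?d [^] Suc N \<otimes> eval_ring C \<kappa> c e)"
    using c by (intro m_assoc) auto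
  finally show ?thesis unfolding zero using c by simp
qed

end

text \<open>The derivative at \<open>z\<close> in the direction \<open>\<zeta>\<close>.\<close>

primrec deriv_field :: "('v \<Rightarrow> 'k::comm_ring_1) \<Rightarrow> ('v \<Rightarrow> 'k) \<Rightarrow> ('k, 'v) expr \<Rightarrow> 'k" where
  "deriv_field z \<zeta> (EConst a) = 0"
| "deriv_field z \<zeta> (EVar v) = \<zeta> v"
| "deriv_field z \<zeta> (EAdd a b) = deriv_field z \<zeta> a + deriv_field z \<zeta> b"
| "deriv_field z \<zeta> (EMult a b) = deriv_field z \<zeta> a * eval_field z b + eval_field z a * deriv_field z \<zeta> b"

text \<open>The ring \<open>k[\<epsilon>]/(\<epsilon>\<^sup>2)\<close>, with \<open>a + b\<epsilon>\<close> as the pair \<open>(a, b)\<close>.\<close>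

definition dual_numbers :: "('k::field \<times> 'k) ring" where
  "dual_numbers = \<lparr>carrier = UNIV, monoid.mult = (\<lambda>(a, b) (c, d). (a * c, a * d + b * c)), one = (1, 0),
    zero = (0, 0), add = (\<lambda>(a, b) (c, d). (a + c, b + d))\<rparr>"

lemma const_ring_dual_numbers: "const_ring dual_numbers (\<lambda>a. (a, 0))"
proof -
  have "\<exists>y. y + x = 0" for x :: 'a by (rule exI[of _ "- x"]) simp
  then show ?thesis
    unfolding dual_numbers_def
    by unfold_locales (auto simp: algebra_simps Units_def)
qed

lemma eval_ring_dual_numbers: "eval_ring dual_numbers (\<lambda>a. (a, 0)) (\<lambda>v. (z v, \<zeta> v)) e = (eval_field z e, deriv_field z \<zeta> e)"
  by (induction e) (simp_all add: dual_numbers_def algebra_simps)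

text \<open>The direction \<open>\<zeta>\<close>, extended to the variable \<open>1/d\<close> by the quotient rule.\<close>

definition loc_tangent :: "('k::field, 'v) expr \<Rightarrow> ('v \<Rightarrow> 'k) \<Rightarrow> ('v \<Rightarrow> 'k) \<Rightarrow> 'v option \<Rightarrow> 'k" where
  "loc_tangent d z \<zeta> = case_option (- deriv_field z \<zeta> d / (eval_field z d)\<^sup>2) \<zeta>"

lemma loc_tangent_simps [simp]: "loc_tangent d z \<zeta> None = - deriv_field z \<zeta> d / (eval_field z d)\<^sup>2" "loc_tangent d z \<zeta> (Some v) = \<zeta> v"
  by (simp_all add: loc_tangent_def)

text \<open>The derivative of a function does not depend on the expression: evaluate the expression at a point
  with values in the dual numbers.\<close>

lemma deriv_field_vanish:
  fixes e :: "('k::field, 'v option) expr" and d :: "('k, 'v) expr"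
  assumes inf: "infinite (UNIV :: 'k set)"
    and vanish: "\<And>z. (\<And>v. v \<notin> set vs \<Longrightarrow> z v = 0) \<Longrightarrow> eval_field z d \<noteq> 0 \<Longrightarrow> eval_field (loc_env d z) e = 0"
    and supp: "\<And>v. v \<notin> set vs \<Longrightarrow> z v = 0" "\<And>v. v \<notin> set vs \<Longrightarrow> \<zeta> v = 0" and d: "eval_field z d \<noteq> 0"
  shows "deriv_field (loc_env d z) (loc_tangent d z \<zeta>) e = 0"
proof -
  interpret const_ring dual_numbers "\<lambda>a. (a, 0) :: 'k \<times> 'k" by (rule const_ring_dual_numbers)
  let ?c = "\<lambda>v. (loc_env d z v, loc_tangent d z \<zeta> v)"
  have Some: "?c \<circ> Some = (\<lambda>v. (z v, \<zeta> v))" by (simp add: fun_eq_iff)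
  have "eval_ring dual_numbers (\<lambda>a. (a, 0)) ?c e = \<zero>\<^bsub>dual_numbers\<^esub>"
  proof (rule loc_identity_principle[OF inf vanish])
    show "?c None \<otimes>\<^bsub>dual_numbers\<^esub> eval_ring dual_numbers (\<lambda>a. (a, 0)) (?c \<circ> Some) d = \<one>\<^bsub>dual_numbers\<^esub>"
      unfolding Some eval_ring_dual_numbers using d by (simp add: dual_numbers_def field_simps power2_eq_square)
  qed (use supp in \<open>auto simp: dual_numbers_def\<close>)
  then show ?thesis by (simp add: eval_ring_dual_numbers) (simp add: dual_numbers_def)
qed

section \<open>Functions with values in the truncated polynomial ring\<close>

definition tlinear :: "(('k, 'i) trunc_poly \<Rightarrow> ('k::field_prime_char, 'i::finite) trunc_poly) \<Rightarrow> bool" where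
  "tlinear A \<longleftrightarrow> (\<forall>f g. A (f + g) = A f + A g) \<and> (\<forall>c f. A (tscale c f) = tscale c (A f))"

lemma tlinear_add: "tlinear A \<Longrightarrow> A (f + g) = A f + A g"
  and tlinear_scale: "tlinear A \<Longrightarrow> A (tscale c f) = tscale c (A f)"
  by (simp_all add: tlinear_def)

lemma tlinear_0: "tlinear A \<Longrightarrow> A 0 = 0"
  using tlinear_scale[of A 0 0] by simp

lemma tlinear_sum: "tlinear A \<Longrightarrow> A (sum f I) = (\<Sum>x\<in>I. A (f x))"
  by (induction I rule: infinite_finite_induct) (simp_all add: tlinear_add tlinear_0)

lemma tlinear_expand:
  fixes f :: "('k::field_prime_char, 'i::finite) trunc_poly"
  assumes "tlinear A"
  shows "A f = (\<Sum>b\<in>reduced CHAR('k). tscale (tcoeff f b) (A (tmon b)))"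
  by (subst trunc_poly_expand[of f]) (simp add: tlinear_sum[OF assms] tlinear_scale[OF assms])

lemma tlinear_alg_hom: "alg_hom \<phi> \<Longrightarrow> tlinear \<phi>"
  by (simp add: tlinear_def alg_homD)

lemma tlinear_wapply: "tlinear (wapply D)"
  by (simp add: tlinear_def)

text \<open>The inverse of a function. The usual notation \<open>inv\<close> denotes inverses in groups here.\<close>

abbreviation tinv :: "('a \<Rightarrow> 'b) \<Rightarrow> 'b \<Rightarrow> 'a" where "tinv \<equiv> inv_into UNIV"

lemma tlinear_inv:
  assumes "tlinear A" "bij A" shows "tlinear (tinv A)"
  unfolding tlinear_def
proof (intro conjI allI)
  have A: "A (tinv A f) = f" "tinv A (A f) = f" for f
    using assms(2) by (simp_all add: bij_is_surj surj_f_inv_f bij_is_inj)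
  show "tinv A (f + g) = tinv A f + tinv A g" for f g
    using A(2)[of "tinv A f + tinv A g"] by (simp add: tlinear_add[OF assms(1)] A(1))
  show "tinv A (tscale c f) = tscale c (tinv A f)" for c f
    using A(2)[of "tscale c (tinv A f)"] by (simp add: tlinear_scale[OF assms(1)] A(1))
qed

text \<open>Functions count only through their values on \<open>S\<close>; membership in \<open>\<A>\<close> ignores the others.\<close>

locale function_algebra =
  fixes S :: "'z set" and \<A> :: "('z \<Rightarrow> 'k::field_prime_char) set"
  assumes const_in: "(\<lambda>_. c) \<in> \<A>"
    and add_in: "F \<in> \<A> \<Longrightarrow> G \<in> \<A> \<Longrightarrow> (\<lambda>z. F z + G z) \<in> \<A>"
    and mult_in: "F \<in> \<A> \<Longrightarrow> G \<in> \<A> \<Longrightarrow> (\<lambda>z. F z * G z) \<in> \<A>"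
    and cong_in: "F \<in> \<A> \<Longrightarrow> (\<And>z. z \<in> S \<Longrightarrow> F z = G z) \<Longrightarrow> G \<in> \<A>"
begin

lemma uminus_in: "F \<in> \<A> \<Longrightarrow> (\<lambda>z. - F z) \<in> \<A>"
  using mult_in[OF const_in[of "-1"], of F] by simp

lemma diff_in: "F \<in> \<A> \<Longrightarrow> G \<in> \<A> \<Longrightarrow> (\<lambda>z. F z - G z) \<in> \<A>"
  using add_in[of F "\<lambda>z. - G z"] uminus_in[of G] by simp

lemma sum_in: "(\<And>x. x \<in> I \<Longrightarrow> F x \<in> \<A>) \<Longrightarrow> (\<lambda>z. \<Sum>x\<in>I. F x z) \<in> \<A>"
  by (induction I rule: infinite_finite_induct) (simp_all add: const_in add_in)

lemma prod_in: "(\<And>x. x \<in> I \<Longrightarrow> F x \<in> \<A>) \<Longrightarrow> (\<lambda>z. \<Prod>x\<in>I. F x z) \<in> \<A>"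
  by (induction I rule: infinite_finite_induct) (simp_all add: const_in mult_in)

lemma power_in: "F \<in> \<A> \<Longrightarrow> (\<lambda>z. F z ^ n) \<in> \<A>"
  by (induction n) (simp_all add: const_in mult_in)

lemma det_in:
  assumes "\<And>z. M z \<in> carrier_mat n n" "\<And>i j. i < n \<Longrightarrow> j < n \<Longrightarrow> (\<lambda>z. M z $$ (i, j)) \<in> \<A>"
  shows "(\<lambda>z. det (M z)) \<in> \<A>"
proof -
  have "(\<lambda>z. \<Sum>p\<in>{p. p permutes {0..<n}}. signof p * (\<Prod>i=0..<n. M z $$ (i, p i))) \<in> \<A>"
    using assms(2) by (intro sum_in mult_in const_in prod_in) (auto simp: permutes_in_image)
  then show ?thesis by (simp add: det_def'[OF assms(1)])
qed

lemma adj_mat_in: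
  assumes M: "\<And>z. M z \<in> carrier_mat n n" "\<And>i j. i < n \<Longrightarrow> j < n \<Longrightarrow> (\<lambda>z. M z $$ (i, j)) \<in> \<A>"
    and ij: "i < n" "j < n"
  shows "(\<lambda>z. adj_mat (M z) $$ (i, j)) \<in> \<A>"
proof -
  have dims: "dim_row (M z) = n" "dim_col (M z) = n" for z using M(1)[of z] by auto
  let ?r = "\<lambda>k l. if k < l then k else Suc k"
  have entry: "mat_delete (M z) j i $$ (i', j') = M z $$ (?r i' j, ?r j' i)"
    if "i' < n - 1" "j' < n - 1" for i' j' z
    unfolding mat_delete_def dims using that by (subst index_mat(1)) simp_all
  have "(\<lambda>z. mat_delete (M z) j i $$ (i', j')) \<in> \<A>" if "i' < n - 1" "j' < n - 1" for i' j'
    unfolding entry[OF that] using that by (intro M(2)) auto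
  then have "(\<lambda>z. det (mat_delete (M z) j i)) \<in> \<A>"
    by (rule det_in[where n = "n - 1", OF mat_delete_carrier[OF M(1)]])
  then show ?thesis
    using ij by (simp add: adj_mat_def cofactor_def dims) (intro mult_in const_in)
qed

definition regular_tp :: "('z \<Rightarrow> ('k, 'i::finite) trunc_poly) \<Rightarrow> bool" where
  "regular_tp M \<longleftrightarrow> (\<forall>a. (\<lambda>z. tcoeff (M z) a) \<in> \<A>)"

lemma regular_tpD: "regular_tp M \<Longrightarrow> (\<lambda>z. tcoeff (M z) a) \<in> \<A>"
  by (simp add: regular_tp_def)

lemma regular_tp_const: "regular_tp (\<lambda>_. f)"
  by (simp add: regular_tp_def const_in)

lemma regular_tp_add: "regular_tp M \<Longrightarrow> regular_tp N \<Longrightarrow> regular_tp (\<lambda>z. M z + N z)"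
  by (simp add: regular_tp_def add_in)

lemma regular_tp_diff: "regular_tp M \<Longrightarrow> regular_tp N \<Longrightarrow> regular_tp (\<lambda>z. M z - N z)"
  by (simp add: regular_tp_def diff_in)

lemma regular_tp_scale: "F \<in> \<A> \<Longrightarrow> regular_tp M \<Longrightarrow> regular_tp (\<lambda>z. tscale (F z) (M z))"
  by (simp add: regular_tp_def mult_in)

lemma regular_tp_sum: "(\<And>x. x \<in> I \<Longrightarrow> regular_tp (M x)) \<Longrightarrow> regular_tp (\<lambda>z. \<Sum>x\<in>I. M x z)"
  by (simp add: regular_tp_def sum_in)

lemma regular_tp_cong: "regular_tp M \<Longrightarrow> (\<And>z. z \<in> S \<Longrightarrow> M z = N z) \<Longrightarrow> regular_tp N"
  by (auto simp: regular_tp_def intro: cong_in)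

lemma regular_tp_eps: "regular_tp M \<Longrightarrow> (\<lambda>z. eps (M z)) \<in> \<A>"
  by (simp add: regular_tp_def eps_def)

lemma regular_tp_apply:
  assumes A: "\<And>h. regular_tp (\<lambda>z. A z h)" "\<And>z. z \<in> S \<Longrightarrow> tlinear (A z)" and N: "regular_tp N"
  shows "regular_tp (\<lambda>z. A z (N z))"
proof (rule regular_tp_cong)
  show "regular_tp (\<lambda>z. \<Sum>b\<in>reduced CHAR('k). tscale (tcoeff (N z) b) (A z (tmon b)))"
    by (intro regular_tp_sum regular_tp_scale regular_tpD N A)
  show "(\<Sum>b\<in>reduced CHAR('k). tscale (tcoeff (N z) b) (A z (tmon b))) = A z (N z)" if "z \<in> S" for z
    by (rule tlinear_expand[OF A(2)[OF that], symmetric])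
qed

lemma tlinear_times: "tlinear ((*) f)"
  by (simp add: tlinear_def tscale_def algebra_simps)

lemma regular_tp_mult:
  assumes "regular_tp M" "regular_tp N"
  shows "regular_tp (\<lambda>z. M z * N z)"
proof (rule regular_tp_apply[where A = "\<lambda>z. (*) (M z)"])
  show "regular_tp (\<lambda>z. M z * h)" for h
  proof -
    have "regular_tp (\<lambda>z. h * M z)"
      by (rule regular_tp_apply[where A = "\<lambda>z. (*) h"]) (simp_all add: regular_tp_const tlinear_times assms)
    then show ?thesis by (simp add: mult.commute)
  qed
qed (simp_all add: tlinear_times assms)

lemma regular_tp_power: "regular_tp M \<Longrightarrow> regular_tp (\<lambda>z. M z ^ n)"
  by (induction n) (simp_all add: regular_tp_const regular_tp_mult)

lemma regular_tp_prod: "(\<And>x. x \<in> I \<Longrightarrow> regular_tp (M x)) \<Longrightarrow> regular_tp (\<lambda>z. \<Prod>x\<in>I. M x z)"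
  by (induction I rule: infinite_finite_induct) (simp_all add: regular_tp_const regular_tp_mult)

lemma regular_tp_alg_hom:
  assumes "\<And>z. z \<in> S \<Longrightarrow> alg_hom (\<phi> z)" "\<And>i. regular_tp (\<lambda>z. \<phi> z (tvar i))"
  shows "regular_tp (\<lambda>z. \<phi> z h)"
proof (induction h rule: trunc_poly_gen_induct)
  case (const c)
  show ?case by (rule regular_tp_cong[OF regular_tp_const[of "tconst c"]]) (simp add: assms(1) alg_homD)
next
  case (add f g)
  show ?case by (rule regular_tp_cong[OF regular_tp_add[OF add]]) (simp add: assms(1) alg_homD)
next
  case (mult f g)
  show ?case by (rule regular_tp_cong[OF regular_tp_mult[OF mult]]) (simp add: assms(1) alg_homD)
qed (rule assms(2))

end

locale point_derivation = function_algebra S \<A>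
  for S :: "'z set" and \<A> :: "('z \<Rightarrow> 'k::field_prime_char) set" +
  fixes z0 :: 'z and \<delta> :: "('z \<Rightarrow> 'k) \<Rightarrow> 'k"
  assumes z0: "z0 \<in> S"
    and d_const: "\<delta> (\<lambda>_. c) = 0"
    and d_add: "F \<in> \<A> \<Longrightarrow> G \<in> \<A> \<Longrightarrow> \<delta> (\<lambda>z. F z + G z) = \<delta> F + \<delta> G"
    and d_mult: "F \<in> \<A> \<Longrightarrow> G \<in> \<A> \<Longrightarrow> \<delta> (\<lambda>z. F z * G z) = \<delta> F * G z0 + F z0 * \<delta> G"
    and d_cong: "F \<in> \<A> \<Longrightarrow> (\<And>z. z \<in> S \<Longrightarrow> F z = G z) \<Longrightarrow> \<delta> F = \<delta> G"
begin

lemma d_sum: "(\<And>x. x \<in> I \<Longrightarrow> F x \<in> \<A>) \<Longrightarrow> \<delta> (\<lambda>z. \<Sum>x\<in>I. F x z) = (\<Sum>x\<in>I. \<delta> (F x))"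
  by (induction I rule: infinite_finite_induct) (simp_all add: d_const d_add sum_in)

lemma d_scale: "F \<in> \<A> \<Longrightarrow> \<delta> (\<lambda>z. c * F z) = c * \<delta> F"
  using d_mult[OF const_in[of c], of F] by (simp add: d_const)

definition has_deriv :: "('z \<Rightarrow> ('k, 'i::finite) trunc_poly) \<Rightarrow> ('k, 'i) trunc_poly \<Rightarrow> bool" where
  "has_deriv M M' \<longleftrightarrow> regular_tp M \<and> (\<forall>a. \<delta> (\<lambda>z. tcoeff (M z) a) = tcoeff M' a)"

lemma has_deriv_unique: "has_deriv M M' \<Longrightarrow> has_deriv M M'' \<Longrightarrow> M' = M''"
  by (auto simp: has_deriv_def intro: tcoeff_eqI)

lemma has_deriv_cong: "has_deriv M M' \<Longrightarrow> (\<And>z. z \<in> S \<Longrightarrow> M z = N z) \<Longrightarrow> has_deriv N M'"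
  unfolding has_deriv_def
  by (auto intro: regular_tp_cong d_cong[symmetric, THEN trans] dest: regular_tpD)

lemma has_deriv_exists:
  assumes M: "regular_tp M"
  shows "\<exists>M'. has_deriv M M'"
proof -
  have *: "\<delta> (\<lambda>z. tcoeff (M z) a) = 0" if "a \<notin> reduced CHAR('k)" for a
    using that by (simp add: tcoeff_not_reduced d_const)
  have "tcoeff (\<Sum>b\<in>reduced CHAR('k). tscale (\<delta> (\<lambda>z. tcoeff (M z) b)) (tmon b)) a
    = \<delta> (\<lambda>z. tcoeff (M z) a)" for a
    by (cases "a \<in> reduced CHAR('k)") (simp_all add: tcoeff_tmon * if_distrib cong: if_cong)
  then show ?thesis using M unfolding has_deriv_def
    by (intro exI[of _ "\<Sum>b\<in>reduced CHAR('k). tscale (\<delta> (\<lambda>z. tcoeff (M z) b)) (tmon b)"]) simp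
qed

lemma has_deriv_const: "has_deriv (\<lambda>_. f) 0"
  by (simp add: has_deriv_def regular_tp_const d_const)

lemma has_deriv_add: "has_deriv M M' \<Longrightarrow> has_deriv N N' \<Longrightarrow> has_deriv (\<lambda>z. M z + N z) (M' + N')"
  by (simp add: has_deriv_def regular_tp_add d_add regular_tpD)

lemma has_deriv_scale: "F \<in> \<A> \<Longrightarrow> has_deriv M M' \<Longrightarrow>
    has_deriv (\<lambda>z. tscale (F z) (M z)) (tscale (\<delta> F) (M z0) + tscale (F z0) M')"
  by (simp add: has_deriv_def regular_tp_scale d_mult regular_tpD)

lemma has_deriv_sum: "(\<And>x. x \<in> I \<Longrightarrow> has_deriv (M x) (M' x)) \<Longrightarrow>
    has_deriv (\<lambda>z. \<Sum>x\<in>I. M x z) (\<Sum>x\<in>I. M' x)"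
  by (induction I rule: infinite_finite_induct) (simp_all add: has_deriv_const has_deriv_add)

text \<open>The product rule for a family of linear operators applied to a family of elements. Multiplication
  and composition are instances, and inversion follows.\<close>

lemma has_deriv_apply:
  assumes A: "\<And>h. has_deriv (\<lambda>z. A z h) (A' h)" "\<And>z. z \<in> S \<Longrightarrow> tlinear (A z)"
    and N: "has_deriv N N'"
  shows "has_deriv (\<lambda>z. A z (N z)) (A' (N z0) + A z0 N')"
proof -
  have "tlinear A'"
    unfolding tlinear_def
  proof (intro conjI allI)
    fix f g c
    have "has_deriv (\<lambda>z. A z (f + g)) (A' f + A' g)"
      by (rule has_deriv_cong[OF has_deriv_add[OF A(1) A(1)]]) (simp add: tlinear_add A(2))
    then show "A' (f + g) = A' f + A' g" using A(1) has_deriv_unique by blast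
    have "has_deriv (\<lambda>z. tscale c (A z f)) (tscale c (A' f))"
      using has_deriv_scale[OF const_in[of c] A(1)[of f]] by (simp add: d_const)
    then have "has_deriv (\<lambda>z. A z (tscale c f)) (tscale c (A' f))"
      by (rule has_deriv_cong) (simp add: tlinear_scale A(2))
    then show "A' (tscale c f) = tscale c (A' f)" using A(1) has_deriv_unique by blast
  qed
  have N': "regular_tp N" "\<And>b. \<delta> (\<lambda>z. tcoeff (N z) b) = tcoeff N' b" using N by (auto simp: has_deriv_def)
  have "has_deriv (\<lambda>z. \<Sum>b\<in>reduced CHAR('k). tscale (tcoeff (N z) b) (A z (tmon b)))
    (\<Sum>b\<in>reduced CHAR('k). tscale (tcoeff N' b) (A z0 (tmon b)) + tscale (tcoeff (N z0) b) (A' (tmon b)))"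
    unfolding N'(2)[symmetric] by (intro has_deriv_sum has_deriv_scale A(1) regular_tpD N'(1))
  moreover have "(\<Sum>b\<in>reduced CHAR('k). tscale (tcoeff (N z) b) (A z (tmon b))) = A z (N z)" if "z \<in> S" for z
    by (rule tlinear_expand[OF A(2)[OF that], symmetric])
  ultimately have "has_deriv (\<lambda>z. A z (N z))
    (\<Sum>b\<in>reduced CHAR('k). tscale (tcoeff N' b) (A z0 (tmon b)) + tscale (tcoeff (N z0) b) (A' (tmon b)))"
    by (rule has_deriv_cong)
  also have "(\<Sum>b\<in>reduced CHAR('k). tscale (tcoeff N' b) (A z0 (tmon b)) + tscale (tcoeff (N z0) b) (A' (tmon b)))
    = A z0 N' + A' (N z0)"
    by (simp add: sum.distrib tlinear_expand[OF A(2)[OF z0], of N'] tlinear_expand[OF \<open>tlinear A'\<close>, of "N z0"])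
  finally show ?thesis by (simp add: add.commute)
qed

lemma has_deriv_mult:
  assumes "has_deriv M M'" "has_deriv N N'"
  shows "has_deriv (\<lambda>z. M z * N z) (M' * N z0 + M z0 * N')"
proof (rule has_deriv_apply[where A = "\<lambda>z. (*) (M z)"])
  show "has_deriv (\<lambda>z. M z * h) (M' * h)" for h
    using has_deriv_apply[where A = "\<lambda>z. (*) h" and A' = "\<lambda>_. 0", OF _ _ assms(1)]
    by (simp add: has_deriv_const tlinear_times mult.commute)
qed (simp_all add: tlinear_times assms)

text \<open>Both sides are derivations along \<open>\<phi> z0\<close>, so that it suffices to compare them on the variables.\<close>

lemma has_deriv_alg_hom:
  assumes hom: "\<And>z. z \<in> S \<Longrightarrow> alg_hom (\<phi> z)"
    and var: "\<And>i. has_deriv (\<lambda>z. \<phi> z (tvar i)) (\<phi> z0 (wapply D (tvar i)))"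
  shows "has_deriv (\<lambda>z. \<phi> z h) (\<phi> z0 (wapply D h))"
proof (induction h rule: trunc_poly_gen_induct)
  case (const c)
  have "has_deriv (\<lambda>z. \<phi> z (tconst c)) 0"
    by (rule has_deriv_cong[OF has_deriv_const[of "tconst c"]]) (simp add: hom alg_homD)
  then show ?case by (simp add: hom z0 alg_homD)
next
  case (add f g)
  show ?case
    using has_deriv_cong[OF has_deriv_add[OF add], of "\<lambda>z. \<phi> z (f + g)"] by (simp add: hom z0 alg_homD)
next
  case (mult f g)
  show ?case
    using has_deriv_cong[OF has_deriv_mult[OF mult], of "\<lambda>z. \<phi> z (f * g)"]
    by (simp add: hom z0 alg_homD wapply_mult)
qed (rule var)

text \<open>Differentiate \<open>\<phi> \<circ> \<phi>\<inverse> = id\<close>.\<close>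

lemma has_deriv_inverse:
  assumes hom: "\<And>z. z \<in> S \<Longrightarrow> alg_hom (\<phi> z)" "\<And>z. z \<in> S \<Longrightarrow> bij (\<phi> z)"
    and var: "\<And>i. has_deriv (\<lambda>z. \<phi> z (tvar i)) (\<phi> z0 (wapply D (tvar i)))"
    and inv: "regular_tp (\<lambda>z. tinv (\<phi> z) h)"
  shows "has_deriv (\<lambda>z. tinv (\<phi> z) h) (- wapply D (tinv (\<phi> z0) h))"
proof -
  obtain N' where N': "has_deriv (\<lambda>z. tinv (\<phi> z) h) N'" using has_deriv_exists[OF inv] by blast
  have "has_deriv (\<lambda>z. \<phi> z (tinv (\<phi> z) h)) (\<phi> z0 (wapply D (tinv (\<phi> z0) h)) + \<phi> z0 N')"
    by (rule has_deriv_apply[where A = \<phi> and A' = "\<lambda>h. \<phi> z0 (wapply D h)", OF has_deriv_alg_hom[OF hom(1) var] _ N'])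
      (use hom in \<open>auto intro: tlinear_alg_hom\<close>)
  moreover have "has_deriv (\<lambda>z. \<phi> z (tinv (\<phi> z) h)) 0"
    by (rule has_deriv_cong[OF has_deriv_const[of h]]) (simp add: hom(2) bij_is_surj surj_f_inv_f)
  ultimately have "\<phi> z0 (wapply D (tinv (\<phi> z0) h) + N') = \<phi> z0 0"
    using has_deriv_unique hom(1)[OF z0] by (fastforce simp: alg_homD)
  then have "wapply D (tinv (\<phi> z0) h) + N' = 0"
    using hom(2)[OF z0] by (simp add: bij_is_inj inj_eq)
  then show ?thesis using N' by (metis eq_neg_iff_add_eq_0 add.commute)
qed

text \<open>If \<open>\<phi>\<close> moves with velocity \<open>\<phi> D\<close>, then \<open>\<phi> X \<phi>\<inverse>\<close> moves with velocity \<open>\<phi> ([D, X] + X') \<phi>\<inverse>\<close>.\<close>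

lemma has_deriv_conjugate:
  assumes hom: "\<And>z. z \<in> S \<Longrightarrow> alg_hom (\<phi> z)" "\<And>z. z \<in> S \<Longrightarrow> bij (\<phi> z)"
    and var: "\<And>i. has_deriv (\<lambda>z. \<phi> z (tvar i)) (\<phi> z0 (wapply D (tvar i)))"
    and inv: "\<And>h. regular_tp (\<lambda>z. tinv (\<phi> z) h)"
    and X: "\<And>h. has_deriv (\<lambda>z. wapply (X z) h) (wapply X' h)"
  shows "has_deriv (\<lambda>z. \<phi> z (wapply (X z) (tinv (\<phi> z) h)))
    (\<phi> z0 (wapply (wbracket D (X z0) + X') (tinv (\<phi> z0) h)))"
proof -
  have "has_deriv (\<lambda>z. wapply (X z) (tinv (\<phi> z) h))
    (wapply X' (tinv (\<phi> z0) h) + wapply (X z0) (- wapply D (tinv (\<phi> z0) h)))"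
    by (rule has_deriv_apply[where A = "\<lambda>z. wapply (X z)" and A' = "wapply X'",
      OF X tlinear_wapply has_deriv_inverse[OF hom var inv]])
  from has_deriv_apply[where A = \<phi> and A' = "\<lambda>h. \<phi> z0 (wapply D h)", OF has_deriv_alg_hom[OF hom(1) var] _ this]
  have "has_deriv (\<lambda>z. \<phi> z (wapply (X z) (tinv (\<phi> z) h)))
    (\<phi> z0 (wapply D (wapply (X z0) (tinv (\<phi> z0) h))) +
     \<phi> z0 (wapply X' (tinv (\<phi> z0) h) + wapply (X z0) (- wapply D (tinv (\<phi> z0) h))))"
    using hom(1) tlinear_alg_hom by blast
  then show ?thesis by (simp add: alg_homD[OF hom(1)[OF z0]] algebra_simps)
qed

end

section \<open>Coordinates on the automorphism group of the truncated polynomial ring\<close>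

text \<open>A fixed enumeration of the monomials, for matrices of linear operators.\<close>

definition mon_list :: "nat \<Rightarrow> ('i::finite \<Rightarrow>\<^sub>0 nat) list" where
  "mon_list p = (SOME xs. distinct xs \<and> set xs = reduced p)"

lemma mon_list:
  shows "distinct (mon_list p :: ('a::finite \<Rightarrow>\<^sub>0 nat) list)"
    and "set (mon_list p) = (reduced p :: ('a::finite \<Rightarrow>\<^sub>0 nat) set)"
proof -
  have "\<exists>xs. distinct xs \<and> set xs = (reduced p :: ('a \<Rightarrow>\<^sub>0 nat) set)"
    using finite_distinct_list[OF finite_reduced] by auto
  from someI_ex[OF this] show "distinct (mon_list p :: ('a \<Rightarrow>\<^sub>0 nat) list)"
    "set (mon_list p) = (reduced p :: ('a \<Rightarrow>\<^sub>0 nat) set)"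
    unfolding mon_list_def by simp_all
qed

context
  fixes ms :: "('i::finite \<Rightarrow>\<^sub>0 nat) list" and p
  assumes ms: "ms = mon_list p"
begin

lemma mon_list_nth: "i < length ms \<Longrightarrow> ms ! i \<in> reduced p"
  using nth_mem[of i ms] unfolding ms mon_list(2) .

lemma mon_list_eq_iff: "i < length ms \<Longrightarrow> j < length ms \<Longrightarrow> ms ! i = ms ! j \<longleftrightarrow> i = j"
  unfolding ms by (rule nth_eq_iff_index_eq[OF mon_list(1)])

lemma sum_mon_list: "(\<Sum>a\<in>reduced p. h a) = (\<Sum>i<length ms. h (ms ! i))"
  unfolding ms
  by (rule sum.reindex_bij_betw[OF bij_betw_nth[OF mon_list(1) refl mon_list(2)[symmetric]], symmetric])

end

definition opmat :: "(('k, 'i) trunc_poly \<Rightarrow> ('k::field_prime_char, 'i::finite) trunc_poly) \<Rightarrow> 'k mat" where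
  "opmat A = (let ms = (mon_list CHAR('k) :: ('i \<Rightarrow>\<^sub>0 nat) list) in
    mat (length ms) (length ms) (\<lambda>(i, j). tcoeff (A (tmon (ms ! j))) (ms ! i)))"

definition ofmat :: "'k mat \<Rightarrow> ('k, 'i) trunc_poly \<Rightarrow> ('k::field_prime_char, 'i::finite) trunc_poly" where
  "ofmat M f = (let ms = (mon_list CHAR('k) :: ('i \<Rightarrow>\<^sub>0 nat) list) in
    \<Sum>i<length ms. tscale (\<Sum>j<length ms. M $$ (i, j) * tcoeff f (ms ! j)) (tmon (ms ! i)))"

(* The argument ty only fixes the field. *)
context
  fixes ms :: "('i::finite \<Rightarrow>\<^sub>0 nat) list" and ty :: "'k::field_prime_char itself"
  assumes ms: "ms = mon_list CHAR('k)"
begin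

lemma ms_reduced: "i < length ms \<Longrightarrow> ms ! i \<in> reduced CHAR('k)"
  by (rule mon_list_nth[OF ms])

lemma ms_eqI:
  fixes f g :: "('k, 'i) trunc_poly"
  assumes "\<And>i. i < length ms \<Longrightarrow> tcoeff f (ms ! i) = tcoeff g (ms ! i)" shows "f = g"
proof (rule tcoeff_eqI)
  fix a :: "'i \<Rightarrow>\<^sub>0 nat" assume "a \<in> reduced CHAR('k)"
  then obtain i where "i < length ms" "a = ms ! i"
    by (auto simp: ms in_set_conv_nth simp flip: mon_list(2))
  then show "tcoeff f a = tcoeff g a" using assms by simp
qed

lemma tcoeff_tmon_ms: "i < length ms \<Longrightarrow> j < length ms \<Longrightarrow>
    tcoeff (tmon (ms ! j) :: ('k, 'i) trunc_poly) (ms ! i) = (if i = j then 1 else 0)"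
  by (simp add: tcoeff_tmon ms_reduced mon_list_eq_iff[OF ms])

lemma opmat_carrier: "opmat (A :: ('k, 'i) trunc_poly \<Rightarrow> _) \<in> carrier_mat (length ms) (length ms)"
  by (simp add: opmat_def ms Let_def)

lemma opmat_dim: "dim_row (opmat (A :: ('k, 'i) trunc_poly \<Rightarrow> _)) = length ms"
    "dim_col (opmat (A :: ('k, 'i) trunc_poly \<Rightarrow> _)) = length ms"
  using opmat_carrier[of A] by auto

lemma opmat_index: "i < length ms \<Longrightarrow> j < length ms \<Longrightarrow>
    opmat (A :: ('k, 'i) trunc_poly \<Rightarrow> _) $$ (i, j) = tcoeff (A (tmon (ms ! j))) (ms ! i)"
  by (simp add: opmat_def ms Let_def)

lemma tcoeff_ofmat:
  assumes "i < length ms"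
  shows "tcoeff (ofmat M f :: ('k, 'i) trunc_poly) (ms ! i) = (\<Sum>j<length ms. M $$ (i, j) * tcoeff f (ms ! j))"
proof -
  have "tcoeff (ofmat M f :: ('k, 'i) trunc_poly) (ms ! i) =
    (\<Sum>l<length ms. (\<Sum>j<length ms. M $$ (l, j) * tcoeff f (ms ! j)) * (if l = i then 1 else 0))"
    unfolding ofmat_def Let_def ms[symmetric] tcoeff_sum tcoeff_tscale
    by (intro sum.cong refl) (use assms in \<open>auto simp: tcoeff_tmon_ms\<close>)
  also have "\<dots> = (\<Sum>j<length ms. M $$ (i, j) * tcoeff f (ms ! j))"
    using assms by (simp add: if_distrib cong: if_cong)
  finally show ?thesis .
qed

lemma tcoeff_tlinear:
  fixes f :: "('k, 'i) trunc_poly"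
  assumes "tlinear A" "i < length ms"
  shows "tcoeff (A f) (ms ! i) = (\<Sum>j<length ms. opmat A $$ (i, j) * tcoeff f (ms ! j))"
  by (subst tlinear_expand[OF assms(1)])
     (simp add: sum_mon_list[OF ms] assms(2) opmat_index mult.commute)

lemma ofmat_opmat: "tlinear A \<Longrightarrow> ofmat (opmat A) f = (A f :: ('k, 'i) trunc_poly)"
  by (rule ms_eqI) (simp add: tcoeff_ofmat tcoeff_tlinear)

lemma ofmat_mult:
  assumes "M \<in> carrier_mat (length ms) (length ms)" "N \<in> carrier_mat (length ms) (length ms)"
  shows "ofmat (M * N) f = (ofmat M (ofmat N f) :: ('k, 'i) trunc_poly)"
proof (rule ms_eqI)
  fix i assume i: "i < length ms"
  have "tcoeff (ofmat (M * N) f) (ms ! i) =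
    (\<Sum>j<length ms. (\<Sum>l<length ms. M $$ (i, l) * N $$ (l, j)) * tcoeff f (ms ! j))"
    unfolding tcoeff_ofmat[OF i]
    by (intro sum.cong refl) (use assms i in \<open>auto simp: scalar_prod_def atLeast0LessThan intro!: sum.cong\<close>)
  also have "\<dots> = (\<Sum>l<length ms. M $$ (i, l) * (\<Sum>j<length ms. N $$ (l, j) * tcoeff f (ms ! j)))"
    unfolding sum_distrib_right sum_distrib_left mult.assoc by (rule sum.swap)
  also have "\<dots> = tcoeff (ofmat M (ofmat N f)) (ms ! i)"
    by (simp add: tcoeff_ofmat i)
  finally show "tcoeff (ofmat (M * N) f) (ms ! i) = tcoeff (ofmat M (ofmat N f)) (ms ! i)" .
qed

lemma ofmat_one: "ofmat (1\<^sub>m (length ms)) f = (f :: ('k, 'i) trunc_poly)"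
  by (rule ms_eqI) (simp add: tcoeff_ofmat if_distrib if_distribR cong: if_cong)

lemma opmat_mult:
  assumes "tlinear (A :: ('k, 'i) trunc_poly \<Rightarrow> _)"
  shows "opmat (\<lambda>f. A (B f)) = opmat A * opmat B"
proof (rule eq_matI)
  fix i j assume "i < dim_row (opmat A * opmat B)" "j < dim_col (opmat A * opmat B)"
  then have ij: "i < length ms" "j < length ms" using opmat_carrier[of A] opmat_carrier[of B] by auto
  have "(opmat A * opmat B) $$ (i, j) = (\<Sum>l<length ms. opmat A $$ (i, l) * opmat B $$ (l, j))"
    using ij opmat_carrier[of A] opmat_carrier[of B]
    by (auto simp: scalar_prod_def atLeast0LessThan intro!: sum.cong)
  also have "\<dots> = tcoeff (A (B (tmon (ms ! j)))) (ms ! i)"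
    unfolding tcoeff_tlinear[OF assms ij(1)] using ij by (intro sum.cong) (simp_all add: opmat_index)
  finally show "opmat (\<lambda>f. A (B f)) $$ (i, j) = (opmat A * opmat B) $$ (i, j)"
    using ij by (simp add: opmat_index)
qed (simp_all add: opmat_dim)

lemma opmat_id: "opmat (\<lambda>f :: ('k, 'i) trunc_poly. f) = 1\<^sub>m (length ms)"
  by (rule eq_matI) (auto simp: opmat_dim opmat_index tcoeff_tmon_ms)

lemma bij_iff_det_opmat:
  fixes A :: "('k, 'i) trunc_poly \<Rightarrow> ('k, 'i) trunc_poly"
  assumes A: "tlinear A"
  shows "bij A \<longleftrightarrow> det (opmat A) \<noteq> 0"
    and "bij A \<Longrightarrow> tinv A f = ofmat (inverse (det (opmat A)) \<cdot>\<^sub>m adj_mat (opmat A)) f"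
    and "bij A \<Longrightarrow> inverse (det (opmat A)) = det (opmat (tinv A))"
proof -
  let ?n = "length ms" and ?M = "opmat A"
  let ?N = "inverse (det ?M) \<cdot>\<^sub>m adj_mat ?M"
  have M: "?M \<in> carrier_mat ?n ?n" by (rule opmat_carrier)
  note adj = adj_mat[OF M]
  have inverse: "det (opmat (tinv A)) * det ?M = 1" if "bij A"
  proof -
    have "det (opmat (tinv A)) * det ?M = det (opmat (\<lambda>f. tinv A (A f)))"
      by (simp only: opmat_mult[OF tlinear_inv[OF A that], where B = A] det_mult[OF opmat_carrier M])
    also have "(\<lambda>f. tinv A (A f)) = (\<lambda>f. f)" using that by (simp add: bij_is_inj)
    finally show ?thesis by (simp add: opmat_id)
  qed
  have 1: "?M * ?N = 1\<^sub>m ?n" "?N * ?M = 1\<^sub>m ?n" if "det ?M \<noteq> 0"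
  proof -
    have "inverse (det ?M) \<cdot>\<^sub>m (det ?M \<cdot>\<^sub>m 1\<^sub>m ?n) = 1\<^sub>m ?n"
      by (rule eq_matI) (use that in auto)
    then show "?M * ?N = 1\<^sub>m ?n" "?N * ?M = 1\<^sub>m ?n"
      by (simp_all only: mult_smult_distrib[OF M adj(1)] mult_smult_assoc_mat[OF adj(1) M] adj(2,3))
  qed
  have N: "?N \<in> carrier_mat ?n ?n" using adj by simp
  have 2: "A (ofmat ?N f) = f" "ofmat ?N (A f) = f" if "det ?M \<noteq> 0" for f
    using ofmat_mult[OF M N, of f] ofmat_mult[OF N M, of f] by (simp_all add: 1[OF that] ofmat_one ofmat_opmat[OF A])
  show iff: "bij A \<longleftrightarrow> det ?M \<noteq> 0"
  proof
    assume "det ?M \<noteq> 0"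
    then show "bij A" using 2 by (intro bijI') (metis, metis)
  qed (use inverse in auto)
  show "tinv A f = ofmat ?N f" if "bij A"
    using 2(1)[of f] iff that bij_inv_eq_iff[OF that, of "ofmat ?N f" f] by simp
  show "inverse (det ?M) = det (opmat (tinv A))" if "bij A"
    using inverse[OF that] by (intro inverse_unique) (simp add: mult.commute)
qed

end

text \<open>The entries of the inverse matrix are those of the adjugate, divided by the determinant.\<close>

lemma (in function_algebra) regular_tp_inverse:
  fixes A :: "'z \<Rightarrow> ('k, 'i::finite) trunc_poly \<Rightarrow> ('k, 'i) trunc_poly"
  assumes A: "\<And>h. regular_tp (\<lambda>z. A z h)" "\<And>z. z \<in> S \<Longrightarrow> tlinear (A z)" "\<And>z. z \<in> S \<Longrightarrow> bij (A z)"
    and det: "(\<lambda>z. inverse (det (opmat (A z)))) \<in> \<A>"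
  shows "regular_tp (\<lambda>z. tinv (A z) h)"
proof (rule regular_tp_cong)
  define ms :: "('i \<Rightarrow>\<^sub>0 nat) list" where "ms = mon_list CHAR('k)"
  let ?N = "\<lambda>z. inverse (det (opmat (A z))) \<cdot>\<^sub>m adj_mat (opmat (A z))"
  note carrier = opmat_carrier[OF ms_def]
  have adj: "(\<lambda>z. adj_mat (opmat (A z)) $$ (i, j)) \<in> \<A>" if "i < length ms" "j < length ms" for i j
  proof (rule adj_mat_in[OF carrier _ that])
    show "(\<lambda>z. opmat (A z) $$ (i, j)) \<in> \<A>" if "i < length ms" "j < length ms" for i j
      using that by (simp add: opmat_index[OF ms_def] regular_tpD A(1))
  qed
  have N: "(\<lambda>z. ?N z $$ (i, j)) \<in> \<A>" if "i < length ms" "j < length ms" for i j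
  proof -
    have "?N z $$ (i, j) = inverse (det (opmat (A z))) * adj_mat (opmat (A z)) $$ (i, j)" for z
      using that adj_mat(1)[OF carrier, of "A z"] by simp
    then show ?thesis by (simp only:) (rule mult_in[OF det adj[OF that]])
  qed
  show "regular_tp (\<lambda>z. ofmat (?N z) h)"
    unfolding ofmat_def Let_def ms_def[symmetric]
    by (intro regular_tp_sum regular_tp_scale regular_tp_const sum_in mult_in N const_in) auto
  show "ofmat (?N z) h = tinv (A z) h" if "z \<in> S" for z
    using bij_iff_det_opmat(2)[OF ms_def A(2)[OF that] A(3)[OF that]] by simp
qed

type_synonym 'i cvar = "'i \<times> ('i \<Rightarrow>\<^sub>0 nat)"

definition cvars :: "nat \<Rightarrow> 'i::finite cvar set" where
  "cvars p = UNIV \<times> reduced p"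

text \<open>The coordinate \<open>(j, a)\<close> with \<open>a \<noteq> 0\<close> is the coefficient of \<open>x\<^sup>a\<close> in the image of \<open>x\<^sub>j\<close>. An automorphism has no
  constant terms, which leaves \<open>(j, 0)\<close> free to hold \<open>\<eta>\<^sub>j\<close>.\<close>

definition gpoint :: "('i cvar \<Rightarrow> 'k) \<Rightarrow> 'i \<Rightarrow> ('k::field_prime_char, 'i::finite) trunc_poly" where
  "gpoint z j = (\<Sum>a\<in>reduced CHAR('k) - {0}. tscale (z (j, a)) (tmon a))"

definition phi :: "('i cvar \<Rightarrow> 'k) \<Rightarrow> ('k, 'i) trunc_poly \<Rightarrow> ('k::field_prime_char, 'i::finite) trunc_poly" where
  "phi z = tsubst (gpoint z)"

lemma tcoeff_gpoint: "tcoeff (gpoint z j) a =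
    (if a \<in> reduced CHAR('k) \<and> a \<noteq> 0 then z (j, a) else (0 :: 'k::field_prime_char))"
proof -
  have "tcoeff (gpoint z j) a = (\<Sum>b\<in>reduced CHAR('k) - {0}. if b = a then z (j, a) else 0)"
    unfolding gpoint_def tcoeff_sum by (intro sum.cong) (auto simp: tcoeff_tmon)
  then show ?thesis by simp
qed

lemma eps_gpoint [simp]: "eps (gpoint z j) = 0"
  by (simp add: eps_def tcoeff_gpoint)

lemma alg_hom_phi: "alg_hom (phi z)"
  unfolding phi_def by (rule alg_hom_tsubst) simp

lemma phi_tvar [simp]: "phi z (tvar j) = gpoint z j"
  unfolding phi_def by (rule tsubst_tvar) simp

definition polynomial_functions :: "(('v \<Rightarrow> 'k) \<Rightarrow> 'k::field_prime_char) set" where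
  "polynomial_functions = {F. \<exists>e. \<forall>z. F z = eval_field z e}"

interpretation polynomial_functions: function_algebra UNIV "polynomial_functions :: (('v \<Rightarrow> 'k) \<Rightarrow> 'k::field_prime_char) set"
proof
  fix c :: 'k and F G :: "('v \<Rightarrow> 'k) \<Rightarrow> 'k"
  show "(\<lambda>_. c) \<in> polynomial_functions"
    unfolding polynomial_functions_def by (auto intro: exI[of _ "EConst c"])
  assume F: "F \<in> polynomial_functions"
  show "G \<in> polynomial_functions" if "\<And>z. z \<in> UNIV \<Longrightarrow> F z = G z"
    using F that unfolding polynomial_functions_def by auto
  assume G: "G \<in> polynomial_functions"
  from F G obtain a b where "\<And>z. F z = eval_field z a" "\<And>z. G z = eval_field z b"
    unfolding polynomial_functions_def by auto
  then show "(\<lambda>z. F z + G z) \<in> polynomial_functions" "(\<lambda>z. F z * G z) \<in> polynomial_functions"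
    unfolding polynomial_functions_def by (auto intro: exI[of _ "EAdd a b"] exI[of _ "EMult a b"])
qed

lemma (in function_algebra) regular_tp_phi:
  assumes "\<And>v. (\<lambda>z. c z v) \<in> \<A>"
  shows "regular_tp (\<lambda>z. phi (c z) h)"
proof (rule regular_tp_alg_hom[OF alg_hom_phi])
  show "regular_tp (\<lambda>z. phi (c z) (tvar i))" for i
    unfolding phi_tvar gpoint_def by (intro regular_tp_sum regular_tp_scale regular_tp_const assms)
qed

definition det_expr :: "('k::field_prime_char, 'i::finite cvar) expr" where
  "det_expr = (SOME e. \<forall>z. det (opmat (phi z)) = eval_field z e)"

lemma eval_field_det_expr:
  fixes z :: "'i::finite cvar \<Rightarrow> 'k::field_prime_char"
  shows "eval_field z det_expr = det (opmat (phi z))"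
proof -
  have "(\<lambda>z :: 'i cvar \<Rightarrow> 'k. z v) \<in> polynomial_functions" for v
    unfolding polynomial_functions_def by (auto intro: exI[of _ "EVar v"])
  then have "polynomial_functions.regular_tp (\<lambda>z :: 'i cvar \<Rightarrow> 'k. phi z h)" for h
    by (rule polynomial_functions.regular_tp_phi[where c = "\<lambda>z. z"])
  then have "(\<lambda>z :: 'i cvar \<Rightarrow> 'k. det (opmat (phi z))) \<in> polynomial_functions"
    by (intro polynomial_functions.det_in[OF opmat_carrier[OF refl]])
       (simp add: opmat_index[OF refl] polynomial_functions.regular_tpD)
  then have "\<exists>e. \<forall>z :: 'i cvar \<Rightarrow> 'k. det (opmat (phi z)) = eval_field z e"
    unfolding polynomial_functions_def by simp
  from someI_ex[OF this] have "\<forall>z :: 'i cvar \<Rightarrow> 'k. det (opmat (phi z)) = eval_field z det_expr"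
    unfolding det_expr_def .
  then show ?thesis by (rule allE) (rule sym)
qed

lemma bij_phi_iff: "bij (phi z) \<longleftrightarrow> eval_field z det_expr \<noteq> 0"
  unfolding eval_field_det_expr by (rule bij_iff_det_opmat(1)[OF refl tlinear_alg_hom[OF alg_hom_phi]])

text \<open>Coordinates outside the finite set \<open>cvars\<close> are \<open>0\<close>, so that points correspond bijectively to pairs of an
  automorphism and some \<open>\<eta>\<close>.\<close>

definition chart :: "('i::finite cvar \<Rightarrow> 'k::field_prime_char) set" where
  "chart = {z. (\<forall>v. v \<notin> cvars CHAR('k) \<longrightarrow> z v = 0) \<and> bij (phi z)}"

definition chart_functions :: "(('i::finite cvar \<Rightarrow> 'k::field_prime_char) \<Rightarrow> 'k) set" where
  "chart_functions = {F. \<exists>e. \<forall>z\<in>chart. F z = eval_field (loc_env det_expr z) e}"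

lemma chart_functionsI: "(\<And>z. z \<in> chart \<Longrightarrow> F z = eval_field (loc_env det_expr z) e) \<Longrightarrow> F \<in> chart_functions"
  unfolding chart_functions_def by blast

interpretation chart: function_algebra chart "chart_functions :: (('i::finite cvar \<Rightarrow> 'k::field_prime_char) \<Rightarrow> 'k) set"
proof
  fix c :: 'k and F G :: "('i cvar \<Rightarrow> 'k) \<Rightarrow> 'k"
  show "(\<lambda>_. c) \<in> chart_functions"
    unfolding chart_functions_def by (auto intro: exI[of _ "EConst c"])
  assume F: "F \<in> chart_functions"
  show "G \<in> chart_functions" if "\<And>z. z \<in> chart \<Longrightarrow> F z = G z"
    using F that unfolding chart_functions_def by auto
  assume G: "G \<in> chart_functions"
  from F G obtain a b where "\<And>z. z \<in> chart \<Longrightarrow> F z = eval_field (loc_env det_expr z) a"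
    "\<And>z. z \<in> chart \<Longrightarrow> G z = eval_field (loc_env det_expr z) b"
    unfolding chart_functions_def by auto
  then show "(\<lambda>z. F z + G z) \<in> chart_functions" "(\<lambda>z. F z * G z) \<in> chart_functions"
    by (auto intro: chart_functionsI[of _ "EAdd a b"] chart_functionsI[of _ "EMult a b"])
qed

lemma chart_coordinate: "(\<lambda>z. z v) \<in> chart_functions"
  by (rule chart_functionsI[where e = "EVar (Some v)"]) simp

lemma chart_regular_phi: "chart.regular_tp (\<lambda>z. phi z h)"
  by (rule chart.regular_tp_phi[where c = "\<lambda>z. z", OF chart_coordinate])

lemma chart_inverse_det: "(\<lambda>z. inverse (det (opmat (phi z)))) \<in> chart_functions"
  by (rule chart_functionsI[where e = "EVar None"]) (simp add: eval_field_det_expr)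

lemma chart_regular_inverse: "chart.regular_tp (\<lambda>z. tinv (phi z) h)"
  by (rule chart.regular_tp_inverse[OF chart_regular_phi _ _ chart_inverse_det])
     (auto simp: chart_def tlinear_alg_hom alg_hom_phi)

definition cvar_list :: "nat \<Rightarrow> 'i::finite cvar list" where
  "cvar_list p = (SOME xs. set xs = cvars p)"

lemma cvar_list: "set (cvar_list p) = (cvars p :: 'a::finite cvar set)"
proof -
  have "\<exists>xs. set xs = (cvars p :: 'a cvar set)"
    by (rule finite_list) (simp add: cvars_def)
  from someI_ex[OF this] show ?thesis unfolding cvar_list_def .
qed

lemma chart_vanish:
  assumes "\<And>z. z \<in> chart \<Longrightarrow> eval_field (loc_env det_expr z) e = 0"
    "\<And>v. v \<notin> set (cvar_list CHAR('k)) \<Longrightarrow> z v = 0" "eval_field z det_expr \<noteq> 0"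
  shows "eval_field (loc_env det_expr (z :: 'i::finite cvar \<Rightarrow> 'k::field_prime_char)) e = 0"
  using assms by (simp add: chart_def cvar_list bij_phi_iff)

text \<open>The choice of the expression is irrelevant by \<open>chart_deriv_eq\<close>.\<close>

definition chart_deriv :: "('i::finite cvar \<Rightarrow> 'k::field_prime_char) \<Rightarrow> ('i cvar \<Rightarrow> 'k) \<Rightarrow> (('i cvar \<Rightarrow> 'k) \<Rightarrow> 'k) \<Rightarrow> 'k" where
  "chart_deriv z \<zeta> F = deriv_field (loc_env det_expr z) (loc_tangent det_expr z \<zeta>)
    (SOME e. \<forall>z\<in>chart. F z = eval_field (loc_env det_expr z) e)"

context
  fixes z0 \<zeta> :: "'i::finite cvar \<Rightarrow> 'k::field_prime_char"
  assumes inf: "infinite (UNIV :: 'k set)" and z0: "z0 \<in> chart"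
    and \<zeta>: "\<And>v. v \<notin> cvars CHAR('k) \<Longrightarrow> \<zeta> v = 0"
begin

lemma chart_deriv_eq:
  assumes "\<And>z. z \<in> chart \<Longrightarrow> F z = eval_field (loc_env det_expr z) e"
  shows "chart_deriv z0 \<zeta> F = deriv_field (loc_env det_expr z0) (loc_tangent det_expr z0 \<zeta>) e"
proof -
  define e' where "e' = (SOME e. \<forall>z\<in>chart. F z = eval_field (loc_env det_expr z) e)"
  have e: "\<forall>z\<in>chart. F z = eval_field (loc_env det_expr z) e'"
    unfolding e'_def by (rule someI[where P = "\<lambda>e. \<forall>z\<in>chart. F z = eval_field (loc_env det_expr z) e"]) (use assms in blast)
  have "deriv_field (loc_env det_expr z0) (loc_tangent det_expr z0 \<zeta>) (EAdd e' (EMult (EConst (- 1)) e)) = 0"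
  proof (rule deriv_field_vanish[OF inf, where vs = "cvar_list CHAR('k)"])
    show "eval_field (loc_env det_expr z) (EAdd e' (EMult (EConst (- 1)) e)) = 0"
      if "\<And>v. v \<notin> set (cvar_list CHAR('k)) \<Longrightarrow> z v = 0" "eval_field z det_expr \<noteq> 0" for z
    proof (rule chart_vanish[OF _ that])
      fix z :: "'i cvar \<Rightarrow> 'k" assume "z \<in> chart"
      from bspec[OF e this] assms[OF this] have "eval_field (loc_env det_expr z) e' = eval_field (loc_env det_expr z) e"
        by (rule trans[OF sym])
      then show "eval_field (loc_env det_expr z) (EAdd e' (EMult (EConst (- 1)) e)) = 0" by simp
    qed
  qed (use z0 \<zeta> in \<open>auto simp: cvar_list chart_def simp flip: bij_phi_iff\<close>)
  then show ?thesis by (simp add: chart_deriv_def flip: e'_def)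
qed

lemma point_derivation_chart: "point_derivation chart chart_functions z0 (chart_deriv z0 \<zeta>)"
proof (unfold_locales, goal_cases)
  case 1 show ?case by (rule z0)
next
  case (2 c) show ?case by (subst chart_deriv_eq[where e = "EConst c"]) simp_all
next
  case (3 F G)
  then obtain a b where "\<And>z. z \<in> chart \<Longrightarrow> F z = eval_field (loc_env det_expr z) a"
    "\<And>z. z \<in> chart \<Longrightarrow> G z = eval_field (loc_env det_expr z) b"
    unfolding chart_functions_def by auto
  then show ?case
    by (simp add: chart_deriv_eq[where e = a] chart_deriv_eq[where e = b] chart_deriv_eq[where e = "EAdd a b"])
next
  case (4 F G)
  then obtain a b where "\<And>z. z \<in> chart \<Longrightarrow> F z = eval_field (loc_env det_expr z) a"
    "\<And>z. z \<in> chart \<Longrightarrow> G z = eval_field (loc_env det_expr z) b"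
    unfolding chart_functions_def by auto
  then show ?case using z0
    by (simp add: chart_deriv_eq[where e = a] chart_deriv_eq[where e = b] chart_deriv_eq[where e = "EMult a b"])
next
  case (5 F G)
  then obtain a where "\<And>z. z \<in> chart \<Longrightarrow> F z = eval_field (loc_env det_expr z) a"
    unfolding chart_functions_def by auto
  with 5 show ?case by (simp add: chart_deriv_eq[where e = a])
qed

lemma chart_deriv_coordinate: "chart_deriv z0 \<zeta> (\<lambda>z. z v) = \<zeta> v"
  by (subst chart_deriv_eq[where e = "EVar (Some v)"]) simp_all

text \<open>The tangent vector at \<open>\<phi>\<close> of the left invariant vector field given by a derivation that preserves
  the maximal ideal.\<close>

lemma has_deriv_phi:
  assumes D: "D \<in> W0" "\<And>j a. a \<in> reduced CHAR('k) \<Longrightarrow> a \<noteq> 0 \<Longrightarrow> \<zeta> (j, a) = tcoeff (phi z0 (wapply D (tvar j))) a"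
  shows "point_derivation.has_deriv chart_functions (chart_deriv z0 \<zeta>) (\<lambda>z. phi z (tvar j)) (phi z0 (wapply D (tvar j)))"
proof -
  interpret point_derivation chart chart_functions z0 "chart_deriv z0 \<zeta>" by (rule point_derivation_chart)
  have "tcoeff (phi z0 (wapply D (tvar j))) 0 = 0"
    using D(1) alg_hom_eps[OF alg_hom_phi, of z0 "wapply D (tvar j)"] by (simp add: eps_def W0_def)
  moreover have "(\<lambda>z. tcoeff (phi z (tvar j)) a) = (if a \<in> reduced CHAR('k) \<and> a \<noteq> 0 then (\<lambda>z. z (j, a)) else (\<lambda>_. 0 :: 'k))" for a
    by (auto simp: tcoeff_gpoint)
  ultimately show ?thesis
    unfolding has_deriv_def using chart_regular_phi[of "tvar j"]
    by (auto simp: d_const chart_deriv_coordinate D(2) tcoeff_not_reduced)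
qed

end

text \<open>The action of ring automorphisms on derivations.\<close>

definition wconj :: "(('k, 'i) trunc_poly \<Rightarrow> ('k, 'i) trunc_poly) \<Rightarrow> ('k, 'i) witt \<Rightarrow> ('k::field_prime_char, 'i::finite) witt" where
  "wconj \<phi> D = Abs_witt (\<lambda>f. \<phi> (wapply D (tinv \<phi> f)))"

lemma alg_hom_tinv:
  assumes "alg_hom \<phi>" "bij \<phi>" shows "alg_hom (tinv \<phi>)"
proof -
  have A: "\<phi> (tinv \<phi> f) = f" "tinv \<phi> (\<phi> f) = f" for f
    using assms(2) by (simp_all add: bij_is_surj surj_f_inv_f bij_is_inj)
  show ?thesis unfolding alg_hom_def
  proof (intro conjI allI)
    show "tinv \<phi> (f + g) = tinv \<phi> f + tinv \<phi> g" for f g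
      using A(2)[of "tinv \<phi> f + tinv \<phi> g"] by (simp add: alg_homD[OF assms(1)] A(1))
    show "tinv \<phi> (f * g) = tinv \<phi> f * tinv \<phi> g" for f g
      using A(2)[of "tinv \<phi> f * tinv \<phi> g"] by (simp add: alg_homD[OF assms(1)] A(1))
    show "tinv \<phi> (tconst c) = tconst c" for c
      using A(2)[of "tconst c"] by (simp add: alg_homD[OF assms(1)])
  qed
qed

lemma wapply_wconj:
  assumes "alg_hom \<phi>" "bij \<phi>"
  shows "wapply (wconj \<phi> D) f = \<phi> (wapply D (tinv \<phi> f))"
proof -
  have A: "\<phi> (tinv \<phi> f) = f" for f
    using assms(2) by (simp add: bij_is_surj surj_f_inv_f)
  note hom = alg_homD[OF assms(1)] alg_homD[OF alg_hom_tinv[OF assms]]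
  have "derivation (\<lambda>f. \<phi> (wapply D (tinv \<phi> f)))"
    by (rule derivationI) (simp_all add: hom wapply_mult A)
  then show ?thesis by (simp add: wconj_def Abs_witt_inverse)
qed

lemma (in point_derivation) functional_deriv:
  fixes M :: "'z \<Rightarrow> ('k, 'i::finite) witt"
  assumes "\<And>i. has_deriv (\<lambda>z. wapply (M z) (tvar i)) (wapply M' (tvar i))" "wlin l"
  shows "(\<lambda>z. l (M z)) \<in> \<A>" "\<delta> (\<lambda>z. l (M z)) = l M'"
proof -
  have c: "(\<lambda>z. wcoord r (M z)) \<in> \<A>" "\<delta> (\<lambda>z. wcoord r (M z)) = wcoord r M'" for r
    using assms(1)[of "fst r"] by (auto simp: wcoord_def has_deriv_def regular_tpD)
  have l: "(\<lambda>z. l (M z)) = (\<lambda>z. \<Sum>r\<in>UNIV \<times> reduced CHAR('k). wcoord r (M z) * l (wbasis r))"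
    by (rule ext) (rule wlin_expand[OF assms(2)])
  show "(\<lambda>z. l (M z)) \<in> \<A>"
    unfolding l by (intro sum_in mult_in const_in c)
  have "\<delta> (\<lambda>z. l (M z)) = (\<Sum>r\<in>UNIV \<times> reduced CHAR('k). \<delta> (\<lambda>z. wcoord r (M z) * l (wbasis r)))"
    unfolding l by (intro d_sum mult_in const_in c)
  also have "\<dots> = (\<Sum>r\<in>UNIV \<times> reduced CHAR('k). wcoord r M' * l (wbasis r))"
    by (intro sum.cong refl) (simp add: d_mult c const_in d_const)
  finally show "\<delta> (\<lambda>z. l (M z)) = l M'" unfolding wlin_expand[OF assms(2), of M', symmetric] .
qed

lemma (in point_derivation) has_deriv_wconj:
  assumes hom: "\<And>z. z \<in> S \<Longrightarrow> alg_hom (\<phi> z)" "\<And>z. z \<in> S \<Longrightarrow> bij (\<phi> z)"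
    and var: "\<And>i. has_deriv (\<lambda>z. \<phi> z (tvar i)) (\<phi> z0 (wapply D (tvar i)))"
    and inv: "\<And>h. regular_tp (\<lambda>z. tinv (\<phi> z) h)"
    and X: "\<And>h. has_deriv (\<lambda>z. wapply (X z) h) (wapply X' h)"
  shows "has_deriv (\<lambda>z. wapply (wconj (\<phi> z) (X z)) h)
    (wapply (wconj (\<phi> z0) (wbracket D (X z0) + X')) h)"
  unfolding wapply_wconj[OF hom(1)[OF z0] hom(2)[OF z0]]
  by (rule has_deriv_cong[OF has_deriv_conjugate[OF hom var inv X]]) (simp_all add: wapply_wconj hom)

definition chart_id :: "'i::finite cvar \<Rightarrow> 'k::field_prime_char" where
  "chart_id v = (if snd v = Poly_Mapping.single (fst v) 1 then 1 else 0)"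

lemma CHAR_gt_1: "1 < CHAR('k::field_prime_char)"
  using prime_CHAR prime_gt_1_nat by blast

lemma single_reduced: "Poly_Mapping.single j 1 \<in> reduced CHAR('k::field_prime_char)"
  using CHAR_gt_1[where 'k='k] by (auto simp: reduced_def lookup_single when_def)

lemma single_neq_0: "Poly_Mapping.single j (1::nat) \<noteq> 0"
  by (metis lookup_single_eq lookup_zero zero_neq_one)

lemma phi_chart_id: "phi chart_id = (\<lambda>f. f :: ('k::field_prime_char, 'i::finite) trunc_poly)"
proof (rule alg_hom_ext[OF alg_hom_phi])
  show "alg_hom (\<lambda>f. f :: ('k, 'i) trunc_poly)" by (simp add: alg_hom_def)
  fix j :: 'i
  show "phi chart_id (tvar j) = (tvar j :: ('k, 'i) trunc_poly)"
    unfolding phi_tvar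
    by (rule tcoeff_eqI)
      (auto simp: tcoeff_gpoint chart_id_def tcoeff_tmon single_neq_0 simp del: One_nat_def simp flip: tmon_single_1)
qed

lemma chart_id: "chart_id \<in> chart"
  unfolding chart_def mem_Collect_eq phi_chart_id
  by (auto simp: chart_id_def cvars_def single_reduced simp del: One_nat_def intro: bijI')

text \<open>The orbit map of \<open>y\<close> composed with \<open>l\<close> is a regular function that vanishes identically; its derivative at
  the identity in the direction \<open>D\<close> is \<open>l [D, y]\<close>.\<close>

lemma orbit_functional_vanish:
  fixes y :: "('k::field_prime_char, 'i::finite) witt"
  assumes inf: "infinite (UNIV :: 'k set)" and D: "D \<in> W0" and l: "wlin l"
    and vanish: "\<And>z. z \<in> chart \<Longrightarrow> l (wconj (phi z) y) = 0"
  shows "l (wbracket D y) = 0"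
proof -
  let ?\<zeta> = "\<lambda>v. if v \<in> cvars CHAR('k) then tcoeff (wapply D (tvar (fst v))) (snd v) else 0"
  interpret point_derivation chart chart_functions chart_id "chart_deriv chart_id ?\<zeta>"
    by (rule point_derivation_chart[OF inf chart_id]) simp
  have var: "has_deriv (\<lambda>z. phi z (tvar i)) (phi chart_id (wapply D (tvar i)))" for i
    by (rule has_deriv_phi[OF inf chart_id _ D]) (simp_all add: phi_chart_id cvars_def)
  have "has_deriv (\<lambda>z. wapply (wconj (phi z) y) h) (wapply (wconj (phi chart_id) (wbracket D y + 0)) h)" for h
    by (rule has_deriv_wconj[OF alg_hom_phi _ var chart_regular_inverse])
       (simp_all add: chart_def has_deriv_const)
  moreover have "wconj (phi chart_id) E = E" for E :: "('k, 'i) witt"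
  proof (rule witt_eqI)
    fix f :: "('k, 'i) trunc_poly"
    have "tinv (\<lambda>f. f) f = f" by (rule inv_f_f[of "\<lambda>f. f"]) simp
    moreover have "(chart_id :: 'i cvar \<Rightarrow> 'k) \<in> chart" by (rule chart_id)
    then have "bij (phi chart_id :: ('k, 'i) trunc_poly \<Rightarrow> _)" by (simp add: chart_def)
    ultimately show "wapply (wconj (phi chart_id) E) f = wapply E f"
      by (simp only: wapply_wconj[OF alg_hom_phi]) (simp only: phi_chart_id)
  qed
  ultimately have "has_deriv (\<lambda>z. wapply (wconj (phi z) y) h) (wapply (wbracket D y) h)" for h
    by simp
  from functional_deriv[OF this l] have "chart_deriv chart_id ?\<zeta> (\<lambda>z. l (wconj (phi z) y)) = l (wbracket D y)"
    by blast
  moreover have "chart_deriv chart_id ?\<zeta> (\<lambda>z. l (wconj (phi z) y)) = chart_deriv chart_id ?\<zeta> (\<lambda>_. 0)"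
    by (rule sym, rule d_cong[OF chart.const_in]) (simp add: vanish)
  ultimately show ?thesis by (simp add: d_const)
qed

section \<open>Automorphisms of the Witt algebra\<close>

lemma witt_autD:
  assumes "g \<in> witt_aut"
  shows "g (D + E) = g D + g E" "g (wscale c D) = wscale c (g D)" "bij g"
    "g (wbracket D E) = wbracket (g D) (g E)" "g (wpower D) = wpower (g D)"
    "g 0 = 0" "g (- D) = - g D" "g (D - E) = g D - g E" "g (tinv g D) = D" "tinv g (g D) = D"
proof -
  show add: "g (D + E) = g D + g E" for D E using assms by (simp add: witt_aut_def witt_linear_iff)
  show 0: "g 0 = 0" using add[of 0 0] by simp
  show minus: "g (- D) = - g D" for D using add[of D "- D"] 0 by (simp add: eq_neg_iff_add_eq_0 add.commute)
  show "g (D - E) = g D - g E" using add[of D "- E"] minus by simp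
  show "bij g" using assms by (simp add: witt_aut_def)
  then show "g (tinv g D) = D" "tinv g (g D) = D"
    by (simp_all add: bij_is_surj surj_f_inv_f bij_is_inj)
qed (use assms in \<open>simp_all add: witt_aut_def witt_linear_iff\<close>)

lemma witt_aut_sum: "g \<in> witt_aut \<Longrightarrow> g (sum f A) = (\<Sum>x\<in>A. g (f x))"
  by (induction A rule: infinite_finite_induct) (simp_all add: witt_autD)

lemma witt_autI:
  assumes "\<And>D E. g (D + E) = g D + g E" "\<And>c D. g (wscale c D) = wscale c (g D)" "bij g"
    "\<And>D E. g (wbracket D E) = wbracket (g D) (g E)" "\<And>D. g (wpower D) = wpower (g D)"
  shows "g \<in> witt_aut"
  using assms by (simp add: witt_aut_def witt_linear_iff)

lemma tinv_witt_aut: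
  assumes g: "g \<in> witt_aut" shows "tinv g \<in> witt_aut"
proof -
  note g' = witt_autD[OF g]
  have inj: "x = y" if "g x = g y" for x y using that g'(3) by (simp add: bij_is_inj inj_eq)
  show ?thesis
    by (rule witt_autI; (rule inj)?) (simp_all add: g' bij_imp_bij_inv)
qed

lemma comp_witt_aut:
  assumes "g \<in> witt_aut" "h \<in> witt_aut" shows "(\<lambda>D. g (h D)) \<in> witt_aut"
proof (rule witt_autI)
  show "bij (\<lambda>D. g (h D))" using bij_comp[OF witt_autD(3)[OF assms(2)] witt_autD(3)[OF assms(1)]] by (simp add: comp_def)
qed (simp_all add: witt_autD[OF assms(1)] witt_autD[OF assms(2)])

lemma wapply_wpower: "wapply (wpower D) f = (wapply D ^^ CHAR('k)) f"
  for D :: "('k::field_prime_char, 'i::finite) witt"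
  by (simp add: wpower.rep_eq)

lemma wconj_witt_aut:
  assumes \<phi>: "alg_hom \<phi>" "bij \<phi>"
  shows "wconj \<phi> \<in> witt_aut"
proof (rule witt_autI)
  have A: "\<phi> (tinv \<phi> f) = f" "tinv \<phi> (\<phi> f) = f" for f
    using assms(2) by (simp_all add: bij_is_surj surj_f_inv_f bij_is_inj)
  note hom = alg_homD[OF \<phi>(1)] alg_homD[OF alg_hom_tinv[OF \<phi>]] wapply_wconj[OF \<phi>]
  have \<psi>: "alg_hom (tinv \<phi>)" "bij (tinv \<phi>)" "tinv (tinv \<phi>) = \<phi>"
    using \<phi> by (simp_all add: alg_hom_tinv bij_imp_bij_inv inv_inv_eq)
  show "bij (wconj \<phi>)"
  proof (rule o_bij)
    show "wconj (tinv \<phi>) \<circ> wconj \<phi> = id" "wconj \<phi> \<circ> wconj (tinv \<phi>) = id"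
      by (rule ext, rule witt_eqI, simp add: hom wapply_wconj[OF \<psi>(1,2)] \<psi>(3) A)+
  qed
  show "wconj \<phi> (wpower D) = wpower (wconj \<phi> D)" for D
  proof (rule witt_eqI)
    fix f
    have "(wapply (wconj \<phi> D) ^^ n) f = \<phi> ((wapply D ^^ n) (tinv \<phi> f))" for n
      by (induction n) (simp_all add: A hom)
    then show "wapply (wconj \<phi> (wpower D)) f = wapply (wpower (wconj \<phi> D)) f"
      by (simp add: hom wapply_wpower)
  qed
qed (rule witt_eqI, simp add: wapply_wconj[OF assms] alg_homD[OF assms(1)] alg_homD[OF alg_hom_tinv[OF assms]] inv_f_f[OF bij_is_inj[OF assms(2)]])+

text \<open>Being defined by the bracket alone, these elements are permuted by all automorphisms of the Lie algebra.\<close>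

definition sandwiches :: "('k::field_prime_char, 'i::finite) witt set" where
  "sandwiches = {c. \<forall>y. wbracket c (wbracket c y) = 0}"

lemma of_nat_neq_0:
  assumes "0 < n" "n < CHAR('k)" shows "(of_nat n :: 'k::field_prime_char) \<noteq> 0"
  unfolding of_nat_eq_0_iff_char_dvd using assms by (simp add: nat_dvd_not_less)

lemma eps_of_nat [simp]: "eps (of_nat n) = of_nat n"
  by (induction n) simp_all

lemma eps_numeral [simp]: "eps (numeral n) = numeral n"
  using eps_of_nat[of "numeral n"] by simp

text \<open>If \<open>u = c(x\<^sub>j)\<close> is a unit, then \<open>(ad c)\<^sup>2(x\<^sub>j\<^sup>2 c) = c\<^sup>2(x\<^sub>j\<^sup>2) c\<close>, whose value on \<open>x\<^sub>j\<close> has constant term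
  \<open>2 u(0)\<^sup>3\<close>.\<close>

lemma sandwiches_W0:
  fixes c :: "('k::field_prime_char, 'i::finite) witt"
  assumes p: "CHAR('k) > 2" and c: "c \<in> sandwiches"
  shows "c \<in> W0"
proof (rule ccontr)
  assume "c \<notin> W0"
  then obtain j where u: "eps (wapply c (tvar j)) \<noteq> 0" by (auto simp: W0_iff)
  have "wapply (wbracket c (wbracket c (wmult (tvar j ^ 2) c))) (tvar j) = 0"
    using c by (simp add: sandwiches_def)
  then have "wapply c (wapply c (tvar j ^ 2)) * wapply c (tvar j) = 0"
    by (simp add: wapply_mult algebra_simps)
  then have "eps (wapply c (wapply c (tvar j * tvar j)) * wapply c (tvar j)) = 0"
    by (simp add: power2_eq_square)
  moreover have "(2 :: 'k) \<noteq> 0" using of_nat_neq_0[of 2, where 'k='k] p by simp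
  ultimately show False using u by (simp add: wapply_mult)
qed

text \<open>With \<open>f = x\<^sub>j\<^sup>s\<close>, every term of \<open>(ad f D\<^sub>i)\<^sup>2\<close> contains \<open>f\<^sup>2\<close> or \<open>x\<^sub>j\<^sup>2\<^sup>s\<^sup>-\<^sup>1\<close>, and both vanish.\<close>

lemma monomial_sandwich:
  fixes i j :: "'i::finite"
  assumes "i \<noteq> j" "CHAR('k::field_prime_char) < 2 * s"
  shows "wmult (tvar j ^ s) (wpartial i) \<in> (sandwiches :: ('k, 'i) witt set)"
  unfolding sandwiches_def mem_Collect_eq
proof (rule allI, rule witt_eqI_var)
  fix y :: "('k, 'i) witt" and l
  define D :: "('k, 'i) witt" where "D = wpartial i"
  define f :: "('k, 'i) trunc_poly" where "f = tvar j ^ s"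
  define e :: 'k where "e = (if i = l then 1 else 0)"
  have Dl: "wapply D (tvar l) = tconst e" by (simp add: D_def wapply_wpartial e_def tconst_1)
  have Dj: "wapply D (tvar j) = 0" using assms(1) by (simp add: D_def wapply_wpartial)
  have Df: "wapply D f = 0" by (simp add: f_def wapply_power Dj)
  have ff: "f * f = 0" using assms(2) by (simp add: f_def tvar_power_zero flip: power_add mult_2)
  have "tvar j ^ s * tvar j ^ (s - 1) = (0 :: ('k, 'i) trunc_poly)"
    using assms(2) by (subst power_add[symmetric]) (intro tvar_power_zero, linarith)
  note zero = this
  have "f * (of_nat s * tvar j ^ (s - 1) * wapply D (wapply y (tvar j))) = 0"
  proof -
    have "f * (of_nat s * tvar j ^ (s - 1) * wapply D (wapply y (tvar j))) =
      of_nat s * wapply D (wapply y (tvar j)) * (tvar j ^ s * tvar j ^ (s - 1))"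
      by (simp only: f_def mult_ac)
    then show ?thesis by (simp only: zero mult_zero_right)
  qed
  moreover have "wapply D (wapply y f) = of_nat s * tvar j ^ (s - 1) * wapply D (wapply y (tvar j))"
  proof -
    have "wapply D (of_nat n * h) = of_nat n * wapply D h" for n h
      by (induction n) (simp_all add: distrib_right)
    then show ?thesis by (simp add: f_def wapply_power wapply_mult Dj mult.assoc)
  qed
  ultimately have fD: "f * wapply D (wapply y f) = 0" by simp
  have "wapply (wbracket (wmult f D) (wbracket (wmult f D) y)) (tvar l) =
    f * f * wapply D (wapply D (wapply y (tvar l))) - 2 * tconst e * (f * wapply D (wapply y f))"
    by (simp add: Dl wapply_mult Df algebra_simps)
  then show "wapply (wbracket (wmult (tvar j ^ s) (wpartial i)) (wbracket (wmult (tvar j ^ s) (wpartial i)) y)) (tvar l) =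
      wapply 0 (tvar l)"
    by (simp add: ff fD flip: f_def D_def)
qed

lemma witt_aut_sandwiches:
  assumes g: "g \<in> witt_aut" and c: "c \<in> sandwiches"
  shows "g c \<in> sandwiches"
  unfolding sandwiches_def mem_Collect_eq
proof
  fix y
  have "wbracket c (wbracket c (tinv g y)) = 0" using c by (simp add: sandwiches_def)
  then have "g (wbracket c (wbracket c (tinv g y))) = 0" by (simp only: witt_autD(6)[OF g])
  then show "wbracket (g c) (wbracket (g c) y) = 0" by (simp only: witt_autD(4,9)[OF g])
qed

text \<open>The linear span of the sandwich elements as a double annihilator. In this form its stability under \<open>W\<^sub>0\<close>
  follows by differentiating regular functions on the group.\<close>

definition sandwich_span :: "('k::field_prime_char, 'i::finite) witt set" where
  "sandwich_span = {y. \<forall>l. wlin l \<longrightarrow> (\<forall>c\<in>sandwiches. l c = 0) \<longrightarrow> l y = 0}"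

lemma sandwiches_span: "sandwiches \<subseteq> sandwich_span"
  by (auto simp: sandwich_span_def)

lemma sandwich_span_W0:
  fixes y :: "('k::field_prime_char, 'i::finite) witt"
  assumes p: "CHAR('k) > 2" and y: "y \<in> sandwich_span"
  shows "y \<in> W0"
  unfolding W0_iff
proof
  fix i
  have "wlin (\<lambda>D :: ('k, 'i) witt. eps (wapply D (tvar i)))" by (simp add: wlin_def)
  moreover have "eps (wapply c (tvar i)) = 0" if "c \<in> sandwiches" for c :: "('k, 'i) witt"
    using sandwiches_W0[OF p that] by (simp add: W0_def)
  ultimately show "eps (wapply y (tvar i)) = 0"
    using y unfolding sandwich_span_def mem_Collect_eq
    by (elim allE[of _ "\<lambda>D. eps (wapply D (tvar i))"] impE) auto
qed

lemma wlin_comp_witt_aut: "g \<in> witt_aut \<Longrightarrow> wlin l \<Longrightarrow> wlin (\<lambda>D. l (g D))"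
  by (simp add: wlin_def witt_autD)

lemma witt_aut_sandwich_span:
  assumes g: "g \<in> witt_aut" and y: "y \<in> sandwich_span"
  shows "g y \<in> sandwich_span"
  unfolding sandwich_span_def mem_Collect_eq
proof (intro allI impI)
  fix l :: "('a, 'b) witt \<Rightarrow> 'a"
  assume l: "wlin l" "\<forall>c\<in>sandwiches. l c = 0"
  have "\<forall>c\<in>sandwiches. l (g c) = 0" using l(2) witt_aut_sandwiches[OF g] by blast
  with y wlin_comp_witt_aut[OF g l(1)] show "l (g y) = 0"
    unfolding sandwich_span_def by blast
qed

text \<open>The span is stable under the automorphisms of the truncated polynomial ring, hence under their Lie
  algebra \<open>W\<^sub>0\<close>.\<close>

lemma W0_sandwich_span:
  fixes y :: "('k::field_prime_char, 'i::finite) witt"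
  assumes inf: "infinite (UNIV :: 'k set)" and D: "D \<in> W0" and y: "y \<in> sandwich_span"
  shows "wbracket D y \<in> sandwich_span"
  unfolding sandwich_span_def mem_Collect_eq
proof (intro allI impI)
  fix l :: "('k, 'i) witt \<Rightarrow> 'k"
  assume l: "wlin l" "\<forall>c\<in>sandwiches. l c = 0"
  show "l (wbracket D y) = 0"
  proof (rule orbit_functional_vanish[OF inf D l(1)])
    fix z :: "'i cvar \<Rightarrow> 'k" assume "z \<in> chart"
    then have "wconj (phi z) \<in> witt_aut" by (intro wconj_witt_aut alg_hom_phi) (simp add: chart_def)
    from witt_aut_sandwich_span[OF this y] l show "l (wconj (phi z) y) = 0"
      unfolding sandwich_span_def by blast
  qed
qed

text \<open>If \<open>y\<close> moves the origin in direction \<open>x\<^sub>j\<close>, then bracketing \<open>x\<^sub>j\<^sup>s D\<^sub>i\<close> with \<open>y\<close> lowers the power of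
  \<open>x\<^sub>j\<close> in the leading term, one step at a time, until \<open>D\<^sub>i\<close> appears.\<close>

lemma normalizer_sandwich_span:
  fixes y :: "('k::field_prime_char, 'i::finite) witt"
  assumes p: "CHAR('k) > 2" and card: "CARD('i) \<ge> 2"
    and y: "\<And>s. s \<in> sandwich_span \<Longrightarrow> wbracket y s \<in> sandwich_span"
  shows "y \<in> W0"
proof (rule ccontr)
  assume "y \<notin> W0"
  then obtain j where u0: "eps (wapply y (tvar j)) \<noteq> 0" by (auto simp: W0_iff)
  define u where "u = wapply y (tvar j)"
  obtain i where ij: "i \<noteq> j"
  proof -
    have "UNIV \<noteq> {j}"
    proof
      assume "UNIV = {j}"
      from arg_cong[OF this, of card] card show False by simp
    qed
    then show ?thesis using that by auto
  qed
  (* The least exponent for which the square of x_j^s vanishes; it is less than p because p > 2. *)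
  define s where "s = CHAR('k) div 2 + 1"
  have s: "CHAR('k) < 2 * s" "s < CHAR('k)" using p by (auto simp: s_def)
  have "\<exists>a R. a \<noteq> 0 \<and> wmult (tconst a * tvar j ^ (s - k) * u ^ k) (wpartial i) + wmult (tvar j ^ (s - k + 1)) R \<in> sandwich_span"
    if "k \<le> s" for k
    using that
  proof (induction k)
    case 0
    have "wmult (tconst 1 * tvar j ^ (s - 0) * u ^ 0) (wpartial i) + wmult (tvar j ^ (s - 0 + 1)) 0 =
      wmult (tvar j ^ s) (wpartial i)"
      by (rule witt_eqI) (simp add: tconst_1)
    then show ?case
      using monomial_sandwich[OF ij s(1)] sandwiches_span by (intro exI[of _ 1] exI[of _ 0]) auto
  next
    case (Suc k)
    then obtain a R where a: "a \<noteq> 0"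
      "wmult (tconst a * tvar j ^ (s - k) * u ^ k) (wpartial i) + wmult (tvar j ^ (s - k + 1)) R \<in> sandwich_span" by auto
    define r where "r = s - Suc k"
    have r: "s - k = Suc r" using Suc.prems by (simp add: r_def)
    have ar: "a * of_nat (Suc r) \<noteq> 0"
      using a(1) of_nat_neq_0[of "Suc r", where 'k='k] s r by (simp del: of_nat_Suc)
    let ?R = "wmult (tconst a * wapply y (u ^ k)) (wpartial i) + wmult (tconst a * u ^ k) (wbracket y (wpartial i))
      + wmult (of_nat (Suc (Suc r)) * u) R + wmult (tvar j) (wbracket y R)"
    have "wbracket y (wmult (tconst a * tvar j ^ Suc r * u ^ k) (wpartial i) + wmult (tvar j ^ (Suc r + 1)) R)
      = wmult (tconst (a * of_nat (Suc r)) * tvar j ^ r * u ^ Suc k) (wpartial i) + wmult (tvar j ^ (r + 1)) ?R"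
    proof (rule witt_eqI)
      fix h
      have of_nat: "tconst (of_nat n) = (of_nat n :: ('k, 'i) trunc_poly)" for n
        by (induction n) (simp_all add: tconst_add tconst_1)
      have pow: "wapply y (tvar j ^ Suc n) = of_nat (Suc n) * tvar j ^ n * u" for n
        unfolding wapply_power u_def by simp
      show "wapply (wbracket y (wmult (tconst a * tvar j ^ Suc r * u ^ k) (wpartial i) + wmult (tvar j ^ (Suc r + 1)) R)) h =
        wapply (wmult (tconst (a * of_nat (Suc r)) * tvar j ^ r * u ^ Suc k) (wpartial i) + wmult (tvar j ^ (r + 1)) ?R) h"
        by (simp add: wapply_mult pow tconst_mult of_nat del: power_Suc of_nat_Suc) (simp add: algebra_simps)
    qed
    with y[OF a(2)[unfolded r]] ar show ?case unfolding r_def[symmetric] by metis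
  qed
  from this[of s] obtain a R where a: "a \<noteq> 0"
    "wmult (tconst a * u ^ s) (wpartial i) + wmult (tvar j) R \<in> sandwich_span" by auto
  from sandwich_span_W0[OF p a(2)] have "eps (wapply (wmult (tconst a * u ^ s) (wpartial i) + wmult (tvar j) R) (tvar i)) = 0"
    unfolding W0_def by blast
  then show False using a(1) u0 by (simp add: wapply_wpartial u_def)
qed

text \<open>\<open>W\<^sub>0\<close> is the normalizer of the span of the sandwich elements, and automorphisms preserve this span.\<close>

lemma witt_aut_W0:
  fixes g :: "('k::field_prime_char, 'i::finite) witt \<Rightarrow> ('k, 'i) witt"
  assumes inf: "infinite (UNIV :: 'k set)" and p: "CHAR('k) > 2" and card: "CARD('i) \<ge> 2"
    and g: "g \<in> witt_aut" and D: "D \<in> W0"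
  shows "g D \<in> W0"
proof (rule normalizer_sandwich_span[OF p card])
  fix s :: "('k, 'i) witt" assume "s \<in> sandwich_span"
  then have "tinv g s \<in> sandwich_span" by (rule witt_aut_sandwich_span[OF tinv_witt_aut[OF g]])
  then have "g (wbracket D (tinv g s)) \<in> sandwich_span"
    by (intro witt_aut_sandwich_span[OF g] W0_sandwich_span[OF inf D])
  then show "wbracket (g D) s \<in> sandwich_span" by (simp add: witt_autD[OF g])
qed

section \<open>Every automorphism is a change of variables\<close>

definition degree_of :: "('i::finite \<Rightarrow>\<^sub>0 nat) \<Rightarrow> nat" where
  "degree_of a = (\<Sum>i\<in>UNIV. lk a i)"

text \<open>The powers of the maximal ideal.\<close>

inductive_set order_ge :: "nat \<Rightarrow> ('k::field_prime_char, 'i::finite) trunc_poly set" for d where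
  mon: "d \<le> degree_of a \<Longrightarrow> tscale c (tmon a) \<in> order_ge d"
| add: "f \<in> order_ge d \<Longrightarrow> g \<in> order_ge d \<Longrightarrow> f + g \<in> order_ge d"

lemma ord_0 [simp]: "f \<in> order_ge 0"
  by (induction f rule: trunc_poly_induct) (auto intro: order_ge.intros)

lemma ord_zero [simp]: "(0 :: ('k::field_prime_char, 'i::finite) trunc_poly) \<in> order_ge d"
proof -
  have "(tscale 0 (tmon (\<Sum>i\<in>UNIV. Poly_Mapping.single (i :: 'i) d)) :: ('k, 'i) trunc_poly) \<in> order_ge d"
  proof (rule order_ge.mon)
    have "d * 1 \<le> d * CARD('i)" by (intro mult_le_mono2) (simp add: Suc_le_eq)
    then show "d \<le> degree_of (\<Sum>i\<in>UNIV. Poly_Mapping.single (i :: 'i) d)"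
      by (simp add: degree_of_def lookup_sum lookup_single when_def mult.commute)
  qed
  then show ?thesis by simp
qed

lemma ord_sum: "(\<And>x. x \<in> A \<Longrightarrow> f x \<in> order_ge d) \<Longrightarrow> sum f A \<in> order_ge d"
  by (induction A rule: infinite_finite_induct) (auto intro: order_ge.add)

lemma degree_of_add: "degree_of (a + b) = degree_of a + degree_of b"
  by (simp add: degree_of_def lookup_add sum.distrib)

lemma ord_mult:
  assumes "f \<in> order_ge d" "g \<in> order_ge e"
  shows "f * g \<in> order_ge (d + e)"
  using assms(1)
proof (induction rule: order_ge.induct)
  case (mon a c)
  from assms(2) show ?case
  proof (induction rule: order_ge.induct)
    case (mon b c')
    have "tscale c (tmon a) * tscale c' (tmon b) = tscale (c * c') (tmon (a + b))"
      by (simp add: tscale_def tmon_add tconst_mult mult_ac)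
    then show ?case using \<open>d \<le> degree_of a\<close> mon by (auto simp: degree_of_add intro!: order_ge.mon)
  qed (simp add: distrib_left order_ge.add)
qed (simp add: distrib_right order_ge.add)

lemma degree_of_pos: "a \<noteq> 0 \<Longrightarrow> 0 < degree_of a"
  by (auto simp: degree_of_def poly_mapping_eq_iff fun_eq_iff intro!: sum_pos2)

lemma degree_of_0 [simp]: "degree_of 0 = 0"
  by (simp add: degree_of_def)

lemma ord_Suc_eps: "f \<in> order_ge (Suc d) \<Longrightarrow> eps f = 0"
  by (induction rule: order_ge.induct) (auto simp: eps_tmon)

lemma eps_ord_1:
  fixes f :: "('k::field_prime_char, 'i::finite) trunc_poly"
  assumes "eps f = 0" shows "f \<in> order_ge 1"
proof -
  have "tscale (tcoeff f a) (tmon a) \<in> order_ge 1" for a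
    using assms degree_of_pos[of a] by (cases "a = 0") (auto simp: eps_def intro: order_ge.mon)
  then show ?thesis by (subst trunc_poly_expand) (auto intro: ord_sum)
qed

lemma degree_of_decrement: "lk a i \<noteq> 0 \<Longrightarrow> degree_of a = Suc (degree_of (a - Poly_Mapping.single i 1))"
proof -
  assume "lk a i \<noteq> 0"
  then have "degree_of a = degree_of (Poly_Mapping.single i 1 + (a - Poly_Mapping.single i 1))"
    using exponent_decompose by metis
  then show ?thesis by (simp add: degree_of_add) (simp add: degree_of_def lookup_single when_def)
qed

lemma tpderiv_tscale: "tpderiv j (tscale c f) = tscale c (tpderiv j f)"
  by (simp add: tscale_def derivationD[OF derivation_tpderiv])

lemma ord_tpderiv:
  assumes "f \<in> order_ge (Suc d)" shows "tpderiv j f \<in> order_ge d"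
proof -
  have "wapply (wpartial j) f \<in> order_ge d"
    using assms
  proof (induction rule: order_ge.induct)
    case (mon a c)
    then show ?case using degree_of_decrement[of a j]
      by (cases "lk a j = 0") (auto simp: wapply_wpartial tpderiv_tmon tpderiv_tscale simp del: One_nat_def intro!: order_ge.mon)
  qed (simp add: order_ge.add)
  then show ?thesis by (simp add: wapply_wpartial)
qed

lemma wapply_expand: "wapply E f = (\<Sum>j\<in>UNIV. wapply E (tvar j) * tpderiv j f)"
proof -
  have "E = wfield (\<lambda>j. wapply E (tvar j))" by (rule witt_eqI_var) simp
  then have "wapply E f = wapply (wfield (\<lambda>j. wapply E (tvar j))) f" by (rule arg_cong)
  then show ?thesis by (simp only: wapply_wfield)
qed

lemma ord_wapply: "f \<in> order_ge (Suc d) \<Longrightarrow> wapply E f \<in> order_ge d"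
  unfolding wapply_expand[of E f]
  using ord_mult[OF ord_0 ord_tpderiv] by (intro ord_sum) fastforce

lemma ord_W0:
  assumes "E \<in> W0" "f \<in> order_ge d" shows "wapply E f \<in> order_ge d"
proof (cases d)
  case (Suc e)
  have "wapply E (tvar j) * tpderiv j f \<in> order_ge (1 + e)" for j
    using assms Suc by (intro ord_mult eps_ord_1 ord_tpderiv) (auto simp: W0_def)
  then show ?thesis unfolding wapply_expand[of E f] Suc by (intro ord_sum) simp
qed simp

lemma funpow_ord:
  assumes "E - P \<in> W0" "f \<in> order_ge (d + n)" "f - f' \<in> order_ge (Suc (d + n))"
  shows "(wapply E ^^ n) f \<in> order_ge d \<and> (wapply E ^^ n) f - (wapply P ^^ n) f' \<in> order_ge (Suc d)"
  using assms(2,3)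
proof (induction n arbitrary: d)
  case (Suc n)
  let ?f = "(wapply E ^^ n) f" and ?f' = "(wapply P ^^ n) f'"
  from Suc have IH: "?f \<in> order_ge (Suc d)" "?f - ?f' \<in> order_ge (Suc (Suc d))" by simp_all
  have "wapply E ?f - wapply P ?f' = wapply (E - P) ?f + wapply P (?f - ?f')" by simp
  also have "\<dots> \<in> order_ge (Suc d)"
    by (intro order_ge.add ord_W0[OF assms(1)] ord_wapply IH)
  finally show ?case using ord_wapply[OF IH(1)] by simp
qed simp

text \<open>The product of the powers \<open>E\<^sub>l\<^bsup>n l\<^esup>\<close> over the list.\<close>

primrec iterop :: "('i \<Rightarrow> ('k, 'i) witt) \<Rightarrow> 'i list \<Rightarrow> ('i \<Rightarrow> nat) \<Rightarrow> ('k, 'i) trunc_poly \<Rightarrow> ('k::field_prime_char, 'i::finite) trunc_poly" where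
  "iterop E [] n f = f"
| "iterop E (l # ls) n f = (wapply (E l) ^^ n l) (iterop E ls n f)"

text \<open>Replacing \<open>E\<^sub>l\<close> by its leading term \<open>P\<^sub>l\<close> changes the result only in higher order.\<close>

lemma iterop_ord:
  assumes "\<And>l. E l - P l \<in> W0" "f \<in> order_ge (d + sum_list (map n ls))"
  shows "iterop E ls n f \<in> order_ge d \<and> iterop E ls n f - iterop P ls n f \<in> order_ge (Suc d)"
  using assms(2)
proof (induction ls arbitrary: d)
  case (Cons l ls)
  have "iterop E ls n f \<in> order_ge (d + n l) \<and> iterop E ls n f - iterop P ls n f \<in> order_ge (Suc (d + n l))"
    by (rule Cons.IH) (use Cons.prems in \<open>simp add: add.assoc\<close>)
  then show ?case
    using funpow_ord[OF assms(1)[of l], of "iterop E ls n f" d "n l" "iterop P ls n f"] by simp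
qed simp

lemma funpow_wpartial_tmon:
  assumes "n \<le> lk a l" "lk a l < CHAR('k)"
  shows "\<exists>c. c \<noteq> 0 \<and> (wapply (wpartial l) ^^ n) (tmon a) =
    tscale c (tmon (a - Poly_Mapping.single l n) :: ('k::field_prime_char, 'i::finite) trunc_poly)"
  using assms(1)
proof (induction n)
  case 0
  show ?case by (intro exI[of _ 1]) simp
next
  case (Suc n)
  then obtain c where c: "c \<noteq> 0" "(wapply (wpartial l) ^^ n) (tmon a) =
    tscale c (tmon (a - Poly_Mapping.single l n) :: ('k, 'i) trunc_poly)" by auto
  have "(of_nat (lk a l - n) :: 'k) \<noteq> 0" using Suc.prems assms(2) by (intro of_nat_neq_0) auto
  moreover have "a - Poly_Mapping.single l n - Poly_Mapping.single l 1 = a - Poly_Mapping.single l (Suc n)"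
    by (rule poly_mapping_eqI) (simp add: lookup_minus lookup_single when_def)
  ultimately show ?case using c
    by (intro exI[of _ "c * of_nat (lk a l - n)"])
       (simp add: wapply_wpartial tpderiv_tmon tpderiv_tscale lookup_minus)
qed

lemma funpow_wapply_tscale: "(wapply E ^^ n) (tscale c f) = tscale c ((wapply E ^^ n) f)"
  by (induction n) simp_all

lemma iterop_wpartial_tmon:
  assumes "distinct ls" "\<And>l. n l \<le> lk a l" "\<And>l. lk a l < CHAR('k)"
  shows "\<exists>c b. c \<noteq> 0 \<and> (\<forall>j. lk b j = (if j \<in> set ls then lk a j - n j else lk a j)) \<and>
    iterop wpartial ls n (tmon a) = tscale c (tmon b :: ('k::field_prime_char, 'i::finite) trunc_poly)"
  using assms(1)
proof (induction ls)
  case Nil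
  show ?case by (intro exI[of _ 1] exI[of _ a]) simp
next
  case (Cons l ls)
  then obtain c b where cb: "c \<noteq> 0" "\<And>j. lk b j = (if j \<in> set ls then lk a j - n j else lk a j)"
    "iterop wpartial ls n (tmon a) = tscale c (tmon b :: ('k, 'i) trunc_poly)" by auto
  have "n l \<le> lk b l" "lk b l < CHAR('k)" using Cons.prems cb(2)[of l] assms by auto
  from funpow_wpartial_tmon[OF this] obtain c' where c': "c' \<noteq> 0" "(wapply (wpartial l) ^^ n l) (tmon b) =
    tscale c' (tmon (b - Poly_Mapping.single l (n l)) :: ('k, 'i) trunc_poly)" by blast
  show ?case
    using cb c' Cons.prems
    by (intro exI[of _ "c * c'"] exI[of _ "b - Poly_Mapping.single l (n l)"])
       (auto simp: funpow_wapply_tscale lookup_minus lookup_single when_def)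
qed

lemma funpow_wapply_0: "(wapply E ^^ n) 0 = 0"
  by (induction n) simp_all

lemma iterop_cong: "(\<And>l. l \<in> set ls \<Longrightarrow> n l = n' l) \<Longrightarrow> iterop E ls n f = iterop E ls n' f"
  by (induction ls) simp_all

lemma iterop_zero:
  assumes "l \<in> set ls" "\<And>f. (wapply (E l) ^^ n l) f = 0"
  shows "iterop E ls n f = 0"
  using assms(1) by (induction ls) (auto simp: assms(2) funpow_wapply_0)

lemma wapply_iterop:
  assumes comm: "\<And>i j f. wapply (E i) (wapply (E j) f) = wapply (E j) (wapply (E i) f)"
    and "distinct ls" "j \<in> set ls"
  shows "wapply (E j) (iterop E ls n f) = iterop E ls (n(j := Suc (n j))) f"
  using assms(2,3)
proof (induction ls)
  case (Cons l ls)
  have "wapply (E j) ((wapply (E l) ^^ m) h) = (wapply (E l) ^^ m) (wapply (E j) h)" for m h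
    by (induction m) (simp_all add: comm[of j l])
  then show ?case using Cons
    by (cases "l = j") (auto intro!: arg_cong[where f = "wapply (E j)"] arg_cong[where f = "(wapply (E j) ^^ n j)"] iterop_cong)
qed simp

lemma unit_inverse:
  fixes w :: "('k::field_prime_char, 'i::finite) trunc_poly"
  assumes "eps w \<noteq> 0" shows "\<exists>v. v * w = 1"
proof -
  (* The geometric series of t terminates, because t lies in the maximal ideal. *)
  define t where "t = 1 - tscale (inverse (eps w)) w"
  have t: "t ^ CHAR('k) = 0" by (rule nil_maximal_ideal) (simp add: t_def assms)
  have "(1 - t) * (\<Sum>n<CHAR('k). t ^ n) = 1"
    unfolding one_diff_power_eq[symmetric] t by simp
  then have "(tconst (inverse (eps w)) * (\<Sum>n<CHAR('k). t ^ n)) * w = 1"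
    by (simp add: t_def tscale_def mult_ac)
  then show ?thesis by blast
qed

text \<open>The element \<open>w\<close> obtained from the top monomial by all \<open>p - 1\<close>-fold derivatives is a unit that every
  \<open>E\<^sub>l\<close> kills. Leaving out one derivative along \<open>E\<^sub>j\<close> and dividing by \<open>w\<close> gives the coordinate dual to
  \<open>E\<^sub>j\<close>.\<close>

lemma dual_coordinates:
  fixes E :: "'i::finite \<Rightarrow> ('k::field_prime_char, 'i) witt"
  assumes comm: "\<And>i j f. wapply (E i) (wapply (E j) f) = wapply (E j) (wapply (E i) f)"
    and nilp: "\<And>l f. (wapply (E l) ^^ CHAR('k)) f = 0"
    and lead: "\<And>l. E l - wpartial l \<in> W0"
  obtains y where "\<And>j. eps (y j) = 0" "\<And>l j. wapply (E l) (y j) = (if l = j then 1 else 0)"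
proof -
  obtain ls :: "'i list" where ls: "distinct ls" "set ls = UNIV"
    using finite_distinct_list[of "UNIV :: 'i set"] by auto
  define N :: "'i \<Rightarrow> nat" where "N = (\<lambda>_. CHAR('k) - 1)"
  have p: "CHAR('k) \<ge> 2" using CHAR_gt_1[where 'k='k] by simp
  define w :: "('k, 'i) trunc_poly" where "w = iterop E ls N xtau"
  have shift: "wapply (E l) (iterop E ls n f) = iterop E ls (n(l := Suc (n l))) f" for l n f
    by (rule wapply_iterop[OF comm ls(1)]) (simp add: ls)
  have Ew: "wapply (E l) w = 0" for l
    unfolding w_def shift
    by (rule iterop_zero[where l = l]) (use p in \<open>simp_all add: ls N_def nilp\<close>)
  have "(tscale 1 xtau :: ('k, 'i) trunc_poly) \<in> order_ge (0 + sum_list (map N ls))"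
    unfolding xtau_eq
    by (rule order_ge.mon) (simp add: degree_of_def N_def ls sum_list_distinct_conv_sum_set[OF ls(1)])
  then have "w - iterop wpartial ls N xtau \<in> order_ge (Suc 0)"
    unfolding w_def using iterop_ord[of E wpartial, OF lead] by auto
  then have "eps w = eps (iterop wpartial ls N (xtau :: ('k, 'i) trunc_poly))"
    using ord_Suc_eps by fastforce
  moreover obtain c b where "c \<noteq> 0" "\<And>j. lk b j = (if j \<in> set ls then lk (tau CHAR('k) :: 'i \<Rightarrow>\<^sub>0 nat) j - N j else lk (tau CHAR('k) :: 'i \<Rightarrow>\<^sub>0 nat) j)"
    "iterop wpartial ls N (xtau :: ('k, 'i) trunc_poly) = tscale c (tmon b)"
    using iterop_wpartial_tmon[OF ls(1), of N "tau CHAR('k)", where 'k='k] p unfolding xtau_eq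
    by (auto simp: N_def)
  moreover from this(2) have "b = 0" by (intro poly_mapping_eqI) (simp add: ls N_def)
  ultimately have "eps w \<noteq> 0" by simp
  then obtain v where v: "v * w = 1" using unit_inverse by blast
  have Ev: "wapply (E l) v = 0" for l
  proof -
    have "wapply (E l) (v * w) = 0" unfolding v by simp
    then have "wapply (E l) v * w = 0" by (simp add: wapply_mult Ew)
    then have "wapply (E l) v * w * v = 0" by simp
    then show ?thesis using v by (simp add: mult.assoc mult.commute[of w])
  qed
  define y0 where "y0 j = v * iterop E ls (N(j := CHAR('k) - 2)) xtau" for j
  have E: "wapply (E l) (y0 j) = (if l = j then 1 else 0)" for l j
  proof (cases "l = j")
    case True
    have "N(j := CHAR('k) - 2, j := Suc (CHAR('k) - 2)) = N" using p by (auto simp: N_def fun_eq_iff)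
    then show ?thesis using True v
      unfolding y0_def wapply_mult Ev shift
      by (simp add: w_def)
  next
    case False
    have "iterop E ls (N(j := CHAR('k) - 2, l := Suc (N l))) xtau = 0"
      by (rule iterop_zero[where l = l]) (use p in \<open>simp_all add: ls N_def nilp\<close>)
    then show ?thesis using False
      unfolding y0_def wapply_mult Ev shift
      by simp
  qed
  show ?thesis
    by (rule that[of "\<lambda>j. y0 j - tconst (eps (y0 j))"]) (simp_all add: E)
qed

lemma tcoeff_tpderiv:
  fixes f :: "('k::field_prime_char, 'i::finite) trunc_poly"
  assumes "b \<in> reduced CHAR('k)"
  shows "tcoeff (tpderiv j f) b = of_nat (Suc (lk b j)) * tcoeff f (b + Poly_Mapping.single j 1)"
proof (cases f rule: abs_trunc_poly_cases)
  case (1 q)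
  have "b + Poly_Mapping.single j 1 \<in> reduced CHAR('k) \<or> (of_nat (Suc (lk b j)) :: 'k) = 0"
  proof (cases "Suc (lk b j) = CHAR('k)")
    case True
    then show ?thesis by (metis of_nat_CHAR)
  next
    case False
    then have "Suc (lk b j) < CHAR('k)" using assms by (auto simp: reduced_def intro!: Suc_lessI)
    then show ?thesis using assms by (auto simp: reduced_def lookup_add lookup_single when_def)
  qed
  then show ?thesis using assms
    by (auto simp: 1 tpderiv.abs_eq tcoeff_abs mpderiv.rep_eq simp del: of_nat_Suc)
qed

text \<open>A positive entry of a reduced exponent is nonzero in the field, so that the derivative in this variable
  detects the coefficient.\<close>

lemma constant_if_tpderiv_0:
  fixes f :: "('k::field_prime_char, 'i::finite) trunc_poly"
  assumes "\<And>j. tpderiv j f = 0"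
  shows "f = tconst (eps f)"
proof (rule tcoeff_eqI)
  fix a :: "'i \<Rightarrow>\<^sub>0 nat" assume a: "a \<in> reduced CHAR('k)"
  have const: "tcoeff (tconst c) b = (if b = 0 then c else 0)" for c and b :: "'i \<Rightarrow>\<^sub>0 nat"
    using tcoeff_tconst_mult[of c 1 b] tcoeff_tmon[of 0 b] by (auto simp: tcoeff_not_reduced)
  show "tcoeff f a = tcoeff (tconst (eps f)) a"
  proof (cases "a = 0")
    case True
    then show ?thesis by (simp add: eps_def const)
  next
    case False
    then obtain j where j: "lk a j \<noteq> 0" by (auto simp: poly_mapping_eq_iff fun_eq_iff)
    let ?b = "a - Poly_Mapping.single j 1"
    have b: "?b + Poly_Mapping.single j 1 = a" using exponent_decompose[OF j] by (metis add.commute)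
    have lt: "lk a i < CHAR('k)" for i using a by (simp add: reduced_def)
    then have red: "?b \<in> reduced CHAR('k)" by (auto simp: reduced_def lookup_minus intro: le_less_trans[OF diff_le_self])
    have "lk ?b j = lk a j - 1" by (simp add: lookup_minus lookup_single)
    then have Suc: "Suc (lk ?b j) = lk a j" using j by simp
    from tcoeff_tpderiv[OF red, of j f] have "of_nat (lk a j) * tcoeff f a = 0"
      unfolding assms b Suc by simp
    then have "tcoeff f a = 0" using of_nat_neq_0[OF _ lt[of j]] j by simp
    then show ?thesis using False by (simp add: const)
  qed
qed

text \<open>A homomorphism that intertwines the partial derivatives is injective: its kernel is an ideal closed
  under differentiation.\<close>

lemma intertwiner_injective:
  fixes \<phi> :: "('k::field_prime_char, 'i::finite) trunc_poly \<Rightarrow> ('k, 'i) trunc_poly"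
  assumes \<phi>: "alg_hom \<phi>" and E: "\<And>i f. wapply (E i) (\<phi> f) = \<phi> (tpderiv i f)"
  shows "\<phi> f = 0 \<Longrightarrow> f = 0"
proof -
  have "\<forall>a. tcoeff f a \<noteq> 0 \<longrightarrow> degree_of a \<le> n \<Longrightarrow> \<phi> f = 0 \<Longrightarrow> f = 0" for n f
  proof (induction n arbitrary: f)
    have const: "f = 0" if "\<And>j. tpderiv j f = 0" "\<phi> f = 0" for f
    proof -
      have f: "f = tconst (eps f)" by (rule constant_if_tpderiv_0) (rule that)
      have "\<phi> (tconst (eps f)) = 0" using that(2) f by simp
      then have "eps (tconst (eps f) :: ('k, 'i) trunc_poly) = 0" by (simp only: alg_homD[OF \<phi>] eps_simps)
      then show "f = 0" using f by simp
    qed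
    { case 0
      have "tcoeff (tpderiv j f) b = 0" if "b \<in> reduced CHAR('k)" for j b
        unfolding tcoeff_tpderiv[OF that]
        using 0(1)[rule_format, of "b + Poly_Mapping.single j 1"] degree_of_pos[of "b + Poly_Mapping.single j 1"]
        by (auto simp: exponent_add_0 single_neq_0 simp del: One_nat_def of_nat_Suc)
      then have "tpderiv j f = 0" for j by (intro tcoeff_eqI) simp
      then show ?case by (rule const[OF _ 0(2)]) }
    case (Suc n)
    have "tpderiv j f = 0" for j
    proof (rule Suc.IH)
      show "\<phi> (tpderiv j f) = 0" using E[of j f] Suc.prems(2) by simp
      show "\<forall>a. tcoeff (tpderiv j f) a \<noteq> 0 \<longrightarrow> degree_of a \<le> n"
      proof (intro allI impI)
        fix a assume a: "tcoeff (tpderiv j f) a \<noteq> 0"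
        then have "a \<in> reduced CHAR('k)" using tcoeff_not_reduced by blast
        from a[unfolded tcoeff_tpderiv[OF this]] have "tcoeff f (a + Poly_Mapping.single j 1) \<noteq> 0" by auto
        then have "degree_of (a + Poly_Mapping.single j 1) \<le> Suc n" using Suc.prems(1) by blast
        moreover have "degree_of (Poly_Mapping.single j (1 :: nat)) = 1"
          by (simp add: degree_of_def lookup_single when_def)
        ultimately show "degree_of a \<le> n" by (simp add: degree_of_add)
      qed
    qed
    then show ?case by (rule const[OF _ Suc.prems(2)])
  qed
  moreover have "\<forall>a. tcoeff f a \<noteq> 0 \<longrightarrow> degree_of a \<le> sum degree_of (reduced CHAR('k) :: ('i \<Rightarrow>\<^sub>0 nat) set)"
  proof (intro allI impI)
    fix a assume "tcoeff f a \<noteq> 0"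
    then have "a \<in> reduced CHAR('k)" using tcoeff_not_reduced by blast
    then show "degree_of a \<le> sum degree_of (reduced CHAR('k) :: ('i \<Rightarrow>\<^sub>0 nat) set)" by (rule member_le_sum) simp_all
  qed
  ultimately show "\<phi> f = 0 \<Longrightarrow> f = 0" by blast
qed

lemma bij_if_injective:
  fixes A :: "('k::field_prime_char, 'i::finite) trunc_poly \<Rightarrow> ('k, 'i) trunc_poly"
  assumes A: "tlinear A" and inj: "\<And>f. A f = 0 \<Longrightarrow> f = 0"
  shows "bij A"
proof -
  define ms :: "('i \<Rightarrow>\<^sub>0 nat) list" where "ms = mon_list CHAR('k)"
  note carrier = opmat_carrier[OF ms_def, of A]
  have "det (opmat A) \<noteq> 0"
  proof
    assume "det (opmat A) = 0"
    then obtain v where v: "v \<in> carrier_vec (length ms)" "v \<noteq> 0\<^sub>v (length ms)" "opmat A *\<^sub>v v = 0\<^sub>v (length ms)"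
      using det_0_iff_vec_prod_zero_field[OF carrier] by blast
    define f where "f = (\<Sum>j<length ms. tscale (v $ j) (tmon (ms ! j)) :: ('k, 'i) trunc_poly)"
    have f: "tcoeff f (ms ! i) = v $ i" if i: "i < length ms" for i
    proof -
      have "tcoeff f (ms ! i) = (\<Sum>j<length ms. if j = i then v $ i else 0)"
        unfolding f_def tcoeff_sum by (intro sum.cong) (auto simp: tcoeff_tmon_ms[OF ms_def i])
      then show ?thesis using i by simp
    qed
    have "A f = 0"
    proof (rule ms_eqI[OF ms_def])
      fix i assume i: "i < length ms"
      have "tcoeff (A f) (ms ! i) = (opmat A *\<^sub>v v) $ i"
        using i v(1) carrier by (simp add: tcoeff_tlinear[OF ms_def A] f scalar_prod_def atLeast0LessThan)
      then show "tcoeff (A f) (ms ! i) = tcoeff 0 (ms ! i)" using v(3) i by simp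
    qed
    then have "f = 0" by (rule inj)
    then have "v = 0\<^sub>v (length ms)" using f v(1) by (intro eq_vecI) auto
    then show False using v(2) by simp
  qed
  then show ?thesis by (simp add: bij_iff_det_opmat(1)[OF ms_def A])
qed

lemma wscale_0: "wscale 0 D = 0"
  by (rule witt_eqI) simp

text \<open>The coordinates of \<open>D\<close> modulo \<open>W\<^sub>0\<close>.\<close>

definition lead :: "('k::field_prime_char, 'i::finite) witt \<Rightarrow> 'i \<Rightarrow> 'k" where
  "lead D j = eps (wapply D (tvar j))"

lemma W0_lead: "D \<in> W0 \<longleftrightarrow> (\<forall>j. lead D j = 0)"
  by (simp add: W0_iff lead_def)

lemma lead_remainder: "D - (\<Sum>j\<in>UNIV. wscale (lead D j) (wpartial j)) \<in> W0"
proof -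
  have "(\<Sum>x\<in>UNIV. lead D x * eps (tpderiv x (tvar i))) = lead D i" for i
    by (simp add: if_distrib cong: if_cong)
  then show ?thesis by (simp add: W0_iff wapply_wpartial flip: lead_def)
qed

lemma lead_simps: "lead (D + E) j = lead D j + lead E j" "lead (D - E) j = lead D j - lead E j"
  "lead (wscale c D) j = c * lead D j" "lead (sum h A) j = (\<Sum>x\<in>A. lead (h x) j)"
  "lead (wpartial i) j = (if i = j then 1 else 0)"
  by (simp_all add: lead_def wapply_wpartial)

lemma lead_witt_aut:
  fixes g :: "('k::field_prime_char, 'i::finite) witt \<Rightarrow> ('k, 'i) witt"
  assumes "g \<in> witt_aut" "\<And>D. D \<in> W0 \<Longrightarrow> g D \<in> W0"
  shows "lead (g D) j = (\<Sum>l\<in>UNIV. lead D l * lead (g (wpartial l)) j)"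
proof -
  have "g (D - (\<Sum>l\<in>UNIV. wscale (lead D l) (wpartial l))) \<in> W0" by (rule assms(2)[OF lead_remainder])
  then have "lead (g D - (\<Sum>l\<in>UNIV. wscale (lead D l) (g (wpartial l)))) j = 0"
    by (simp add: W0_lead witt_autD[OF assms(1)] witt_aut_sum[OF assms(1)])
  then show ?thesis by (simp add: lead_simps)
qed

lemma wbracket_wpartial_wbasis:
  "wbracket (wpartial k) (wbasis (i, a)) = wscale (of_nat (lk a k)) (wbasis (i, a - Poly_Mapping.single k 1))"
proof (rule witt_eqI_var)
  fix j
  have "wapply (wbasis (i, a)) (tpderiv k (tvar j)) = 0" by simp
  then show "wapply (wbracket (wpartial k) (wbasis (i, a))) (tvar j) =
    wapply (wscale (of_nat (lk a k)) (wbasis (i, a - Poly_Mapping.single k 1))) (tvar j)"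
    by (simp add: wapply_wbasis_tvar wapply_wpartial tpderiv_tmon derivationD[OF derivation_tpderiv])
qed

text \<open>An automorphism that fixes the partial derivatives and \<open>W\<^sub>0\<close> is the identity, by induction on the
  degree: \<open>h(x\<^sup>a D\<^sub>i) - x\<^sup>a D\<^sub>i\<close> commutes with all partial derivatives.\<close>

lemma fixes_partials_identity:
  fixes h :: "('k::field_prime_char, 'i::finite) witt \<Rightarrow> ('k, 'i) witt"
  assumes h: "h \<in> witt_aut" and W: "\<And>D. D \<in> W0 \<Longrightarrow> h D \<in> W0"
    and fix_partial: "\<And>i. h (wpartial i) = wpartial i"
  shows "h D = D"
proof -
  have basis: "h (wbasis (i, a)) = wbasis (i, a)" for i a
  proof (induction "degree_of a" arbitrary: a rule: less_induct)
    case less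
    show ?case
    proof (cases "a = 0")
      case True
      then have "wbasis (i, a) = (wpartial i :: ('k, 'i) witt)" by (intro witt_eqI) (simp add: wbasis_def)
      then show ?thesis using fix_partial by simp
    next
      case False
      define X where "X = h (wbasis (i, a)) - wbasis (i, a)"
      have "wbasis (i, a) \<in> W0" using False by (simp add: W0_iff wapply_wbasis_tvar eps_tmon)
      with W[OF this] have X: "X \<in> W0" by (simp add: X_def W0_lead lead_simps)
      have "tpderiv k (wapply X (tvar j)) = 0" for k j
      proof -
        have "h (wbracket (wpartial k) (wbasis (i, a))) = wbracket (wpartial k) (wbasis (i, a))"
          unfolding wbracket_wpartial_wbasis using less[of "a - Poly_Mapping.single k 1"] degree_of_decrement[of a k]
          by (cases "lk a k = 0") (auto simp: witt_autD[OF h] wscale_0)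
        then have "wbracket (wpartial k) (h (wbasis (i, a))) = wbracket (wpartial k) (wbasis (i, a))"
          by (simp only: witt_autD(4)[OF h] fix_partial)
        then have "wapply (wbracket (wpartial k) (h (wbasis (i, a)))) (tvar j) = wapply (wbracket (wpartial k) (wbasis (i, a))) (tvar j)"
          by simp
        moreover have "wapply E (tpderiv k (tvar j)) = 0" for E :: "('k, 'i) witt" by simp
        ultimately show ?thesis by (simp only: wapply_wbracket wapply_wpartial X_def wapply_witt derivationD[OF derivation_tpderiv]) simp
      qed
      then have "wapply X (tvar j) = tconst (eps (wapply X (tvar j)))" for j by (rule constant_if_tpderiv_0)
      then have "wapply X (tvar j) = 0" for j using X by (metis W0_iff tconst_0)
      then have "X = 0" by (intro witt_eqI_var) simp
      then show ?thesis by (simp add: X_def)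
    qed
  qed
  have "h D = h (\<Sum>r\<in>UNIV \<times> reduced CHAR('k). wscale (wcoord r D) (wbasis r))"
    by (subst witt_expand[of D]) simp
  also have "\<dots> = (\<Sum>r\<in>UNIV \<times> reduced CHAR('k). wscale (wcoord r D) (wbasis r))"
    by (simp add: witt_aut_sum[OF h] witt_autD[OF h] basis split: prod.splits) (metis (no_types, lifting) basis prod.collapse)
  also have "\<dots> = D" by (rule witt_expand[symmetric])
  finally show ?thesis .
qed

text \<open>Modulo \<open>W\<^sub>0\<close> the automorphism is a matrix \<open>A\<close> with inverse \<open>C\<close>. The combinations \<open>\<Sum> C\<^sub>l\<^sub>i g(D\<^sub>i)\<close> have leading
  terms \<open>D\<^sub>l\<close>, so that they have dual coordinates; transforming these back with \<open>C\<close> gives coordinates dual to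
  the \<open>g(D\<^sub>i)\<close>, and the change of variables to them agrees with \<open>g\<close> on the partial derivatives.\<close>

theorem witt_aut_eq_wconj:
  fixes g :: "('k::field_prime_char, 'i::finite) witt \<Rightarrow> ('k, 'i) witt"
  assumes inf: "infinite (UNIV :: 'k set)" and p: "CHAR('k) > 2" and card: "CARD('i) \<ge> 2"
    and g: "g \<in> witt_aut"
  obtains \<phi> where "alg_hom \<phi>" "bij \<phi>" "\<And>D. g D = wconj \<phi> D"
proof -
  note W = witt_aut_W0[OF inf p card]
  have g': "tinv g \<in> witt_aut" by (rule tinv_witt_aut[OF g])
  define A where "A i j = lead (g (wpartial i)) j" for i j
  define C where "C i j = lead (tinv g (wpartial i)) j" for i j
  (* Both products of A and C are needed: CA = 1 gives the leading terms, AC = 1 transforms the dual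
     coordinates back. *)
  have AC: "(\<Sum>l\<in>UNIV. A i l * C l j) = (if i = j then 1 else 0)" for i j
    using lead_witt_aut[OF g' W[OF g'], of "g (wpartial i)" j]
    by (simp add: witt_autD[OF g] lead_simps A_def C_def)
  have CA: "(\<Sum>l\<in>UNIV. C i l * A l j) = (if i = j then 1 else 0)" for i j
    using lead_witt_aut[OF g W[OF g], of "tinv g (wpartial i)" j]
    by (simp add: witt_autD[OF g] lead_simps A_def C_def)
  define D where "D l = (\<Sum>i\<in>UNIV. wscale (C l i) (wpartial i))" for l
  have D_tvar: "wapply (D l) (tvar j) = tconst (C l j)" for l j
    by (simp add: D_def wapply_wpartial if_distrib tscale_def cong: if_cong)
  have gD: "g (D l) = (\<Sum>i\<in>UNIV. wscale (C l i) (g (wpartial i)))" for l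
    by (simp add: D_def witt_aut_sum[OF g] witt_autD[OF g])
  have "wbracket (D i) (D j) = 0" for i j
    by (rule witt_eqI_var) (simp add: D_tvar)
  then have "wbracket (g (D i)) (g (D j)) = 0" for i j
    by (metis witt_autD(4,6)[OF g])
  then have comm: "wapply (g (D i)) (wapply (g (D j)) f) = wapply (g (D j)) (wapply (g (D i)) f)" for i j f
    by (metis eq_iff_diff_eq_0 wapply_wbracket wapply_witt(4))
  have "wpower (D l) = 0" for l
  proof (rule witt_eqI_var)
    fix j
    obtain q where q: "CHAR('k) = Suc (Suc q)"
      using CHAR_gt_1[where 'k='k] that[of "CHAR('k) - 2"] by simp
    have "(wapply (D l) ^^ Suc q) (wapply (D l) (tvar j)) = 0"
      unfolding D_tvar funpow_Suc_right by (simp add: funpow_wapply_0)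
    then show "wapply (wpower (D l)) (tvar j) = wapply 0 (tvar j)"
      unfolding wapply_wpower q by (subst funpow_Suc_right) (simp only: comp_apply wapply_witt)
  qed
  then have "wpower (g (D l)) = 0" for l by (metis witt_autD(5,6)[OF g])
  then have nilp: "(wapply (g (D l)) ^^ CHAR('k)) f = 0" for l f
    by (metis wapply_wpower wapply_witt(4))
  have "g (D l) - wpartial l \<in> W0" for l
    by (simp add: gD W0_lead lead_simps CA flip: A_def)
  from dual_coordinates[OF comm nilp this] obtain y where y: "\<And>j. eps (y j) = 0"
    "\<And>l j. wapply (g (D l)) (y j) = (if l = j then 1 else 0)" by blast
  define Y where "Y j = (\<Sum>l\<in>UNIV. tscale (C l j) (y l))" for j
  have Y0: "eps (Y j) = 0" for j by (simp add: Y_def y)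
  have gpartial: "wapply (g (wpartial i)) (Y j) = (if i = j then 1 else 0)" for i j
  proof -
    have "g (wpartial i) = (\<Sum>l\<in>UNIV. wscale (A i l) (g (D l)))"
    proof -
      have "(\<Sum>l\<in>UNIV. wscale (A i l) (D l)) = wpartial i"
        by (rule witt_eqI_var)
          (simp add: D_tvar tscale_def AC wapply_wpartial tconst_1 flip: tconst_mult tconst_sum)
      from arg_cong[OF this, of g] show ?thesis by (simp add: witt_aut_sum[OF g] witt_autD[OF g])
    qed
    then have "wapply (g (wpartial i)) (Y j) = (\<Sum>l\<in>UNIV. \<Sum>r\<in>UNIV. tscale (A i r * C l j) (wapply (g (D r)) (y l)))"
      by (simp add: Y_def tscale_sum mult.commute)
    also have "\<dots> = (\<Sum>l\<in>UNIV. \<Sum>r\<in>UNIV. if r = l then tconst (A i l * C l j) else 0)"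
      by (intro sum.cong refl) (simp add: y tscale_def)
    also have "\<dots> = (\<Sum>l\<in>UNIV. tconst (A i l * C l j))" by simp
    also have "\<dots> = tconst (\<Sum>l\<in>UNIV. A i l * C l j)" by (simp add: tconst_sum)
    finally show ?thesis by (simp add: AC tconst_1)
  qed
  define \<phi> where "\<phi> = tsubst Y"
  have \<phi>: "alg_hom \<phi>" unfolding \<phi>_def by (rule alg_hom_tsubst[OF Y0])
  have intertwine: "wapply (g (wpartial i)) (\<phi> f) = \<phi> (tpderiv i f)" for i f
  proof (induction f rule: trunc_poly_gen_induct)
    case (var j)
    have "\<phi> (tvar j) = Y j" unfolding \<phi>_def by (rule tsubst_tvar[OF Y0])
    then show ?case by (simp add: gpartial alg_homD[OF \<phi>])
  qed (simp_all add: alg_homD[OF \<phi>] wapply_mult derivationD[OF derivation_tpderiv])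
  have bij: "bij \<phi>"
    by (rule bij_if_injective[OF tlinear_alg_hom[OF \<phi>]])
       (rule intertwiner_injective[OF \<phi>, where E = "\<lambda>i. g (wpartial i)", OF intertwine])
  have c: "wconj \<phi> \<in> witt_aut" by (rule wconj_witt_aut[OF \<phi> bij])
  (* It remains to see that g and conjugation by the change of variables differ by the identity. *)
  define h where "h D = tinv (wconj \<phi>) (g D)" for D
  have h: "h \<in> witt_aut" unfolding h_def[abs_def] by (rule comp_witt_aut[OF tinv_witt_aut[OF c] g])
  have "wconj \<phi> (wpartial i) = g (wpartial i)" for i
  proof (rule witt_eqI)
    fix f
    have "f = \<phi> (tinv \<phi> f)" using bij by (simp add: bij_is_surj surj_f_inv_f)
    then show "wapply (wconj \<phi> (wpartial i)) f = wapply (g (wpartial i)) f"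
      using intertwine[of i "tinv \<phi> f"] by (simp add: wapply_wconj[OF \<phi> bij] wapply_wpartial)
  qed
  then have h_partial: "h (wpartial i) = wpartial i" for i
    unfolding h_def by (metis witt_autD(10)[OF c])
  have "h D = D" for D
    by (rule fixes_partials_identity[OF h]) (simp_all add: W[OF h] h_partial)
  then have "g D = wconj \<phi> D" for D unfolding h_def by (metis witt_autD(9)[OF c])
  with \<phi> bij show ?thesis by (rule that)
qed

section \<open>The source of the orbit map as a principal open set\<close>

lemma tinv_wconj:
  assumes \<phi>: "alg_hom \<phi>" "bij \<phi>"
  shows "tinv (wconj \<phi>) D = wconj (tinv \<phi>) D"
proof -
  have A: "\<phi> (tinv \<phi> f) = f" for f
    using assms(2) by (simp add: bij_is_surj surj_f_inv_f)
  have \<psi>: "alg_hom (tinv \<phi>)" "bij (tinv \<phi>)" "tinv (tinv \<phi>) = \<phi>"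
    using \<phi> by (simp_all add: alg_hom_tinv bij_imp_bij_inv inv_inv_eq)
  have "wconj \<phi> (wconj (tinv \<phi>) D) = D"
    by (rule witt_eqI) (simp add: wapply_wconj[OF \<phi>] wapply_wconj[OF \<psi>(1,2)] \<psi>(3) A)
  then show ?thesis using witt_autD(10)[OF wconj_witt_aut[OF \<phi>], of "wconj (tinv \<phi>) D"] by simp
qed

lemma eps_chain_rule:
  fixes h :: "('k::field_prime_char, 'i::finite) trunc_poly"
  assumes "alg_hom \<phi>"
  shows "eps (wapply D (\<phi> h)) = (\<Sum>i\<in>UNIV. eps (wapply D (\<phi> (tvar i))) * eps (tpderiv i h))"
proof (induction h rule: trunc_poly_gen_induct)
  case (mult f g)
  then show ?case
    by (simp add: alg_homD[OF assms] wapply_mult alg_hom_eps[OF assms] derivationD[OF derivation_tpderiv]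
        distrib_left sum.distrib sum_distrib_left sum_distrib_right mult_ac)
qed (simp_all add: alg_homD[OF assms] derivationD[OF derivation_tpderiv] distrib_left sum.distrib if_distrib cong: if_cong)

definition dual_entry :: "'i \<Rightarrow> (('k, 'i) witt \<Rightarrow> ('k::field_prime_char, 'i::finite) witt) \<Rightarrow> 'i \<Rightarrow> 'k" where
  "dual_entry l g i = eps (wapply (tinv g (wpartial l)) (tvar i))"

definition recover_unit :: "'i \<Rightarrow> (('k, 'i) witt \<Rightarrow> ('k, 'i) witt) \<Rightarrow> ('k::field_prime_char, 'i::finite) trunc_poly" where
  "recover_unit l g = (\<Sum>i\<in>UNIV. tscale (dual_entry l g i) (wapply (g (wpartial i)) (tvar l)))"

text \<open>A formula for \<open>\<phi>(x\<^sub>j)\<close> in terms of matrix coefficients of the automorphism \<open>g\<close> induced by \<open>\<phi>\<close> and of its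
  inverse, which shows that the coordinates are regular functions on the group. Since \<open>g(x\<^sub>j D\<^sub>i) = \<phi>(x\<^sub>j) g(D\<^sub>i)\<close>,
  the second factor is \<open>\<phi>(x\<^sub>j)\<close> times \<open>recover_unit\<close>, which has constant term \<open>1\<close>; the first factor is the inverse
  of this unit as a geometric series.\<close>

definition recover_var :: "'i \<Rightarrow> (('k, 'i) witt \<Rightarrow> ('k, 'i) witt) \<Rightarrow> 'i \<Rightarrow> ('k::field_prime_char, 'i::finite) trunc_poly" where
  "recover_var l g j = (\<Sum>n<CHAR('k). (1 - recover_unit l g) ^ n) *
    (\<Sum>i\<in>UNIV. tscale (dual_entry l g i) (wapply (g (wmult (tvar j) (wpartial i))) (tvar l)))"

lemma recover_var_wconj:
  fixes \<phi> :: "('k::field_prime_char, 'i::finite) trunc_poly \<Rightarrow> ('k, 'i) trunc_poly"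
  assumes \<phi>: "alg_hom \<phi>" "bij \<phi>"
  shows "recover_var l (wconj \<phi>) j = \<phi> (tvar j)"
proof -
  define \<mu> where "\<mu> = recover_unit l (wconj \<phi>)"
  have A: "\<phi> (tinv \<phi> f) = f" for f
    using assms(2) by (simp add: bij_is_surj surj_f_inv_f)
  have \<psi>: "alg_hom (tinv \<phi>)" "bij (tinv \<phi>)" "tinv (tinv \<phi>) = \<phi>"
    using \<phi> by (simp_all add: alg_hom_tinv bij_imp_bij_inv inv_inv_eq)
  have dual: "dual_entry l (wconj \<phi>) i = eps (wapply (wpartial l) (\<phi> (tvar i)))" for i
    by (simp add: dual_entry_def tinv_wconj[OF \<phi>] wapply_wconj[OF \<psi>(1,2)] \<psi>(3) alg_hom_eps[OF \<psi>(1)])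
  have "eps \<mu> = (\<Sum>i\<in>UNIV. eps (wapply (wpartial l) (\<phi> (tvar i))) * eps (tpderiv i (tinv \<phi> (tvar l))))"
    by (simp add: \<mu>_def recover_unit_def dual wapply_wconj[OF \<phi>] alg_hom_eps[OF \<phi>(1)] wapply_wpartial)
  also have "\<dots> = eps (wapply (wpartial l) (\<phi> (tinv \<phi> (tvar l))))"
    by (rule eps_chain_rule[OF \<phi>(1), symmetric])
  finally have "eps \<mu> = 1" by (simp add: A wapply_wpartial)
  then have "(1 - \<mu>) ^ CHAR('k) = 0" by (intro nil_maximal_ideal) simp
  then have inverse: "(\<Sum>n<CHAR('k). (1 - \<mu>) ^ n) * \<mu> = 1"
    using one_diff_power_eq[of "1 - \<mu>" "CHAR('k)"] by (simp add: mult.commute)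
  have "(\<Sum>i\<in>UNIV. tscale (dual_entry l (wconj \<phi>) i) (wapply (wconj \<phi> (wmult (tvar j) (wpartial i))) (tvar l))) = \<mu> * \<phi> (tvar j)"
    by (simp add: \<mu>_def recover_unit_def wapply_wconj[OF \<phi>] alg_homD[OF \<phi>(1)] sum_distrib_left sum_distrib_right tscale_def mult_ac)
  then have "recover_var l (wconj \<phi>) j = (\<Sum>n<CHAR('k). (1 - \<mu>) ^ n) * (\<mu> * \<phi> (tvar j))"
    unfolding recover_var_def by (simp add: \<mu>_def)
  also have "\<dots> = \<phi> (tvar j)" unfolding mult.assoc[symmetric] inverse by simp
  finally show ?thesis .
qed

abbreviation orbit_points :: "((('k, 'i) witt \<Rightarrow> ('k, 'i) witt) \<times> ('k::field_prime_char, 'i::{finite, linorder}) witt) set" where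
  "orbit_points \<equiv> witt_aut \<times> Omega1"

text \<open>The chart as a parametrization of the source of the orbit map; \<open>coords\<close> is its inverse.\<close>

definition param :: "('i cvar \<Rightarrow> 'k) \<Rightarrow> (('k, 'i) witt \<Rightarrow> ('k, 'i) witt) \<times> ('k::field_prime_char, 'i::{finite, linorder}) witt" where
  "param z = (wconj (phi z), D_eta (\<lambda>i. z (i, 0)))"

definition coords :: "(('k, 'i) witt \<Rightarrow> ('k, 'i) witt) \<times> ('k::field_prime_char, 'i::{finite, linorder}) witt \<Rightarrow> 'i cvar \<Rightarrow> 'k" where
  "coords \<xi> v = (if snd v = 0 then eta_sign (fst v) * tcoeff (wapply (snd \<xi>) (tvar (fst v))) (tau CHAR('k))
    else tcoeff (recover_var (Min UNIV) (fst \<xi>) (fst v)) (snd v))"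

lemma tcoeff_lowvars_tau: "tcoeff (lowvars i :: ('k::field_prime_char, 'i::{finite, linorder}) trunc_poly) (tau CHAR('k)) = 0"
proof -
  have "lk (tau CHAR('k) :: 'i \<Rightarrow>\<^sub>0 nat) i \<noteq> lk (\<Sum>j | j < i. Poly_Mapping.single j (CHAR('k) - 1)) i"
    using CHAR_gt_1[where 'k='k] by (simp add: lookup_lowvars)
  then have "tau CHAR('k) \<noteq> (\<Sum>j | j < i. Poly_Mapping.single j (CHAR('k) - 1))" by metis
  then show ?thesis by (simp add: lowvars_eq tcoeff_tmon)
qed

lemma tcoeff_xtau [simp]: "tcoeff (xtau :: ('k::field_prime_char, 'i::finite) trunc_poly) (tau CHAR('k)) = 1"
  by (simp add: xtau_eq tcoeff_tmon)

lemma D_eta_coordinate: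
  "eta_sign i * tcoeff (wapply (D_eta \<eta> :: ('k::field_prime_char, 'i::{finite, linorder}) witt) (tvar i)) (tau CHAR('k)) = \<eta> i"
  by (simp add: wapply_D_eta_tvar tcoeff_lowvars_tau)

lemma chartD: "z \<in> chart \<Longrightarrow> bij (phi z)" "z \<in> chart \<Longrightarrow> v \<notin> cvars CHAR('k) \<Longrightarrow> z v = (0 :: 'k::field_prime_char)"
  unfolding chart_def by blast+

lemma param_points: "z \<in> chart \<Longrightarrow> param z \<in> orbit_points"
  unfolding param_def
  by (rule SigmaI[OF wconj_witt_aut[OF alg_hom_phi chartD(1)]]) (auto simp: Omega1_def)

lemma coords_param:
  fixes z :: "'i::{finite, linorder} cvar \<Rightarrow> 'k::field_prime_char"
  assumes "z \<in> chart" shows "coords (param z) = z"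
proof
  fix v :: "'i cvar"
  obtain j a where v: "v = (j, a)" by (cases v)
  show "coords (param z) v = z v"
    using chartD(2)[OF assms, of v]
    by (auto simp: v coords_def param_def D_eta_coordinate recover_var_wconj[OF alg_hom_phi chartD(1)[OF assms]]
        tcoeff_gpoint cvars_def tcoeff_not_reduced)
qed

lemma param_surj:
  fixes \<xi> :: "(('k, 'i) witt \<Rightarrow> ('k, 'i) witt) \<times> ('k::field_prime_char, 'i::{finite, linorder}) witt"
  assumes inf: "infinite (UNIV :: 'k set)" and p: "CHAR('k) > 2" and card: "CARD('i) \<ge> 2"
    and \<xi>: "\<xi> \<in> orbit_points"
  shows "coords \<xi> \<in> chart" "param (coords \<xi>) = \<xi>"
proof -
  obtain g x where gx: "\<xi> = (g, x)" "g \<in> witt_aut" "x \<in> Omega1" using \<xi> by auto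
  obtain \<eta> where \<eta>: "x = D_eta \<eta>" using gx(3) by (auto simp: Omega1_def)
  obtain \<phi> where \<phi>: "alg_hom \<phi>" "bij \<phi>" "\<And>D. g D = wconj \<phi> D"
    using witt_aut_eq_wconj[OF inf p card gx(2)] by blast
  define z where "z = (\<lambda>v :: 'i cvar. if snd v = 0 then \<eta> (fst v) else tcoeff (\<phi> (tvar (fst v))) (snd v))"
  have "phi z = \<phi>"
  proof (rule alg_hom_ext[OF alg_hom_phi \<phi>(1)])
    fix j
    have "eps (\<phi> (tvar j)) = 0" by (simp add: alg_hom_eps[OF \<phi>(1)])
    then show "phi z (tvar j) = \<phi> (tvar j)"
      by (intro tcoeff_eqI) (auto simp: tcoeff_gpoint z_def eps_def)
  qed
  moreover have "z v = 0" if "v \<notin> cvars CHAR('k)" for v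
    using that by (cases v) (auto simp: z_def cvars_def tcoeff_not_reduced)
  ultimately have z: "z \<in> chart" using \<phi>(2) by (simp add: chart_def)
  have "g = wconj \<phi>" using \<phi>(3) by (rule ext)
  moreover have "(\<lambda>i. z (i, 0)) = \<eta>" by (simp add: z_def)
  ultimately have "param z = \<xi>"
    by (simp add: param_def gx(1) \<eta> \<open>phi z = \<phi>\<close>)
  then show "coords \<xi> \<in> chart" "param (coords \<xi>) = \<xi>" using coords_param[OF z] z by auto
qed

section \<open>The coordinate ring of the source\<close>

lemma function_algebra_variety_of:
  fixes X :: "'x set" and G :: "('x \<Rightarrow> 'k::field_prime_char) set"
  shows "function_algebra X {f. restrict f X \<in> regular (variety_of X G)}"
proof
  have R: "restrict f X \<in> regular (variety_of X G) \<longleftrightarrow> (\<exists>h\<in>fun_algebra G. restrict f X = restrict h X)" for f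
    by (auto simp: variety_of_def)
  fix c and F H :: "'x \<Rightarrow> 'k"
  show "(\<lambda>_. c) \<in> {f. restrict f X \<in> regular (variety_of X G)}"
    unfolding mem_Collect_eq R by (rule bexI[OF refl fun_algebra.const])
  assume F: "F \<in> {f. restrict f X \<in> regular (variety_of X G)}"
  { assume "\<And>z. z \<in> X \<Longrightarrow> F z = H z"
    then have "restrict H X = restrict F X" by (auto simp: restrict_def)
    then show "H \<in> {f. restrict f X \<in> regular (variety_of X G)}" using F by simp }
  assume H: "H \<in> {f. restrict f X \<in> regular (variety_of X G)}"
  from F H obtain a b where ab: "a \<in> fun_algebra G" "restrict F X = restrict a X" "b \<in> fun_algebra G" "restrict H X = restrict b X"
    unfolding mem_Collect_eq R by blast
  have eq: "F x = a x" "H x = b x" if "x \<in> X" for x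
    using fun_cong[OF ab(2), of x] fun_cong[OF ab(4), of x] that by simp_all
  show "(\<lambda>z. F z + H z) \<in> {f. restrict f X \<in> regular (variety_of X G)}"
    unfolding mem_Collect_eq R by (rule bexI[OF _ fun_algebra.add[OF ab(1,3)]]) (auto simp: restrict_def eq)
  show "(\<lambda>z. F z * H z) \<in> {f. restrict f X \<in> regular (variety_of X G)}"
    unfolding mem_Collect_eq R by (rule bexI[OF _ fun_algebra.mult[OF ab(1,3)]]) (auto simp: restrict_def eq)
qed

lemma points_orbit_source [simp]: "points orbit_source = orbit_points"
  by (simp add: orbit_source_def product_variety_def variety_of_def witt_aut_variety_def Omega1_variety_def)

lemma points_witt_variety [simp]: "points witt_variety = UNIV"
  by (simp add: witt_variety_def variety_of_def)

lemma regular_witt_variety: "regular witt_variety = fun_algebra witt_functionals"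
  by (simp add: witt_variety_def variety_of_def restrict_def)

definition source_functions :: "((('k, 'i) witt \<Rightarrow> ('k, 'i) witt) \<times> ('k::field_prime_char, 'i::{finite, linorder}) witt \<Rightarrow> 'k) set" where
  "source_functions = {f. restrict f orbit_points \<in> regular orbit_source}"

interpretation source: function_algebra orbit_points
  "source_functions :: ((('k, 'i) witt \<Rightarrow> ('k, 'i) witt) \<times> ('k::field_prime_char, 'i::{finite, linorder}) witt \<Rightarrow> 'k) set"
  using function_algebra_variety_of[of "orbit_points"]
  unfolding source_functions_def orbit_source_def product_variety_def
  by (simp add: variety_of_def witt_aut_variety_def Omega1_variety_def)

lemma source_functions_generators:
  assumes "wlin l"
  shows "(\<lambda>\<xi>. l (fst \<xi> D)) \<in> source_functions" "(\<lambda>\<xi>. l (tinv (fst \<xi>) D)) \<in> source_functions"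
    "(\<lambda>\<xi>. l (snd \<xi>)) \<in> source_functions"
proof -
  let ?S = "{\<lambda>g. l (g D) | l D. l \<in> witt_functionals} \<union> {\<lambda>g. l (tinv g D) | l D. l \<in> witt_functionals}"
  let ?G = "{\<lambda>z. f (fst z) | f. f \<in> regular witt_aut_variety} \<union> {\<lambda>z. g (snd z) | g. g \<in> regular Omega1_variety}"
  have l: "l \<in> witt_functionals" using assms by (simp add: witt_functionals_iff)
  have reg: "restrict f orbit_points \<in> regular orbit_source" if "f \<in> ?G" for f
    using fun_algebra.gen[OF that]
    by (auto simp: orbit_source_def product_variety_def variety_of_def witt_aut_variety_def Omega1_variety_def)
  have aut: "(\<lambda>\<xi>. f (fst \<xi>)) \<in> source_functions" if "f \<in> ?S" for f
  proof -
    have "restrict f witt_aut \<in> regular witt_aut_variety"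
      using fun_algebra.gen[OF that] by (simp add: witt_aut_variety_def variety_of_def)
    then have "(\<lambda>\<xi>. restrict f witt_aut (fst \<xi>)) \<in> ?G" by blast
    from reg[OF this] have "(\<lambda>\<xi>. restrict f witt_aut (fst \<xi>)) \<in> source_functions"
      by (simp add: source_functions_def)
    then show ?thesis by (rule source.cong_in) auto
  qed
  show "(\<lambda>\<xi>. l (fst \<xi> D)) \<in> source_functions" using aut[of "\<lambda>g. l (g D)"] l by blast
  show "(\<lambda>\<xi>. l (tinv (fst \<xi>) D)) \<in> source_functions" using aut[of "\<lambda>g. l (tinv g D)"] l by blast
  have "restrict l Omega1 \<in> regular Omega1_variety"
    using fun_algebra.gen[OF l] by (simp add: Omega1_variety_def variety_of_def)
  then have "(\<lambda>\<xi>. restrict l Omega1 (snd \<xi>)) \<in> ?G" by blast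
  from reg[OF this] have "(\<lambda>\<xi>. restrict l Omega1 (snd \<xi>)) \<in> source_functions"
    by (simp add: source_functions_def)
  then show "(\<lambda>\<xi>. l (snd \<xi>)) \<in> source_functions" by (rule source.cong_in) auto
qed

lemma wlin_tcoeff: "wlin (\<lambda>D. tcoeff (wapply D h) a)"
  by (simp add: wlin_def)

lemma source_regular_tp:
  "source.regular_tp (\<lambda>\<xi>. wapply (fst \<xi> D) h)" "source.regular_tp (\<lambda>\<xi>. wapply (tinv (fst \<xi>) D) h)"
  "source.regular_tp (\<lambda>\<xi>. wapply (snd \<xi>) h)"
  unfolding source.regular_tp_def using source_functions_generators[OF wlin_tcoeff] by blast+

lemma source_recover_var:
  "source.regular_tp (\<lambda>\<xi>. recover_var l (fst \<xi>) j)" "source.regular_tp (\<lambda>\<xi>. recover_var l (tinv (fst \<xi>)) j)"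
proof -
  have *: "source.regular_tp (\<lambda>\<xi>. recover_var l (g \<xi>) j)"
    if "\<And>D h. source.regular_tp (\<lambda>\<xi>. wapply (g \<xi> D) h)" "\<And>D h. source.regular_tp (\<lambda>\<xi>. wapply (tinv (g \<xi>) D) h)" for g
    unfolding recover_var_def recover_unit_def dual_entry_def
    by (intro source.regular_tp_mult source.regular_tp_sum source.regular_tp_power source.regular_tp_diff
      source.regular_tp_const source.regular_tp_scale source.regular_tp_eps that)
  show "source.regular_tp (\<lambda>\<xi>. recover_var l (fst \<xi>) j)" by (rule * source_regular_tp)+
  have "source.regular_tp (\<lambda>\<xi>. wapply (tinv (tinv (fst \<xi>)) D) h)" for D h
    by (rule source.regular_tp_cong[OF source_regular_tp(1)]) (auto simp: inv_inv_eq witt_autD(3))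
  then show "source.regular_tp (\<lambda>\<xi>. recover_var l (tinv (fst \<xi>)) j)" by (intro * source_regular_tp)
qed

lemma coords_in: "(\<lambda>\<xi>. coords \<xi> v) \<in> source_functions"
proof (cases "snd v = 0")
  case True
  then show ?thesis unfolding coords_def
    by (simp add: source.mult_in source.const_in source.regular_tpD source_regular_tp)
next
  case False
  then show ?thesis unfolding coords_def
    by (simp add: source.regular_tpD source_recover_var)
qed

(* The argument ty only fixes the type variables. *)
context
  fixes ty :: "('k::field_prime_char \<times> 'i::{finite, linorder}) itself"
  assumes inf: "infinite (UNIV :: 'k set)" and p: "CHAR('k) > 2" and card: "CARD('i) \<ge> 2"
begin

text \<open>The inverse of the determinant is the determinant of the inverse, whose entries are regular functions.\<close>

lemma inverse_det_in: "(\<lambda>\<xi> :: _ \<times> ('k, 'i) witt. inverse (eval_field (coords \<xi>) det_expr)) \<in> source_functions"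
proof (rule source.cong_in)
  let ?\<psi> = "\<lambda>\<xi> :: _ \<times> ('k, 'i) witt. tsubst (\<lambda>j. recover_var (Min UNIV) (tinv (fst \<xi>)) j)"
  have \<psi>: "?\<psi> \<xi> = tinv (phi (coords \<xi>))" if \<xi>: "\<xi> \<in> orbit_points" for \<xi>
  proof -
    let ?\<phi> = "phi (coords \<xi>)"
    note z = param_surj[OF inf p card \<xi>]
    note \<phi> = alg_hom_phi[of "coords \<xi>"] chartD(1)[OF z(1)]
    have t: "alg_hom (tinv ?\<phi>)" "bij (tinv ?\<phi>)" using \<phi> by (simp_all add: alg_hom_tinv bij_imp_bij_inv)
    have "fst \<xi> = wconj ?\<phi>" using arg_cong[OF z(2), of fst] by (simp add: param_def)
    then have "tinv (fst \<xi>) = wconj (tinv ?\<phi>)" using tinv_wconj[OF \<phi>] by auto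
    then have var: "recover_var (Min UNIV) (tinv (fst \<xi>)) j = tinv ?\<phi> (tvar j)" for j
      by (simp add: recover_var_wconj[OF t])
    have e: "eps (tinv ?\<phi> (tvar j)) = 0" for j by (simp add: alg_hom_eps[OF t(1)])
    show ?thesis unfolding var
      by (rule alg_hom_ext[OF alg_hom_tsubst[OF e] t(1)]) (simp add: tsubst_tvar[OF e])
  qed
  have reg: "source.regular_tp (\<lambda>\<xi>. ?\<psi> \<xi> h)" for h
  proof (rule source.regular_tp_alg_hom)
    fix \<xi> :: "(('k, 'i) witt \<Rightarrow> ('k, 'i) witt) \<times> ('k, 'i) witt" assume \<xi>: "\<xi> \<in> orbit_points"
    show "alg_hom (?\<psi> \<xi>)"
      unfolding \<psi>[OF \<xi>] by (rule alg_hom_tinv[OF alg_hom_phi chartD(1)[OF param_surj(1)[OF inf p card \<xi>]]])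
  next
    fix i :: 'i
    show "source.regular_tp (\<lambda>\<xi>. ?\<psi> \<xi> (tvar i))"
      unfolding tsubst_def
      by (intro source.regular_tp_sum source.regular_tp_scale source.const_in source.regular_tp_prod
        source.regular_tp_power source_recover_var)
  qed
  show "(\<lambda>\<xi>. det (opmat (?\<psi> \<xi>))) \<in> source_functions"
    by (rule source.det_in[OF opmat_carrier[OF refl]]) (simp add: opmat_index[OF refl] source.regular_tpD reg)
  show "det (opmat (?\<psi> \<xi>)) = inverse (eval_field (coords \<xi>) det_expr)" if \<xi>: "\<xi> \<in> orbit_points" for \<xi>
    unfolding \<psi>[OF \<xi>] eval_field_det_expr
    by (rule bij_iff_det_opmat(3)[OF refl tlinear_alg_hom[OF alg_hom_phi] chartD(1)[OF param_surj(1)[OF inf p card \<xi>]], symmetric])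
qed

lemma source_expr: "(\<lambda>\<xi> :: _ \<times> ('k, 'i) witt. eval_field (loc_env det_expr (coords \<xi>)) e) \<in> source_functions"
proof (induction e)
  case (EVar w)
  then show ?case by (cases w) (simp_all add: coords_in inverse_det_in)
qed (simp_all add: source.const_in source.add_in source.mult_in)

lemma chart_regular_wconj:
  "chart.regular_tp (\<lambda>z. wapply (wconj (phi z) D) h :: ('k, 'i) trunc_poly)"
  "chart.regular_tp (\<lambda>z. wapply (tinv (wconj (phi z)) D) h :: ('k, 'i) trunc_poly)"
proof -
  have "chart.regular_tp (\<lambda>z. phi z (wapply D (tinv (phi z) h)) :: ('k, 'i) trunc_poly)"
    by (rule chart.regular_tp_apply[where A = phi, OF chart_regular_phi tlinear_alg_hom[OF alg_hom_phi]
      chart.regular_tp_apply[where A = "\<lambda>z. wapply D", OF chart.regular_tp_const tlinear_wapply chart_regular_inverse]])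
  then show "chart.regular_tp (\<lambda>z. wapply (wconj (phi z) D) h :: ('k, 'i) trunc_poly)"
    by (rule chart.regular_tp_cong) (simp add: wapply_wconj alg_hom_phi chartD)
  have "chart.regular_tp (\<lambda>z. tinv (phi z) (wapply D (phi z h)) :: ('k, 'i) trunc_poly)"
    by (rule chart.regular_tp_apply[where A = "\<lambda>z. tinv (phi z)", OF chart_regular_inverse
        tlinear_alg_hom[OF alg_hom_tinv[OF alg_hom_phi chartD(1)]]
      chart.regular_tp_apply[where A = "\<lambda>z. wapply D", OF chart.regular_tp_const tlinear_wapply chart_regular_phi]])
  then show "chart.regular_tp (\<lambda>z. wapply (tinv (wconj (phi z)) D) h :: ('k, 'i) trunc_poly)"
    by (rule chart.regular_tp_cong)
       (simp add: tinv_wconj wapply_wconj alg_hom_phi chartD alg_hom_tinv bij_imp_bij_inv inv_inv_eq)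
qed

lemma D_eta_expand: "wapply (D_eta \<eta>) h = wapply (wfield lowvars) h +
    (\<Sum>i\<in>UNIV. tscale (\<eta> i) (tscale (eta_sign i) (xtau * tpderiv i h)))"
  by (simp add: wapply_D_eta wapply_wfield sum_distrib_left tscale_def tconst_mult mult_ac)

lemma chart_regular_D_eta: "chart.regular_tp (\<lambda>z. wapply (D_eta (\<lambda>i. z (i, 0))) h :: ('k, 'i) trunc_poly)"
  unfolding D_eta_expand
  by (intro chart.regular_tp_add chart.regular_tp_sum chart.regular_tp_scale chart.regular_tp_const chart_coordinate)

lemma chart_functional:
  assumes "wlin l" "\<And>h. chart.regular_tp (\<lambda>z. wapply (M z) h :: ('k, 'i) trunc_poly)"
  shows "(\<lambda>z. l (M z)) \<in> chart_functions"
proof -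
  have l: "(\<lambda>z. l (M z)) = (\<lambda>z. \<Sum>r\<in>UNIV \<times> reduced CHAR('k). wcoord r (M z) * l (wbasis r))"
    by (rule ext) (rule wlin_expand[OF assms(1)])
  show ?thesis unfolding l wcoord_def
    by (intro chart.sum_in chart.mult_in chart.const_in chart.regular_tpD assms(2))
qed

lemma function_algebra_pulled_back:
  "function_algebra orbit_points {f :: _ \<times> ('k, 'i) witt \<Rightarrow> 'k. (\<lambda>z. f (param z)) \<in> chart_functions}"
proof (unfold_locales, unfold mem_Collect_eq, goal_cases)
  case (4 F G)
  show ?case by (rule chart.cong_in[OF 4(1)]) (simp add: param_points 4(2))
qed (simp_all add: chart.const_in chart.add_in chart.mult_in)

text \<open>The generators of the coordinate ring are regular on the chart, because the entries of an inverse matrix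
  are; conversely the coordinates and the inverse of the determinant are regular on the source.\<close>

lemma regular_orbit_source_iff:
  "f \<in> source_functions \<longleftrightarrow> (\<lambda>z. f (param z)) \<in> chart_functions"
  for f :: "_ \<times> ('k, 'i) witt \<Rightarrow> 'k"
proof
  let ?P = "{f :: _ \<times> ('k, 'i) witt \<Rightarrow> 'k. (\<lambda>z. f (param z)) \<in> chart_functions}"
  interpret P: function_algebra orbit_points ?P by (rule function_algebra_pulled_back)
  show "f \<in> source_functions" if "(\<lambda>z. f (param z)) \<in> chart_functions"
  proof -
    from that obtain e where e: "\<And>z. z \<in> chart \<Longrightarrow> f (param z) = eval_field (loc_env det_expr z) e"
      unfolding chart_functions_def by blast
    show ?thesis
      by (rule source.cong_in[OF source_expr[of e]])
         (use e[OF param_surj(1)[OF inf p card]] param_surj(2)[OF inf p card] in simp)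
  qed
  assume "f \<in> source_functions"
  then obtain h where h: "restrict f orbit_points = restrict h orbit_points"
    "h \<in> fun_algebra ({\<lambda>z. f (fst z) | f. f \<in> regular (witt_aut_variety :: (('k, 'i) witt \<Rightarrow> _, 'k) variety)} \<union>
      {\<lambda>z. g (snd z) | g. g \<in> regular (Omega1_variety :: (('k, 'i) witt, 'k) variety)})"
    by (auto simp: source_functions_def orbit_source_def product_variety_def variety_of_def witt_aut_variety_def Omega1_variety_def)
  have aut: "(\<lambda>\<xi>. f (fst \<xi>)) \<in> ?P" if f: "f \<in> fun_algebra ({\<lambda>g. l (g D) | l D. l \<in> witt_functionals} \<union>
    {\<lambda>g. l (tinv g D) | l D. l \<in> witt_functionals})" for f :: "(('k, 'i) witt \<Rightarrow> ('k, 'i) witt) \<Rightarrow> 'k"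
    using f
  proof induction
    case (gen f)
    then show ?case
      by (auto simp: param_def witt_functionals_iff intro: chart_functional chart_regular_wconj)
  qed (use P.const_in P.add_in P.mult_in in auto)
  have omega: "(\<lambda>\<xi>. f (snd \<xi>)) \<in> ?P" if f: "f \<in> fun_algebra witt_functionals" for f :: "('k, 'i) witt \<Rightarrow> 'k"
    using f
  proof induction
    case (gen f)
    then show ?case
      by (auto simp: param_def witt_functionals_iff intro: chart_functional chart_regular_D_eta)
  qed (use P.const_in P.add_in P.mult_in in auto)
  have "h \<in> ?P"
    using h(2)
  proof induction
    case (gen f)
    then consider f' where "f = (\<lambda>z. f' (fst z))" "f' \<in> regular witt_aut_variety" |
      f' where "f = (\<lambda>z. f' (snd z))" "f' \<in> regular Omega1_variety" by blast
    then show ?case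
    proof cases
      case 1
      then obtain f'' where f'': "f' = restrict f'' witt_aut" "f'' \<in> fun_algebra ({\<lambda>g. l (g D) | l D. l \<in> witt_functionals} \<union>
        {\<lambda>g. l (tinv g D) | l D. l \<in> witt_functionals})"
        by (auto simp: witt_aut_variety_def variety_of_def)
      show ?thesis by (rule P.cong_in[OF aut[OF f''(2)]]) (auto simp: 1(1) f''(1))
    next
      case 2
      then obtain f'' where f'': "f' = restrict f'' Omega1" "f'' \<in> fun_algebra witt_functionals"
        by (auto simp: Omega1_variety_def variety_of_def)
      show ?thesis by (rule P.cong_in[OF omega[OF f''(2)]]) (auto simp: 2(1) f''(1))
    qed
  qed (use P.const_in P.add_in P.mult_in in auto)
  then have "f \<in> ?P"
  proof (rule P.cong_in)
    fix \<xi> assume "\<xi> \<in> (orbit_points :: (_ \<times> ('k, 'i) witt) set)"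
    then show "h \<xi> = f \<xi>" using fun_cong[OF h(1), of \<xi>] by simp
  qed
  then show "(\<lambda>z. f (param z)) \<in> chart_functions" by simp
qed

end

section \<open>Lifting coordinate vector fields along the orbit map\<close>

lemma (in function_algebra) eval_field_in: "(\<And>v. (\<lambda>z. c z v) \<in> \<A>) \<Longrightarrow> (\<lambda>z. eval_field (c z) e) \<in> \<A>"
  by (induction e) (simp_all add: const_in add_in mult_in)

lemma (in function_algebra) deriv_field_in:
  "(\<And>v. (\<lambda>z. c z v) \<in> \<A>) \<Longrightarrow> (\<And>v. (\<lambda>z. t z v) \<in> \<A>) \<Longrightarrow> (\<lambda>z. deriv_field (c z) (t z) e) \<in> \<A>"
  by (induction e) (simp_all add: const_in add_in mult_in eval_field_in)

text \<open>Solutions for the basis vectors suffice, because the linearised equation is linear in the right hand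
  side; they make the solution for variable \<open>Y\<close> a regular function.\<close>

definition basis_solution :: "'i cvar \<Rightarrow> ('k::field_prime_char, 'i::{finite, linorder}) witt" where
  "basis_solution r = (SOME F. F \<in> W0 \<and> (\<forall>\<eta> i. in_socle (wapply (wbracket F (D_eta \<eta>) - wbasis r) (tvar i))))"

lemma basis_solution:
  "basis_solution r \<in> W0" "in_socle (wapply (wbracket (basis_solution r) (D_eta \<eta>) - wbasis r) (tvar i))"
proof -
  have "\<exists>F. F \<in> W0 \<and> (\<forall>\<eta> i. in_socle (wapply (wbracket F (D_eta \<eta>) - wbasis r) (tvar i)))"
    using linearised_orbit_solvable[of "wbasis r"] by blast
  note * = someI_ex[OF this, folded basis_solution_def]
  show "basis_solution r \<in> W0" using * by (rule conjunct1)
  show "in_socle (wapply (wbracket (basis_solution r) (D_eta \<eta>) - wbasis r) (tvar i))"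
    using conjunct2[OF *] by blast
qed

definition group_part :: "('k, 'i) witt \<Rightarrow> ('k::field_prime_char, 'i::{finite, linorder}) witt" where
  "group_part Y = (\<Sum>r\<in>UNIV \<times> reduced CHAR('k). wscale (wcoord r Y) (basis_solution r))"

text \<open>The coefficients of the remainder at the top monomial. The sign undoes the one in \<open>\<D>\<^sub>\<eta>\<close>.\<close>

definition slice_part :: "('k::field_prime_char, 'i::{finite, linorder}) witt \<Rightarrow> ('i \<Rightarrow> 'k) \<Rightarrow> 'i \<Rightarrow> 'k" where
  "slice_part Y \<eta> i = eta_sign i *
    tcoeff (wapply (Y - wbracket (group_part Y) (D_eta \<eta>)) (tvar i)) (tau CHAR('k))"

lemma soc_sum: "(\<And>x. x \<in> A \<Longrightarrow> in_socle (f x)) \<Longrightarrow> in_socle (sum f A)"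
  by (induction A rule: infinite_finite_induct) (simp_all add: soc_simps)

lemma group_part_W0: "group_part Y \<in> (W0 :: ('k::field_prime_char, 'i::{finite, linorder}) witt set)"
proof -
  have "eps (wapply (basis_solution r) f) = 0" for r and f :: "('k, 'i) trunc_poly"
    using basis_solution(1)[of r] unfolding W0_def by blast
  then show ?thesis by (simp add: group_part_def W0_def)
qed

lemma decompose:
  fixes Y :: "('k::field_prime_char, 'i::{finite, linorder}) witt"
  shows "wbracket (group_part Y) (D_eta \<eta>) +
    (\<Sum>i\<in>UNIV. wscale (eta_sign i * slice_part Y \<eta> i) (wmult xtau (wpartial i))) = Y"
proof (rule witt_eqI_var)
  fix j :: 'i
  let ?R = "UNIV \<times> reduced CHAR('k) :: 'i cvar set"
  have "wapply (wbracket (group_part Y) (D_eta \<eta>) - Y) (tvar j) =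
    (\<Sum>r\<in>?R. tscale (wcoord r Y) (wapply (wbracket (basis_solution r) (D_eta \<eta>) - wbasis r) (tvar j)))"
  proof -
    have "wapply Y (tvar j) = (\<Sum>r\<in>?R. tscale (wcoord r Y) (wapply (wbasis r) (tvar j)))"
      by (subst witt_expand[of Y]) simp
    moreover have "wapply (wbracket (group_part Y) (D_eta \<eta>)) (tvar j) =
      (\<Sum>r\<in>?R. tscale (wcoord r Y) (wapply (wbracket (basis_solution r) (D_eta \<eta>)) (tvar j)))"
    proof -
      have minus: "tscale c (f - g) = tscale c f - tscale c g" for c and f g :: "('k, 'i) trunc_poly"
        by (simp add: tscale_def right_diff_distrib)
      show ?thesis by (simp add: group_part_def minus sum_subtractf)
    qed
    ultimately show ?thesis by (simp add: tscale_def right_diff_distrib sum_subtractf)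
  qed
  then have "in_socle (wapply (wbracket (group_part Y) (D_eta \<eta>) - Y) (tvar j))"
    by (simp only:) (intro soc_sum soc_simps(6) basis_solution(2))
  then have "in_socle (wapply (Y - wbracket (group_part Y) (D_eta \<eta>)) (tvar j))"
    using soc_simps(4) by fastforce
  from soc_eq[OF this] have "wapply (Y - wbracket (group_part Y) (D_eta \<eta>)) (tvar j) =
    tscale (eta_sign j * slice_part Y \<eta> j) xtau"
    by (simp add: slice_part_def)
  moreover have "wapply (\<Sum>i\<in>UNIV. wscale (eta_sign i * slice_part Y \<eta> i) (wmult xtau (wpartial i))) (tvar j) =
    tscale (eta_sign j * slice_part Y \<eta> j) xtau"
    by (simp add: wapply_wpartial if_distrib cong: if_cong)
  ultimately show "wapply (wbracket (group_part Y) (D_eta \<eta>) +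
    (\<Sum>i\<in>UNIV. wscale (eta_sign i * slice_part Y \<eta> i) (wmult xtau (wpartial i)))) (tvar j) = wapply Y (tvar j)"
    by (simp add: algebra_simps)
qed

text \<open>Tangent vectors are computed after moving the point of the orbit back to the slice.\<close>

definition moved_back :: "('k, 'i) witt \<Rightarrow> ('i cvar \<Rightarrow> 'k) \<Rightarrow> ('k::field_prime_char, 'i::finite) witt" where
  "moved_back Y z = tinv (wconj (phi z)) Y"

definition lifted_field :: "('k::field_prime_char, 'i::{finite, linorder}) witt \<Rightarrow> ('i cvar \<Rightarrow> 'k) \<Rightarrow> 'i cvar \<Rightarrow> 'k" where
  "lifted_field Y z v = (if v \<notin> cvars CHAR('k) then 0
    else if snd v = 0 then slice_part (moved_back Y z) (\<lambda>i. z (i, 0)) (fst v)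
    else tcoeff (phi z (wapply (group_part (moved_back Y z)) (tvar (fst v)))) (snd v))"

definition lifted_deriv :: "('k::field_prime_char, 'i::{finite, linorder}) witt \<Rightarrow> (('i cvar \<Rightarrow> 'k) \<Rightarrow> 'k) \<Rightarrow> ('i cvar \<Rightarrow> 'k) \<Rightarrow> 'k" where
  "lifted_deriv Y F z = chart_deriv z (lifted_field Y z) F"

(* The argument ty only fixes the type variables. *)
context
  fixes ty :: "('k::field_prime_char \<times> 'i::{finite, linorder}) itself"
  assumes inf: "infinite (UNIV :: 'k set)" and p: "CHAR('k) > 2" and card: "CARD('i) \<ge> 2"
begin

lemma chart_regular_group_part:
  "chart.regular_tp (\<lambda>z. wapply (group_part (moved_back Y z)) h :: ('k, 'i) trunc_poly)"
  unfolding group_part_def wapply_sum_witt wapply_witt moved_back_def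
  by (intro chart.regular_tp_sum chart.regular_tp_scale chart.regular_tp_const
      chart_functional[OF inf p card wlin_wcoord chart_regular_wconj(2)[OF inf p card]])

lemma lifted_field_in: "(\<lambda>z. lifted_field (Y :: ('k, 'i) witt) z v) \<in> chart_functions"
proof -
  note G = chart_regular_group_part[of Y] and E = chart_regular_D_eta[OF inf p card]
  have "chart.regular_tp (\<lambda>z. wapply (group_part (moved_back Y z)) (wapply (D_eta (\<lambda>i. z (i, 0))) h) :: ('k, 'i) trunc_poly)"
    "chart.regular_tp (\<lambda>z. wapply (D_eta (\<lambda>i. z (i, 0))) (wapply (group_part (moved_back Y z)) h) :: ('k, 'i) trunc_poly)" for h
    by (rule chart.regular_tp_apply[where A = "\<lambda>z. wapply (group_part (moved_back Y z))", OF G tlinear_wapply E],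
        rule chart.regular_tp_apply[where A = "\<lambda>z. wapply (D_eta (\<lambda>i. z (i, 0)))", OF E tlinear_wapply G])
  moreover have "chart.regular_tp (\<lambda>z. wapply (moved_back Y z) h :: ('k, 'i) trunc_poly)" for h
    unfolding moved_back_def by (rule chart_regular_wconj(2)[OF inf p card])
  ultimately have "chart.regular_tp (\<lambda>z. wapply (moved_back Y z - wbracket (group_part (moved_back Y z)) (D_eta (\<lambda>i. z (i, 0)))) h :: ('k, 'i) trunc_poly)" for h
    unfolding wapply_witt wapply_wbracket by (intro chart.regular_tp_diff)
  then have 1: "(\<lambda>z. slice_part (moved_back Y z) (\<lambda>i. z (i, 0)) i) \<in> chart_functions" for i
    unfolding slice_part_def by (intro chart.mult_in chart.const_in chart.regular_tpD)
  have "chart.regular_tp (\<lambda>z. phi z (wapply (group_part (moved_back Y z)) h) :: ('k, 'i) trunc_poly)" for h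
    by (rule chart.regular_tp_apply[where A = phi, OF chart_regular_phi tlinear_alg_hom[OF alg_hom_phi] G])
  then have 2: "(\<lambda>z. tcoeff (phi z (wapply (group_part (moved_back Y z)) h)) a) \<in> chart_functions" for h a
    by (rule chart.regular_tpD)
  show ?thesis
    unfolding lifted_field_def using 1 2
    by (cases "v \<notin> cvars CHAR('k)"; cases "snd v = 0") (simp_all add: chart.const_in)
qed

lemma lifted_deriv_point_derivation:
  "z \<in> chart \<Longrightarrow> point_derivation chart chart_functions z (\<lambda>F. lifted_deriv (Y :: ('k, 'i) witt) F z)"
  unfolding lifted_deriv_def by (rule point_derivation_chart[OF inf]) (simp_all add: lifted_field_def)

lemma lifted_deriv_in:
  assumes "F \<in> chart_functions"
  shows "lifted_deriv (Y :: ('k, 'i) witt) F \<in> chart_functions"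
proof -
  obtain e where e: "\<And>z. z \<in> chart \<Longrightarrow> F z = eval_field (loc_env det_expr z) e"
    using assms unfolding chart_functions_def by blast
  have inverse: "(\<lambda>z :: 'i cvar \<Rightarrow> 'k. inverse (eval_field z det_expr)) \<in> chart_functions"
    using chart_inverse_det by (simp add: eval_field_det_expr)
  show ?thesis
  proof (rule chart.cong_in)
    show "(\<lambda>z. deriv_field (loc_env det_expr z) (loc_tangent det_expr z (lifted_field Y z)) e) \<in> chart_functions"
    proof (rule chart.deriv_field_in)
      fix w :: "'i cvar option"
      show "(\<lambda>z :: 'i cvar \<Rightarrow> 'k. loc_env det_expr z w) \<in> chart_functions"
        using inverse chart_coordinate by (cases w) simp_all
      have "(\<lambda>z. - (deriv_field z (lifted_field Y z) det_expr * (inverse (eval_field z det_expr))\<^sup>2)) \<in> chart_functions"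
        by (intro chart.uminus_in chart.mult_in chart.power_in inverse chart.deriv_field_in chart_coordinate lifted_field_in)
      then show "(\<lambda>z. loc_tangent det_expr z (lifted_field Y z) w) \<in> chart_functions"
        using lifted_field_in by (cases w) (simp_all add: field_simps)
    qed
    show "deriv_field (loc_env det_expr z) (loc_tangent det_expr z (lifted_field Y z)) e = lifted_deriv Y F z"
      if z: "z \<in> chart" for z
      unfolding lifted_deriv_def by (rule chart_deriv_eq[OF inf z _ e, symmetric]) (simp_all add: lifted_field_def)
  qed
qed

text \<open>The vector field lifts the constant field \<open>Y\<close>: at \<open>(\<phi>, \<D>\<^sub>\<eta>)\<close> it has group component \<open>F\<close> and slice
  component \<open>c\<close> with \<open>[F, \<D>\<^sub>\<eta>] + \<Sum> \<plusminus>c\<^sub>i x\<^sup>\<tau> D\<^sub>i = \<phi>\<inverse> . Y\<close>.\<close>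

lemma lifted_deriv_orbit_map:
  assumes z0: "z0 \<in> chart" and l: "wlin l"
  shows "lifted_deriv (Y :: ('k, 'i) witt) (\<lambda>z. l (orbit_map (param z))) z0 = l Y"
proof -
  let ?\<zeta> = "lifted_field Y z0" and ?F = "group_part (moved_back Y z0)"
  let ?c = "slice_part (moved_back Y z0) (\<lambda>i. z0 (i, 0))"
  let ?X = "\<lambda>z :: 'i cvar \<Rightarrow> 'k. D_eta (\<lambda>i. z (i, 0)) :: ('k, 'i) witt"
  let ?X' = "\<Sum>i\<in>UNIV. wscale (eta_sign i * ?c i) (wmult xtau (wpartial i)) :: ('k, 'i) witt"
  have supp: "\<And>v. v \<notin> cvars CHAR('k) \<Longrightarrow> ?\<zeta> v = 0" by (simp add: lifted_field_def)
  interpret point_derivation chart chart_functions z0 "chart_deriv z0 ?\<zeta>"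
    by (rule point_derivation_chart[OF inf z0 supp])
  have var: "has_deriv (\<lambda>z. phi z (tvar i)) (phi z0 (wapply ?F (tvar i)))" for i
    by (rule has_deriv_phi[OF inf z0 supp group_part_W0]) (simp_all add: lifted_field_def cvars_def)
  have "has_deriv (\<lambda>z. wapply (?X z) h) (wapply ?X' h)" for h
  proof -
    have d: "chart_deriv z0 ?\<zeta> (\<lambda>z. z (i, 0)) = ?c i" for i
      by (rule trans[OF chart_deriv_coordinate[OF inf z0 supp]]) (simp_all add: lifted_field_def cvars_def)
    have "has_deriv (\<lambda>z. tscale (z (i, 0)) (tscale (eta_sign i) (xtau * tpderiv i h)))
      (tscale (?c i) (tscale (eta_sign i) (xtau * tpderiv i h)) + tscale (z0 (i, 0)) 0)" for i
      using has_deriv_scale[OF chart_coordinate[of "(i, 0)"] has_deriv_const[of "tscale (eta_sign i) (xtau * tpderiv i h)"]]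
      unfolding d .
    then have "has_deriv (\<lambda>z. wapply (wfield lowvars) h + (\<Sum>i\<in>UNIV. tscale (z (i, 0)) (tscale (eta_sign i) (xtau * tpderiv i h))))
      (0 + (\<Sum>i\<in>UNIV. tscale (?c i) (tscale (eta_sign i) (xtau * tpderiv i h)) + tscale (z0 (i, 0)) 0))"
      by (intro has_deriv_add has_deriv_const has_deriv_sum)
    then show ?thesis
      unfolding D_eta_expand[OF inf p card] by (simp add: wapply_wpartial mult.commute)
  qed
  then have "has_deriv (\<lambda>z. wapply (wconj (phi z) (?X z)) h)
    (wapply (wconj (phi z0) (wbracket ?F (?X z0) + ?X')) h)" for h
    by (intro has_deriv_wconj[OF alg_hom_phi chartD(1) var chart_regular_inverse])
  then have "has_deriv (\<lambda>z. wapply (orbit_map (param z)) h) (wapply (wconj (phi z0) (moved_back Y z0)) h)" for h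
    unfolding decompose by (simp add: orbit_map_def param_def)
  from functional_deriv(2)[OF this l] show ?thesis
    by (simp add: lifted_deriv_def moved_back_def witt_autD(9)[OF wconj_witt_aut[OF alg_hom_phi chartD(1)[OF z0]]])
qed

lemma orbit_map_functional: "wlin l \<Longrightarrow> (\<lambda>z. l (orbit_map (param z) :: ('k, 'i) witt)) \<in> chart_functions"
proof (rule chart_functional[OF inf p card])
  fix h :: "('k, 'i) trunc_poly"
  have "chart.regular_tp (\<lambda>z. phi z (wapply (D_eta (\<lambda>i. z (i, 0))) (tinv (phi z) h)) :: ('k, 'i) trunc_poly)"
    by (rule chart.regular_tp_apply[where A = phi, OF chart_regular_phi tlinear_alg_hom[OF alg_hom_phi]
      chart.regular_tp_apply[where A = "\<lambda>z. wapply (D_eta (\<lambda>i. z (i, 0)))", OF chart_regular_D_eta[OF inf p card] tlinear_wapply chart_regular_inverse]])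
  then show "chart.regular_tp (\<lambda>z. wapply (orbit_map (param z)) h :: ('k, 'i) trunc_poly)"
    by (rule chart.regular_tp_cong) (simp add: orbit_map_def param_def wapply_wconj alg_hom_phi chartD)
qed

end

section \<open>Correcting a lift by derivations\<close>

context cring
begin

lemma finsum_in_ideal:
  assumes J: "ideal J R" and "finite I" "\<And>i. i \<in> I \<Longrightarrow> f i \<in> J"
  shows "(\<Oplus>i\<in>I. f i) \<in> J"
proof -
  interpret J: ideal J R by fact
  show ?thesis using assms(2,3)
  proof (induction I rule: finite_induct)
    case (insert i I)
    then have "(\<Oplus>i\<in>insert i I. f i) = f i \<oplus> (\<Oplus>i\<in>I. f i)"
      by (intro finsum_insert) (auto intro: J.a_Hcarr)
    then show ?case using insert by (simp add: J.a_closed)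
  qed simp
qed

text \<open>Adding to a ring homomorphism \<open>w\<^sub>0\<close> a derivation along \<open>w\<^sub>0\<close> with values in a square-zero ideal gives
  a ring homomorphism. Derivations \<open>D\<^sub>r\<close> dual to elements \<open>Y\<^sub>r\<close> of the source produce one that
  moves \<open>w\<^sub>0(Y\<^sub>r)\<close> to any prescribed value in its coset.\<close>

lemma corrected_lift:
  fixes B :: "('x, 'y) ring_scheme"
  assumes J: "ideal J R" and square: "\<And>a b. a \<in> J \<Longrightarrow> b \<in> J \<Longrightarrow> a \<otimes> b = \<zero>"
    and B: "ring B" and w0: "w0 \<in> Ring.ring_hom B R"
    and I: "finite I" "\<And>r. r \<in> I \<Longrightarrow> Y r \<in> carrier B" "\<And>r. r \<in> I \<Longrightarrow> t r \<in> carrier R"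
      "\<And>r. r \<in> I \<Longrightarrow> t r \<ominus> w0 (Y r) \<in> J"
    and D: "\<And>r b. r \<in> I \<Longrightarrow> b \<in> carrier B \<Longrightarrow> D r b \<in> carrier B"
      "\<And>r a b. r \<in> I \<Longrightarrow> a \<in> carrier B \<Longrightarrow> b \<in> carrier B \<Longrightarrow> D r (a \<oplus>\<^bsub>B\<^esub> b) = D r a \<oplus>\<^bsub>B\<^esub> D r b"
      "\<And>r a b. r \<in> I \<Longrightarrow> a \<in> carrier B \<Longrightarrow> b \<in> carrier B \<Longrightarrow>
        D r (a \<otimes>\<^bsub>B\<^esub> b) = a \<otimes>\<^bsub>B\<^esub> D r b \<oplus>\<^bsub>B\<^esub> b \<otimes>\<^bsub>B\<^esub> D r a"
      "\<And>r. r \<in> I \<Longrightarrow> D r \<one>\<^bsub>B\<^esub> = \<zero>\<^bsub>B\<^esub>"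
      "\<And>r s. r \<in> I \<Longrightarrow> s \<in> I \<Longrightarrow> D r (Y s) = (if r = s then \<one>\<^bsub>B\<^esub> else \<zero>\<^bsub>B\<^esub>)"
  obtains w where "w \<in> Ring.ring_hom B R" "\<And>b. b \<in> carrier B \<Longrightarrow> w b \<ominus> w0 b \<in> J"
    "\<And>s. s \<in> I \<Longrightarrow> w (Y s) = t s"
    "\<And>b. b \<in> carrier B \<Longrightarrow> (\<And>r. r \<in> I \<Longrightarrow> D r b = \<zero>\<^bsub>B\<^esub>) \<Longrightarrow> w b = w0 b"
proof -
  interpret J: ideal J R by fact
  interpret B: ring B by fact
  note hom = Ring.ring_hom_closed[OF w0] Ring.ring_hom_mult[OF w0] Ring.ring_hom_add[OF w0] Ring.ring_hom_one[OF w0]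
    Ring.ring_hom_zero[OF w0 B ring_axioms]
  define j where "j r = t r \<ominus> w0 (Y r)" for r
  define \<delta> where "\<delta> b = (\<Oplus>r\<in>I. j r \<otimes> w0 (D r b))" for b
  have j: "j r \<in> J" "j r \<in> carrier R" if "r \<in> I" for r
    using I(4)[OF that] J.a_Hcarr by (auto simp: j_def)
  have \<delta>: "\<delta> b \<in> J" "\<delta> b \<in> carrier R" if "b \<in> carrier B" for b
  proof -
    show "\<delta> b \<in> J" unfolding \<delta>_def
      by (rule finsum_in_ideal[OF J I(1)]) (simp add: J.I_r_closed j D that hom)
    then show "\<delta> b \<in> carrier R" by (rule J.a_Hcarr)
  qed
  have \<delta>_add: "\<delta> (a \<oplus>\<^bsub>B\<^esub> b) = \<delta> a \<oplus> \<delta> b" if "a \<in> carrier B" "b \<in> carrier B" for a b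
  proof -
    have "\<delta> (a \<oplus>\<^bsub>B\<^esub> b) = (\<Oplus>r\<in>I. j r \<otimes> w0 (D r a) \<oplus> j r \<otimes> w0 (D r b))"
      unfolding \<delta>_def by (intro finsum_cong') (auto simp: D that hom j r_distr)
    also have "\<dots> = \<delta> a \<oplus> \<delta> b"
      unfolding \<delta>_def by (intro finsum_addf) (auto simp: D that hom j)
    finally show ?thesis .
  qed
  have \<delta>_mult: "\<delta> (a \<otimes>\<^bsub>B\<^esub> b) = w0 a \<otimes> \<delta> b \<oplus> w0 b \<otimes> \<delta> a" if "a \<in> carrier B" "b \<in> carrier B" for a b
  proof -
    have "\<delta> (a \<otimes>\<^bsub>B\<^esub> b) = (\<Oplus>r\<in>I. w0 a \<otimes> (j r \<otimes> w0 (D r b)) \<oplus> w0 b \<otimes> (j r \<otimes> w0 (D r a)))"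
      unfolding \<delta>_def by (intro finsum_cong') (auto simp: D that hom j r_distr m_lcomm)
    also have "\<dots> = (\<Oplus>r\<in>I. w0 a \<otimes> (j r \<otimes> w0 (D r b))) \<oplus> (\<Oplus>r\<in>I. w0 b \<otimes> (j r \<otimes> w0 (D r a)))"
      by (intro finsum_addf) (auto simp: D that hom j)
    also have "\<dots> = w0 a \<otimes> \<delta> b \<oplus> w0 b \<otimes> \<delta> a"
      unfolding \<delta>_def using I(1)
      by (intro arg_cong2[where f = "(\<oplus>)"] finsum_rdistr[symmetric]) (auto simp: D that hom j)
    finally show ?thesis .
  qed
  define w where "w b = w0 b \<oplus> \<delta> b" for b
  have D0: "w b = w0 b" if "b \<in> carrier B" "\<And>r. r \<in> I \<Longrightarrow> D r b = \<zero>\<^bsub>B\<^esub>" for b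
  proof -
    have "\<delta> b = (\<Oplus>r\<in>I. \<zero>)" unfolding \<delta>_def by (intro finsum_cong') (auto simp: that(2) hom j)
    then show ?thesis using that(1) by (simp add: w_def hom)
  qed
  show ?thesis
  proof (rule that[of w])
    show "w \<in> Ring.ring_hom B R"
    proof (rule Ring.ring_hom_memI)
      fix a b assume ab: "a \<in> carrier B" "b \<in> carrier B"
      show "w a \<in> carrier R" using ab by (simp add: w_def hom \<delta>)
      show "w (a \<oplus>\<^bsub>B\<^esub> b) = w a \<oplus> w b" using ab by (simp add: w_def hom \<delta> \<delta>_add a_ac)
      have "w a \<otimes> w b = w0 a \<otimes> w0 b \<oplus> (w0 a \<otimes> \<delta> b \<oplus> w0 b \<otimes> \<delta> a) \<oplus> \<delta> a \<otimes> \<delta> b"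
        using ab by (simp add: w_def hom \<delta> l_distr r_distr a_ac m_comm)
      then show "w (a \<otimes>\<^bsub>B\<^esub> b) = w a \<otimes> w b"
        using ab by (simp add: w_def hom \<delta> \<delta>_mult square)
    next
      show "w \<one>\<^bsub>B\<^esub> = \<one>" using D0[of "\<one>\<^bsub>B\<^esub>"] by (simp add: D hom)
    qed
    show "w b \<ominus> w0 b \<in> J" if "b \<in> carrier B" for b
    proof -
      have "w b \<ominus> w0 b = \<delta> b" using that by (simp add: w_def hom \<delta> minus_eq a_ac r_neg r_neg2)
      then show ?thesis using \<delta>(1)[OF that] by simp
    qed
    show "w (Y s) = t s" if s: "s \<in> I" for s
    proof -
      have "\<delta> (Y s) = (\<Oplus>r\<in>I. if s = r then j r else \<zero>)"
        unfolding \<delta>_def by (intro finsum_cong') (auto simp: D s hom j)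
      also have "\<dots> = j s" by (rule finsum_singleton[OF s I(1)]) (simp add: j)
      finally show ?thesis using s I(2,3) by (simp add: w_def j_def hom minus_eq a_ac r_neg r_neg1 r_neg2)
    qed
    show "w b = w0 b" if "b \<in> carrier B" "\<And>r. r \<in> I \<Longrightarrow> D r b = \<zero>\<^bsub>B\<^esub>" for b
      using D0 that by blast
  qed
qed

end

text \<open>Being a function algebra is all that the ring axioms need: additive inverses are multiples by \<open>-1\<close>.\<close>

lemma cring_coord_ring:
  fixes V :: "('x, 'k::field_prime_char) variety"
  assumes V: "function_algebra (points V) {f. restrict f (points V) \<in> regular V}"
    and ext: "regular V \<subseteq> extensional (points V)"
  shows "cring (coord_ring V)"
proof -
  interpret function_algebra "points V" "{f. restrict f (points V) \<in> regular V}" by (rule V)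
  have r: "f \<in> {f. restrict f (points V) \<in> regular V}" if "f \<in> regular V" for f
    using that ext by (auto simp: extensional_restrict)
  have closed: "restrict (\<lambda>x. f x + g x) (points V) \<in> regular V" "restrict (\<lambda>x. f x * g x) (points V) \<in> regular V"
    "restrict (\<lambda>x. - f x) (points V) \<in> regular V"
    "restrict (\<lambda>_. c) (points V) \<in> regular V" if "f \<in> regular V" "g \<in> regular V" for f g c
    using add_in[OF r r, OF that] mult_in[OF r r, OF that] uminus_in[OF r, OF that(1)] const_in[of c] by simp_all
  have const: "restrict (\<lambda>_. c) (points V) \<in> regular V" for c using const_in[of c] by simp
  note eqI = extensionalityI[where A = "points V"] and ext' = subsetD[OF ext]
  show ?thesis
  proof (rule cringI)
    show "abelian_group (coord_ring V)"
    proof (rule abelian_groupI)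
      fix f assume "f \<in> carrier (coord_ring V)"
      then have f: "f \<in> regular V" by (simp add: coord_ring_def)
      show "\<exists>g\<in>carrier (coord_ring V). g \<oplus>\<^bsub>coord_ring V\<^esub> f = \<zero>\<^bsub>coord_ring V\<^esub>"
        using closed(3)[OF f f]
        by (intro bexI[of _ "restrict (\<lambda>x. - f x) (points V)"]) (auto simp: coord_ring_def)
    qed (auto simp: coord_ring_def closed const algebra_simps intro!: eqI intro: ext')
    show "comm_monoid (coord_ring V)"
      by (rule comm_monoidI) (auto simp: coord_ring_def closed const algebra_simps intro!: eqI intro: ext')
  qed (auto simp: coord_ring_def closed const algebra_simps intro!: eqI intro: ext')
qed

text \<open>A nonconstant polynomial without roots exists over every finite field: \<open>1 + \<Prod> (X - a)\<close>.\<close>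

lemma infinite_alg_closed: "infinite (UNIV :: 'k::alg_closed_field set)"
proof
  assume fin: "finite (UNIV :: 'k set)"
  define q :: "'k poly" where "q = (\<Prod>a\<in>UNIV. [:- a, 1:])"
  have "degree q = (\<Sum>a\<in>(UNIV :: 'k set). degree [:- a, 1:])"
    unfolding q_def by (rule degree_prod_eq_sum_degree) auto
  then have "degree q > 0" using fin by (simp add: card_gt_0_iff)
  then have "degree (q + 1) > 0" by (subst degree_add_eq_left) auto
  then obtain x where "poly (q + 1) x = 0" using alg_closed_imp_poly_has_root by blast
  moreover have "poly q x = 0" unfolding q_def poly_prod by (rule prod_zero[OF fin]) auto
  ultimately show False by simp
qed

section \<open>The orbit map is smooth\<close>

lemma carrier_coord_ring [simp]: "carrier (coord_ring V) = regular V"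
  by (simp add: coord_ring_def)

definition expr_fun :: "('k, 'i cvar option) expr \<Rightarrow> (('k, 'i) witt \<Rightarrow> ('k, 'i) witt) \<times> ('k::field_prime_char, 'i::{finite, linorder}) witt \<Rightarrow> 'k" where
  "expr_fun e = restrict (\<lambda>\<xi>. eval_field (loc_env det_expr (coords \<xi>)) e) orbit_points"

definition src_deriv :: "('k, 'i) witt \<Rightarrow> ((('k, 'i) witt \<Rightarrow> ('k, 'i) witt) \<times> ('k, 'i) witt \<Rightarrow> 'k) \<Rightarrow>
    (('k, 'i) witt \<Rightarrow> ('k, 'i) witt) \<times> ('k::field_prime_char, 'i::{finite, linorder}) witt \<Rightarrow> 'k" where
  "src_deriv Y f = restrict (\<lambda>\<xi>. lifted_deriv Y (\<lambda>z. f (param z)) (coords \<xi>)) orbit_points"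

(* The argument ty only fixes the type variables. *)
context
  fixes ty :: "('k::field_prime_char \<times> 'i::{finite, linorder}) itself"
  assumes inf: "infinite (UNIV :: 'k set)" and p: "CHAR('k) > 2" and card: "CARD('i) \<ge> 2"
begin

abbreviation (input) "src \<equiv> orbit_source :: (_ \<times> ('k, 'i) witt, 'k) variety"
abbreviation (input) "tgt \<equiv> witt_variety :: (('k, 'i) witt, 'k) variety"
abbreviation (input) "pts \<equiv> orbit_points :: (_ \<times> ('k, 'i) witt) set"

lemma regular_src_extensional: "regular src \<subseteq> extensional pts"
  by (auto simp: orbit_source_def product_variety_def variety_of_def witt_aut_variety_def Omega1_variety_def)

lemma regular_src_iff: "f \<in> regular src \<longleftrightarrow> f \<in> extensional pts \<and> (\<lambda>z. f (param z)) \<in> chart_functions"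
  using regular_orbit_source_iff[OF inf p card, of f] regular_src_extensional
  by (auto simp: source_functions_def extensional_restrict)

lemma restrict_in_regular_src: "restrict f pts \<in> regular src \<longleftrightarrow> (\<lambda>z. f (param z)) \<in> chart_functions"
  using regular_orbit_source_iff[OF inf p card, of f] by (simp add: source_functions_def)

lemma cring_src: "cring (coord_ring src)"
  by (rule cring_coord_ring)
     (use source.function_algebra_axioms regular_src_extensional in \<open>simp_all add: source_functions_def\<close>)

lemma pullback_regular:
  assumes "h \<in> regular tgt"
  shows "pullback src orbit_map h \<in> regular src"
proof -
  have "(\<lambda>z. h (orbit_map (param z))) \<in> chart_functions"
    using assms unfolding regular_witt_variety
  proof induction
    case (gen f)
    then show ?case by (simp add: orbit_map_functional[OF inf p card] witt_functionals_iff)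
  qed (simp_all add: chart.const_in chart.add_in chart.mult_in)
  then show ?thesis by (simp add: pullback_def restrict_in_regular_src comp_def)
qed

lemma morphism_orbit_map: "morphism src tgt orbit_map"
  by (simp add: morphism_def pullback_regular Pi_def)

lemma expr_fun_regular: "expr_fun e \<in> regular src"
  using source_expr[OF inf p card, of e] by (simp add: expr_fun_def source_functions_def)

lemma regular_src_expr:
  assumes "f \<in> regular src" shows "\<exists>e. f = expr_fun e"
proof -
  obtain e where e: "\<And>z. z \<in> chart \<Longrightarrow> f (param z) = eval_field (loc_env det_expr z) e"
    using assms unfolding regular_src_iff chart_functions_def by blast
  have "f = expr_fun e"
  proof (rule extensionalityI[where A = pts])
    fix \<xi> assume \<xi>: "\<xi> \<in> pts"
    then show "f \<xi> = expr_fun e \<xi>"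
      using e[OF param_surj(1)[OF inf p card \<xi>]] by (simp add: expr_fun_def param_surj(2)[OF inf p card \<xi>])
  qed (use assms regular_src_extensional in \<open>auto simp: expr_fun_def\<close>)
  then show ?thesis ..
qed

lemma expr_fun_param: "z \<in> chart \<Longrightarrow> expr_fun e (param z) = eval_field (loc_env det_expr z) e"
  by (simp add: expr_fun_def param_points coords_param)

lemma expr_fun_ring:
  "expr_fun (EAdd a b) = expr_fun a \<oplus>\<^bsub>coord_ring src\<^esub> expr_fun b"
  "expr_fun (EMult a b) = expr_fun a \<otimes>\<^bsub>coord_ring src\<^esub> expr_fun b"
  "expr_fun (EConst c) = pullback src orbit_map (\<lambda>_. c)"
  "expr_fun (EConst 1) = \<one>\<^bsub>coord_ring src\<^esub>" "expr_fun (EConst 0) = \<zero>\<^bsub>coord_ring src\<^esub>"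
  by (auto simp: expr_fun_def coord_ring_def pullback_def restrict_def)

text \<open>The coordinates and the inverse of the determinant generate the coordinate ring over the constants.\<close>

lemma finite_type_orbit_map: "finite_type (coord_ring tgt) (coord_ring src) (pullback src orbit_map)"
proof -
  interpret B: cring "coord_ring src" by (rule cring_src)
  let ?F = "insert (expr_fun (EVar None)) ((\<lambda>v. expr_fun (EVar (Some v))) ` cvars CHAR('k))"
  let ?G = "pullback src orbit_map ` carrier (coord_ring tgt) \<union> ?F"
  have "finite ?F" by (simp add: cvars_def)
  moreover have F: "?F \<subseteq> carrier (coord_ring src)" by (auto simp: expr_fun_regular)
  moreover have "carrier (coord_ring src) = generate_ring (coord_ring src) ?G"
  proof
    have "?G \<subseteq> carrier (coord_ring src)" using F pullback_regular by auto
    then show "generate_ring (coord_ring src) ?G \<subseteq> carrier (coord_ring src)" by (rule B.generate_ring_incl)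
    have const: "expr_fun (EConst c) \<in> generate_ring (coord_ring src) ?G" for c
      unfolding expr_fun_ring(3)
      by (rule generate_ring.incl) (auto simp: regular_witt_variety intro: fun_algebra.const)
    have "expr_fun e \<in> generate_ring (coord_ring src) ?G" for e
    proof (induction e)
      case (EConst c)
      show ?case by (rule const)
    next
      case (EVar w)
      show ?case
      proof (cases "w = None \<or> (\<exists>v\<in>cvars CHAR('k). w = Some v)")
        case True
        then show ?thesis by (intro generate_ring.incl) auto
      next
        case False
        then obtain v where v: "w = Some v" "v \<notin> cvars CHAR('k)" by auto
        have "expr_fun (EVar w) = expr_fun (EConst (0 :: 'k))"
          unfolding expr_fun_def v(1)
          by (rule restrict_ext) (simp add: chartD(2)[OF param_surj(1)[OF inf p card] v(2)])
        then show ?thesis using const by simp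
      qed
    qed (simp_all add: expr_fun_ring(1,2) generate_ring.eng_add generate_ring.eng_mult)
    then show "carrier (coord_ring src) \<subseteq> generate_ring (coord_ring src) ?G"
      using regular_src_expr by auto
  qed
  ultimately show ?thesis unfolding finite_type_def by blast
qed

lemma src_deriv_regular: "f \<in> regular src \<Longrightarrow> src_deriv Y f \<in> regular src"
proof -
  assume "f \<in> regular src"
  then have "lifted_deriv Y (\<lambda>z. f (param z)) \<in> chart_functions"
    unfolding regular_src_iff by (intro lifted_deriv_in[OF inf p card]) simp
  then have "(\<lambda>z. lifted_deriv Y (\<lambda>z. f (param z)) (coords (param z :: _ \<times> ('k, 'i) witt))) \<in> chart_functions"
    by (rule chart.cong_in) (simp add: coords_param)
  then show ?thesis unfolding src_deriv_def restrict_in_regular_src .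
qed

lemma src_deriv_rules:
  assumes \<xi>: "\<xi> \<in> pts" and f: "f \<in> regular src" and g: "g \<in> regular src"
  shows "src_deriv Y (restrict (\<lambda>x. f x + g x) pts) \<xi> = src_deriv Y f \<xi> + src_deriv Y g \<xi>"
    "src_deriv Y (restrict (\<lambda>x. f x * g x) pts) \<xi> = f \<xi> * src_deriv Y g \<xi> + g \<xi> * src_deriv Y f \<xi>"
    "src_deriv Y (restrict (\<lambda>_. c) pts) \<xi> = 0"
    "src_deriv Y (restrict (\<lambda>x. c * f x) pts) \<xi> = c * src_deriv Y f \<xi>"
proof -
  note z = param_surj[OF inf p card \<xi>]
  interpret point_derivation chart chart_functions "coords \<xi>" "\<lambda>F. lifted_deriv Y F (coords \<xi>)"
    by (rule lifted_deriv_point_derivation[OF inf p card z(1)])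
  have fg: "(\<lambda>z. f (param z)) \<in> chart_functions" "(\<lambda>z. g (param z)) \<in> chart_functions"
    using f g by (simp_all add: regular_src_iff)
  have r: "lifted_deriv Y (\<lambda>z. if param z \<in> pts then H z else undefined) (coords \<xi>) = lifted_deriv Y H (coords \<xi>)"
    if "H \<in> chart_functions" for H
    by (rule sym, rule d_cong[OF that]) (simp add: param_points)
  show "src_deriv Y (restrict (\<lambda>x. f x + g x) pts) \<xi> = src_deriv Y f \<xi> + src_deriv Y g \<xi>"
    using \<xi> fg by (simp add: src_deriv_def r chart.add_in d_add)
  show "src_deriv Y (restrict (\<lambda>x. f x * g x) pts) \<xi> = f \<xi> * src_deriv Y g \<xi> + g \<xi> * src_deriv Y f \<xi>"
    using \<xi> fg by (simp add: src_deriv_def r chart.mult_in d_mult z(2) mult.commute)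
  show "src_deriv Y (restrict (\<lambda>_. c) pts) \<xi> = 0"
    using \<xi> by (simp add: src_deriv_def r chart.const_in d_const)
  show "src_deriv Y (restrict (\<lambda>x. c * f x) pts) \<xi> = c * src_deriv Y f \<xi>"
    using \<xi> fg by (simp add: src_deriv_def r chart.mult_in chart.const_in d_scale)
qed

lemma src_deriv_pullback:
  assumes "\<xi> \<in> pts" "wlin l"
  shows "src_deriv Y (pullback src orbit_map l) \<xi> = l Y"
proof -
  note z = param_surj[OF inf p card assms(1)]
  interpret point_derivation chart chart_functions "coords \<xi>" "\<lambda>F. lifted_deriv Y F (coords \<xi>)"
    by (rule lifted_deriv_point_derivation[OF inf p card z(1)])
  have "lifted_deriv Y (\<lambda>z. l (orbit_map (param z))) (coords \<xi>) = lifted_deriv Y (\<lambda>z. pullback src orbit_map l (param z)) (coords \<xi>)"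
    by (rule d_cong[OF orbit_map_functional[OF inf p card assms(2)]]) (simp add: pullback_def param_points)
  then show ?thesis
    using lifted_deriv_orbit_map[OF inf p card z(1) assms(2), of Y] assms(1) by (simp add: src_deriv_def)
qed

lemma functional_regular: "wlin l \<Longrightarrow> l \<in> regular tgt"
  unfolding regular_witt_variety by (rule fun_algebra.gen) (simp add: witt_functionals_iff)

text \<open>A tangent vector \<open>\<epsilon>\<close> of the target is the image of the combination of the values at \<open>\<xi>\<close> of the lifted
  coordinate fields with coefficients \<open>\<epsilon>(y\<^sub>r)\<close>, where the \<open>y\<^sub>r\<close> are the coordinates of \<open>W\<close>.\<close>

lemma tangent_map_surjective:
  assumes \<xi>: "\<xi> \<in> pts"
  shows "tangent_map src tgt orbit_map ` tangent_space src \<xi> = tangent_space tgt (orbit_map \<xi>)"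
proof
  show "tangent_map src tgt orbit_map ` tangent_space src \<xi> \<subseteq> tangent_space tgt (orbit_map \<xi>)"
  proof
    fix \<epsilon> assume "\<epsilon> \<in> tangent_map src tgt orbit_map ` tangent_space src \<xi>"
    then obtain \<delta> where \<delta>: "\<delta> \<in> tangent_space src \<xi>" "\<epsilon> = tangent_map src tgt orbit_map \<delta>" by blast
    note A = fun_algebra.const[of _ witt_functionals] fun_algebra.add[of _ witt_functionals] fun_algebra.mult[of _ witt_functionals]
    have T: "(\<lambda>z\<in>pts. F z) = pullback src orbit_map h" if "\<And>z. z \<in> pts \<Longrightarrow> F z = h (orbit_map z)" for F h
      using that by (auto simp: pullback_def restrict_def)
    have pb: "pullback src orbit_map h z = h (orbit_map z)" if "z \<in> pts" for h z
      using that by (simp add: pullback_def)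
    have D: "\<delta> (\<lambda>z\<in>pts. c * f z) = c * \<delta> f" "\<delta> (\<lambda>z\<in>pts. f z + g z) = \<delta> f + \<delta> g"
      "\<delta> (\<lambda>z\<in>pts. f z * g z) = f \<xi> * \<delta> g + g \<xi> * \<delta> f" if "f \<in> regular src" "g \<in> regular src" for c f g
      using \<delta>(1) that by (auto simp: tangent_space_def)
    show "\<epsilon> \<in> tangent_space tgt (orbit_map \<xi>)"
      unfolding tangent_space_def \<delta>(2) mem_Collect_eq
    proof (intro conjI ballI allI)
      show "tangent_map src tgt orbit_map \<delta> \<in> extensional (regular tgt)" by (simp add: tangent_map_def)
      fix f g :: "('k, 'i) witt \<Rightarrow> 'k" and c assume fg: "f \<in> regular tgt" "g \<in> regular tgt"
      note P = pullback_regular[OF fg(1)] pullback_regular[OF fg(2)]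
      have m: "(\<lambda>z. c * f z) \<in> regular tgt" "(\<lambda>z. f z + g z) \<in> regular tgt" "(\<lambda>z. f z * g z) \<in> regular tgt"
        using fg A by (simp_all add: regular_witt_variety fun_algebra.mult[OF fun_algebra.const])
      show "tangent_map src tgt orbit_map \<delta> (\<lambda>z\<in>points tgt. f z + g z) =
        tangent_map src tgt orbit_map \<delta> f + tangent_map src tgt orbit_map \<delta> g"
        using D(2)[OF P] T[of "\<lambda>z. pullback src orbit_map f z + pullback src orbit_map g z" "\<lambda>z. f z + g z"] fg m
        by (simp add: tangent_map_def pb restrict_UNIV)
      show "tangent_map src tgt orbit_map \<delta> (\<lambda>z\<in>points tgt. f z * g z) =
        f (orbit_map \<xi>) * tangent_map src tgt orbit_map \<delta> g + g (orbit_map \<xi>) * tangent_map src tgt orbit_map \<delta> f"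
        using D(3)[OF P] T[of "\<lambda>z. pullback src orbit_map f z * pullback src orbit_map g z" "\<lambda>z. f z * g z"] fg m \<xi>
        by (simp add: tangent_map_def pb restrict_UNIV)
    next
      fix f :: "('k, 'i) witt \<Rightarrow> 'k" and c assume f: "f \<in> regular tgt"
      have m: "(\<lambda>z. c * f z) \<in> regular tgt"
        using f by (simp add: regular_witt_variety fun_algebra.mult[OF fun_algebra.const])
      show "tangent_map src tgt orbit_map \<delta> (\<lambda>z\<in>points tgt. c * f z) = c * tangent_map src tgt orbit_map \<delta> f"
        using D(1)[OF pullback_regular[OF f] pullback_regular[OF f], of c] T[of "\<lambda>z. c * pullback src orbit_map f z" "\<lambda>z. c * f z"] f m
        by (simp add: tangent_map_def pb restrict_UNIV)
    qed
  qed
next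
  show "tangent_space tgt (orbit_map \<xi>) \<subseteq> tangent_map src tgt orbit_map ` tangent_space src \<xi>"
  proof
    fix \<epsilon> assume \<epsilon>: "\<epsilon> \<in> tangent_space tgt (orbit_map \<xi>)"
    let ?R = "UNIV \<times> reduced CHAR('k) :: 'i cvar set"
    define \<delta> where "\<delta> = restrict (\<lambda>f. \<Sum>r\<in>?R. \<epsilon> (wcoord r) * src_deriv (wbasis r) f \<xi>) (regular src)"
    have \<delta>_in: "(\<lambda>z\<in>pts. c * f z) \<in> regular src" "(\<lambda>z\<in>pts. f z + g z) \<in> regular src" "(\<lambda>z\<in>pts. f z * g z) \<in> regular src"
      if "f \<in> regular src" "g \<in> regular src" for f g c
      using that by (simp_all add: restrict_in_regular_src) (simp_all add: regular_src_iff chart.mult_in chart.add_in chart.const_in)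
    have "\<delta> \<in> tangent_space src \<xi>"
      unfolding tangent_space_def mem_Collect_eq points_orbit_source
    proof (intro conjI ballI allI)
      show "\<delta> \<in> extensional (regular src)" by (simp add: \<delta>_def)
      fix f g :: "_ \<times> ('k, 'i) witt \<Rightarrow> 'k" assume fg: "f \<in> regular src" "g \<in> regular src"
      show "\<delta> (\<lambda>z\<in>pts. f z + g z) = \<delta> f + \<delta> g"
        using fg by (simp add: \<delta>_def \<delta>_in src_deriv_rules(1)[OF \<xi> fg] distrib_left sum.distrib)
      show "\<delta> (\<lambda>z\<in>pts. f z * g z) = f \<xi> * \<delta> g + g \<xi> * \<delta> f"
        using fg by (simp add: \<delta>_def \<delta>_in src_deriv_rules(2)[OF \<xi> fg] distrib_left sum.distrib sum_distrib_left mult_ac)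
    next
      fix f :: "_ \<times> ('k, 'i) witt \<Rightarrow> 'k" and c assume f: "f \<in> regular src"
      show "\<delta> (\<lambda>z\<in>pts. c * f z) = c * \<delta> f"
        using f by (simp add: \<delta>_def \<delta>_in src_deriv_rules(4)[OF \<xi> f f] sum_distrib_left mult_ac)
    qed
    moreover have "\<epsilon> = tangent_map src tgt orbit_map \<delta>"
    proof (rule extensionalityI[where A = "regular tgt"])
      show "\<epsilon> \<in> extensional (regular tgt)" "tangent_map src tgt orbit_map \<delta> \<in> extensional (regular tgt)"
        using \<epsilon> by (simp_all add: tangent_space_def tangent_map_def)
      fix h assume h: "h \<in> regular tgt"
      have E: "\<epsilon> (\<lambda>z. c * f z) = c * \<epsilon> f" "\<epsilon> (\<lambda>z. f z + g z) = \<epsilon> f + \<epsilon> g"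
        "\<epsilon> (\<lambda>z. f z * g z) = f (orbit_map \<xi>) * \<epsilon> g + g (orbit_map \<xi>) * \<epsilon> f"
        if "f \<in> regular tgt" "g \<in> regular tgt" for f g c
        using \<epsilon> that by (simp_all add: tangent_space_def restrict_UNIV)
      have E1: "\<epsilon> (\<lambda>_. c) = 0" for c
      proof -
        have one: "(\<lambda>_. 1) \<in> regular tgt" unfolding regular_witt_variety by (rule fun_algebra.const)
        from E(3)[OF one one] have "\<epsilon> (\<lambda>_. 1) = \<epsilon> (\<lambda>_. 1) + \<epsilon> (\<lambda>_. 1)"
          by (simp only: mult_1)
        then have "\<epsilon> (\<lambda>_. 1) = 0" by (simp only: add_cancel_right_right)
        then show ?thesis using E(1)[OF one one, of c] by simp
      qed
      have tm: "tangent_map src tgt orbit_map \<delta> f = (\<Sum>r\<in>?R. \<epsilon> (wcoord r) * src_deriv (wbasis r) (pullback src orbit_map f) \<xi>)"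
        if "f \<in> regular tgt" for f
        using that pullback_regular[OF that] by (simp add: tangent_map_def \<delta>_def)
      have T: "pullback src orbit_map h = (\<lambda>z\<in>pts. F z)" if "\<And>z. z \<in> pts \<Longrightarrow> F z = h (orbit_map z)" for F h
        using that by (auto simp: pullback_def restrict_def)
      have pb: "pullback src orbit_map h z = h (orbit_map z)" if "z \<in> pts" for h z
        using that by (simp add: pullback_def)
      have "h \<in> regular tgt \<and> \<epsilon> h = (\<Sum>r\<in>?R. \<epsilon> (wcoord r) * src_deriv (wbasis r) (pullback src orbit_map h) \<xi>)"
        using h unfolding regular_witt_variety
      proof induction
        case (const c)
        have "src_deriv Y (pullback src orbit_map (\<lambda>_. c)) \<xi> = 0" for Y
          unfolding T[of "\<lambda>_. c" "\<lambda>_. c", OF refl]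
          using src_deriv_rules(3)[OF \<xi> expr_fun_regular expr_fun_regular] by simp
        then show ?case by (simp add: E1 fun_algebra.const)
      next
        case (gen l)
        then have l: "wlin l" by (simp add: witt_functionals_iff)
        have sum_reg: "(\<lambda>D. \<Sum>r\<in>I. wcoord r D * l (wbasis r)) \<in> regular tgt \<and>
          \<epsilon> (\<lambda>D. \<Sum>r\<in>I. wcoord r D * l (wbasis r)) = (\<Sum>r\<in>I. \<epsilon> (wcoord r) * l (wbasis r))"
          if "finite I" for I :: "'i cvar set"
          using that
        proof (induction I rule: finite_induct)
          case empty
          show ?case by (simp add: E1 regular_witt_variety fun_algebra.const)
        next
          case (insert r I)
          note w = functional_regular[OF wlin_wcoord, of r]
          have cw: "(\<lambda>D. l (wbasis r) * wcoord r D) \<in> regular tgt"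
            using w by (simp add: regular_witt_variety fun_algebra.mult[OF fun_algebra.const])
          show ?case using insert E(1)[OF w w, of "l (wbasis r)"] E(2)[OF cw, of "\<lambda>D. \<Sum>r\<in>I. wcoord r D * l (wbasis r)"]
              fun_algebra.add[of _ witt_functionals, OF cw[unfolded regular_witt_variety]]
            by (simp add: regular_witt_variety mult.commute)
        qed
        have "l = (\<lambda>D. \<Sum>r\<in>?R. wcoord r D * l (wbasis r))" by (rule ext) (rule wlin_expand[OF l])
        from arg_cong[OF this, of \<epsilon>]
        have "\<epsilon> l = \<epsilon> (\<lambda>D. \<Sum>r\<in>?R. wcoord r D * l (wbasis r))" .
        also have "\<dots> = (\<Sum>r\<in>?R. \<epsilon> (wcoord r) * l (wbasis r))" using sum_reg[of ?R] by simp
        finally have "\<epsilon> l = (\<Sum>r\<in>?R. \<epsilon> (wcoord r) * l (wbasis r))" .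
        then show ?case using fun_algebra.gen[OF gen] by (simp add: src_deriv_pullback[OF \<xi> l])
      next
        case (add f g)
        note fg = add.IH[THEN conjunct1, folded regular_witt_variety] and e = add.IH[THEN conjunct2]
        have "src_deriv Y (pullback src orbit_map (\<lambda>z. f z + g z)) \<xi> =
          src_deriv Y (pullback src orbit_map f) \<xi> + src_deriv Y (pullback src orbit_map g) \<xi>" for Y
          using src_deriv_rules(1)[OF \<xi> pullback_regular[OF fg(1)] pullback_regular[OF fg(2)], of Y]
            T[of "\<lambda>z. pullback src orbit_map f z + pullback src orbit_map g z" "\<lambda>z. f z + g z"] by (simp add: pb)
        then show ?case using add fun_algebra.add[OF add.hyps] by (simp add: E(2)[OF fg] distrib_left sum.distrib)
      next
        case (mult f g)
        note fg = mult.IH[THEN conjunct1, folded regular_witt_variety]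
        have "src_deriv Y (pullback src orbit_map (\<lambda>z. f z * g z)) \<xi> =
          f (orbit_map \<xi>) * src_deriv Y (pullback src orbit_map g) \<xi> + g (orbit_map \<xi>) * src_deriv Y (pullback src orbit_map f) \<xi>" for Y
          using src_deriv_rules(2)[OF \<xi> pullback_regular[OF fg(1)] pullback_regular[OF fg(2)], of Y]
            T[of "\<lambda>z. pullback src orbit_map f z * pullback src orbit_map g z" "\<lambda>z. f z * g z"] \<xi> by (simp add: pb)
        then show ?case using mult fun_algebra.mult[OF mult.hyps]
          by (simp add: E(3)[OF fg] distrib_left sum.distrib sum_distrib_left mult_ac)
      qed
      then show "\<epsilon> h = tangent_map src tgt orbit_map \<delta> h" using tm by simp
    qed
    ultimately show "\<epsilon> \<in> tangent_map src tgt orbit_map ` tangent_space src \<xi>" by blast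
  qed
qed

end

(* The argument ty only fixes the type variables. *)
context
  fixes ty :: "('k::field_prime_char \<times> 'i::{finite, linorder}) itself"
  assumes inf: "infinite (UNIV :: 'k set)" and p: "CHAR('k) > 2" and card: "CARD('i) \<ge> 2"
begin

lemma eval_field_map_Some: "eval_field (loc_env d z) (map_expr id Some e) = eval_field z e"
  by (induction e) simp_all

lemma eval_ring_map_Some: "eval_ring R \<kappa> c (map_expr id Some e) = eval_ring R \<kappa> (c \<circ> Some) e"
  by (induction e) simp_all

text \<open>Lift the coordinates arbitrarily, evaluate expressions at the lifts, and correct the resulting
  homomorphism by the lifted coordinate fields.\<close>

theorem formally_smooth_orbit_map:
  "formally_smooth TYPE('c) (coord_ring witt_variety) (coord_ring (orbit_source :: (_ \<times> ('k, 'i) witt, 'k) variety))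
    (pullback orbit_source orbit_map)"
  unfolding formally_smooth_def
proof (intro allI impI, elim conjE)
  let ?A = "coord_ring (witt_variety :: (('k, 'i) witt, 'k) variety)"
  let ?B = "coord_ring (orbit_source :: (_ \<times> ('k, 'i) witt, 'k) variety)"
  let ?pb = "pullback (orbit_source :: (_ \<times> ('k, 'i) witt, 'k) variety) orbit_map"
  let ?pts = "orbit_points :: (_ \<times> ('k, 'i) witt) set"
  let ?d = "det_expr :: ('k, 'i cvar) expr"
  fix C :: "'c ring" (structure) and J u v
  assume C: "cring C" and J: "ideal J C" and square: "\<forall>a\<in>J. \<forall>b\<in>J. a \<otimes> b = \<zero>"
    and u: "u \<in> Ring.ring_hom ?A C" and v: "v \<in> Ring.ring_hom ?B (C Quot J)"
    and uv: "\<forall>a\<in>carrier ?A. v (?pb a) = J +> u a"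
  note intro_rules = inf p card
  interpret C: cring C by (rule C)
  interpret J: ideal J C by (rule J)
  interpret B: cring ?B by (rule cring_src[OF intro_rules])
  note q = J.rcos_ring_hom
  note carrier = carrier_coord_ring
  define \<kappa> where "\<kappa> a = u (\<lambda>_ :: ('k, 'i) witt. a :: 'k)" for a
  have A_const: "(\<lambda>_. a) \<in> carrier ?A" for a
    unfolding carrier regular_witt_variety by (rule fun_algebra.const)
  interpret \<kappa>: const_ring C \<kappa>
  proof
    have A_ops: "f \<oplus>\<^bsub>?A\<^esub> g = (\<lambda>x. f x + g x)" "f \<otimes>\<^bsub>?A\<^esub> g = (\<lambda>x. f x * g x)" "\<one>\<^bsub>?A\<^esub> = (\<lambda>_. 1)" for f g
      by (simp_all add: coord_ring_def restrict_UNIV)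
    show "\<kappa> a \<in> carrier C" for a unfolding \<kappa>_def by (rule Ring.ring_hom_closed[OF u A_const])
    show "\<kappa> (a + b) = \<kappa> a \<oplus> \<kappa> b" for a b
      using Ring.ring_hom_add[OF u A_const[of a] A_const[of b]] by (simp add: \<kappa>_def A_ops)
    show "\<kappa> (a * b) = \<kappa> a \<otimes> \<kappa> b" for a b
      using Ring.ring_hom_mult[OF u A_const[of a] A_const[of b]] by (simp add: \<kappa>_def A_ops)
    show "\<kappa> 1 = \<one>" using Ring.ring_hom_one[OF u] by (simp add: \<kappa>_def A_ops)
  qed
  note E = expr_fun_regular[OF intro_rules] and E_ring = expr_fun_ring[OF intro_rules]
  have E_carrier: "expr_fun e \<in> carrier ?B" for e by (simp add: carrier E)
  have v_const: "v (expr_fun (EConst a)) = J +> \<kappa> a" for a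
    unfolding E_ring(3) \<kappa>_def using uv A_const by blast

  (* Any choice of lifts of the coordinates evaluates expressions compatibly with v. *)
  have lift_expr: "J +> eval_ring C \<kappa> c e = v (expr_fun e)"
    if "\<And>w. c w \<in> carrier C" "\<And>w. J +> c w = v (expr_fun (EVar w))" for c e
  proof (induction e)
    case (EAdd a b)
    then show ?case
      using Ring.ring_hom_add[OF q, of "eval_ring C \<kappa> c a" "eval_ring C \<kappa> c b"] Ring.ring_hom_add[OF v E_carrier[of a] E_carrier[of b]] that(1)
      by (simp add: E_ring(1))
  next
    case (EMult a b)
    then show ?case
      using Ring.ring_hom_mult[OF q, of "eval_ring C \<kappa> c a" "eval_ring C \<kappa> c b"] Ring.ring_hom_mult[OF v E_carrier[of a] E_carrier[of b]] that(1)
      by (simp add: E_ring(2))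
  qed (simp_all add: v_const that(2))

  have lift: "\<exists>x. x \<in> carrier C \<and> J +> x = v (expr_fun e)" for e
    using Ring.ring_hom_closed[OF v E_carrier[of e]] by (auto simp: FactRing_def A_RCOSETS_def')
  define c0 where "c0 w = (if \<exists>a. w = Some a \<and> a \<notin> cvars CHAR('k) then \<zero>
    else SOME x. x \<in> carrier C \<and> J +> x = v (expr_fun (EVar w)))" for w
  have c0: "c0 w \<in> carrier C" "J +> c0 w = v (expr_fun (EVar w))" for w
  proof -
    have "c0 w \<in> carrier C \<and> J +> c0 w = v (expr_fun (EVar w))"
    proof (cases "\<exists>a. w = Some a \<and> a \<notin> cvars CHAR('k)")
      case True
      then obtain a where a: "w = Some a" "a \<notin> cvars CHAR('k)" by blast
      have "expr_fun (EVar w) = expr_fun (EConst (0 :: 'k))"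
        unfolding expr_fun_def a(1)
        by (rule restrict_ext) (simp add: chartD(2)[OF param_surj(1)[OF intro_rules] a(2)])
      then show ?thesis using True by (simp add: c0_def v_const \<kappa>.const_zero)
    next
      case False
      then have "c0 w = (SOME x. x \<in> carrier C \<and> J +> x = v (expr_fun (EVar w)))"
        by (simp only: c0_def if_False)
      then show ?thesis using someI_ex[OF lift[of "EVar w"]] by simp
    qed
    then show "c0 w \<in> carrier C" "J +> c0 w = v (expr_fun (EVar w))" by auto
  qed

  (* The lift of the inverse of the determinant is inverse to the lifted determinant only up to J; one
    Newton step repairs this. *)
  define dC where "dC = eval_ring C \<kappa> (c0 \<circ> Some) ?d"
  have dC: "dC \<in> carrier C" using c0(1) by (simp add: dC_def)
  define j where "j = c0 None \<otimes> dC \<ominus> \<one>"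
  have "J +> (c0 None \<otimes> dC) = v (expr_fun (EMult (EVar None) (map_expr id Some ?d)))"
    using lift_expr[OF c0, of "EMult (EVar None) (map_expr id Some ?d)"] by (simp add: dC_def eval_ring_map_Some)
  also have "expr_fun (EMult (EVar None) (map_expr id Some ?d)) = expr_fun (EConst 1)"
    unfolding expr_fun_def
    by (rule restrict_ext)
       (use chartD(1)[OF param_surj(1)[OF intro_rules]] in \<open>simp add: eval_field_map_Some bij_phi_iff\<close>)
  also have "v (expr_fun (EConst 1)) = J +> \<one>" by (simp add: v_const \<kappa>.const_one)
  finally have j: "j \<in> J" unfolding j_def
    using C.quotient_eq_iff_same_a_r_cos[OF J, of "c0 None \<otimes> dC" \<one>] c0(1) dC by simp
  have jC: "j \<in> carrier C" using j by (rule J.a_Hcarr)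
  define c where "c w = (if w = None then c0 None \<otimes> (\<one> \<ominus> j) else c0 w)" for w
  have c_closed: "c w \<in> carrier C" for w using c0(1) jC by (simp add: c_def)
  have c_Some: "c \<circ> Some = c0 \<circ> Some" by (simp add: c_def fun_eq_iff)
  have c_lift: "J +> c w = v (expr_fun (EVar w))" for w
  proof (cases "w = None")
    case True
    have "c0 None \<otimes> (\<one> \<ominus> j) \<ominus> c0 None = \<ominus> (c0 None \<otimes> j)"
      using c0(1) jC by (simp add: C.minus_eq C.r_distr C.r_minus C.a_ac C.r_neg C.r_neg1 C.r_neg2)
    moreover have "\<ominus> (c0 None \<otimes> j) \<in> J" using j c0(1) by (simp add: J.I_l_closed J.a_inv_closed)
    ultimately have "J +> (c0 None \<otimes> (\<one> \<ominus> j)) = J +> c0 None"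
      using C.quotient_eq_iff_same_a_r_cos[OF J, of "c0 None \<otimes> (\<one> \<ominus> j)" "c0 None"] c0(1) jC by simp
    then show ?thesis using True c0(2) by (simp add: c_def)
  next
    case False
    then have "c w = c0 w" by (simp only: c_def if_False)
    then show ?thesis by (simp only: c0(2))
  qed
  have unit: "c None \<otimes> eval_ring C \<kappa> (c \<circ> Some) ?d = \<one>"
  proof -
    have d1: "c0 None \<otimes> dC = \<one> \<oplus> j"
      using c0(1) dC by (simp add: j_def C.minus_eq C.a_ac C.r_neg1 C.r_neg2 C.r_neg)
    have "c None \<otimes> dC = (c0 None \<otimes> dC) \<otimes> (\<one> \<ominus> j)"
      using c0(1) dC jC by (simp add: c_def C.m_ac)
    also have "\<dots> = \<one> \<ominus> j \<otimes> j"
      unfolding d1 using jC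
      by (simp add: C.minus_eq C.l_distr C.r_distr C.r_minus C.a_assoc C.minus_add C.r_neg1 C.r_neg2)
    also have "\<dots> = \<one>" using square j by (simp add: C.minus_eq)
    finally show ?thesis by (simp add: c_Some dC_def)
  qed

  have eq: "eval_ring C \<kappa> c e = eval_ring C \<kappa> c e'" if "expr_fun e = expr_fun e'" for e e'
  proof -
    have "eval_ring C \<kappa> c (EAdd e (EMult (EConst (- 1)) e')) = \<zero>"
    proof (rule \<kappa>.loc_identity_principle[OF inf _ _ _ unit, where vs = "cvar_list CHAR('k)"])
      fix z :: "'i cvar \<Rightarrow> 'k"
      assume z: "\<And>v. v \<notin> set (cvar_list CHAR('k)) \<Longrightarrow> z v = 0" "eval_field z ?d \<noteq> 0"
      show "eval_field (loc_env ?d z) (EAdd e (EMult (EConst (- 1)) e')) = 0"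
      proof (rule chart_vanish[OF _ z])
        fix z :: "'i cvar \<Rightarrow> 'k" assume z: "z \<in> chart"
        from arg_cong[OF that, of "\<lambda>f. f (param z)"]
        show "eval_field (loc_env ?d z) (EAdd e (EMult (EConst (- 1)) e')) = 0"
          by (simp add: expr_fun_param[OF intro_rules z])
      qed
    qed (auto simp: c_closed cvar_list, simp add: c_def c0_def)
    then have *: "eval_ring C \<kappa> c e \<oplus> \<kappa> (- 1) \<otimes> eval_ring C \<kappa> c e' = \<zero>" by simp
    have "\<kappa> (- 1) \<oplus> \<one> = \<kappa> (- 1 + 1)" by (simp only: \<kappa>.const_add \<kappa>.const_one)
    then have neg: "\<kappa> (- 1) \<oplus> \<one> = \<zero>" by (simp add: \<kappa>.const_zero)
    have "eval_ring C \<kappa> c e = eval_ring C \<kappa> c e \<oplus> (\<kappa> (- 1) \<oplus> \<one>) \<otimes> eval_ring C \<kappa> c e'"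
      unfolding neg by (simp add: c_closed)
    also have "\<dots> = (eval_ring C \<kappa> c e \<oplus> \<kappa> (- 1) \<otimes> eval_ring C \<kappa> c e') \<oplus> eval_ring C \<kappa> c e'"
      by (simp add: C.l_distr C.a_assoc c_closed)
    also have "\<dots> = eval_ring C \<kappa> c e'" unfolding * by (simp add: c_closed)
    finally show ?thesis .
  qed
  define w0 where "w0 f = eval_ring C \<kappa> c (SOME e. f = expr_fun e)" for f
  have w0: "w0 (expr_fun e) = eval_ring C \<kappa> c e" for e
  proof -
    have "expr_fun e = expr_fun (SOME e'. expr_fun e = expr_fun e')"
      by (rule someI[of "\<lambda>e'. expr_fun e = expr_fun e'"]) (rule refl)
    from eq[OF this] show ?thesis by (simp add: w0_def)
  qed
  have rep: "\<exists>e. f = expr_fun e" if "f \<in> carrier ?B" for f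
    using regular_src_expr[OF intro_rules] that by (simp add: carrier)
  have w0_hom: "w0 \<in> Ring.ring_hom ?B C"
  proof (rule Ring.ring_hom_memI)
    fix f g assume "f \<in> carrier ?B" "g \<in> carrier ?B"
    then obtain a b where ab: "f = expr_fun a" "g = expr_fun b" using rep by blast
    show "w0 f \<in> carrier C" unfolding ab w0 by (simp add: c_closed)
    show "w0 (f \<oplus>\<^bsub>?B\<^esub> g) = w0 f \<oplus> w0 g" unfolding ab E_ring(1)[symmetric] w0 by simp
    show "w0 (f \<otimes>\<^bsub>?B\<^esub> g) = w0 f \<otimes> w0 g" unfolding ab E_ring(2)[symmetric] w0 by simp
  next
    show "w0 \<one>\<^bsub>?B\<^esub> = \<one>" unfolding E_ring(4)[symmetric] w0 by (simp add: \<kappa>.const_one)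
  qed
  have w0_lift: "v f = J +> w0 f" if "f \<in> carrier ?B" for f
    using rep[OF that] lift_expr[OF c_closed c_lift] w0 by auto

  (* Make the lift agree with u on the coordinates of the target. *)
  let ?I = "UNIV \<times> reduced CHAR('k) :: 'i cvar set"
  have y_reg: "wcoord r \<in> carrier ?A" for r
    using functional_regular[OF intro_rules wlin_wcoord] by (simp add: carrier)
  have pb_carrier: "?pb h \<in> carrier ?B" if "h \<in> carrier ?A" for h
    using pullback_regular[OF intro_rules] that by (simp add: carrier)
  have D_carrier: "src_deriv Y f \<in> carrier ?B" if "f \<in> carrier ?B" for Y :: "('k, 'i) witt" and f
    using src_deriv_regular[OF intro_rules] that by (simp add: carrier)
  note rules = src_deriv_rules[OF intro_rules]
  have src_ext: "f = g" if "f \<in> extensional ?pts" "g \<in> extensional ?pts" "\<And>\<xi>. \<xi> \<in> ?pts \<Longrightarrow> f \<xi> = g \<xi>" for f g :: "_ \<Rightarrow> 'k"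
    using that by (rule extensionalityI)
  have D_ext: "src_deriv Y f \<in> extensional ?pts" for Y f by (simp add: src_deriv_def)
  obtain w where w: "w \<in> Ring.ring_hom ?B C" "\<And>b. b \<in> carrier ?B \<Longrightarrow> w b \<ominus> w0 b \<in> J"
    "\<And>s. s \<in> ?I \<Longrightarrow> w (?pb (wcoord s)) = u (wcoord s)"
    "\<And>b. b \<in> carrier ?B \<Longrightarrow> (\<And>r. r \<in> ?I \<Longrightarrow> src_deriv (wbasis r) b = \<zero>\<^bsub>?B\<^esub>) \<Longrightarrow> w b = w0 b"
  proof (rule C.corrected_lift[OF J _ B.ring_axioms w0_hom,
        where I = ?I and Y = "\<lambda>r. ?pb (wcoord r)" and t = "\<lambda>r. u (wcoord r)" and D = "\<lambda>r. src_deriv (wbasis r)"])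
    show "a \<otimes> b = \<zero>" if "a \<in> J" "b \<in> J" for a b using square that by blast
    show "finite ?I" by simp
    show "?pb (wcoord r) \<in> carrier ?B" for r by (rule pb_carrier[OF y_reg])
    show "u (wcoord r) \<in> carrier C" for r by (rule Ring.ring_hom_closed[OF u y_reg])
    then show "u (wcoord r) \<ominus> w0 (?pb (wcoord r)) \<in> J" for r
      using C.quotient_eq_iff_same_a_r_cos[OF J, of "u (wcoord r)" "w0 (?pb (wcoord r))"]
        w0_lift[OF pb_carrier[OF y_reg[of r]]] uv y_reg[of r] Ring.ring_hom_closed[OF w0_hom pb_carrier[OF y_reg[of r]]]
      by simp
    fix r s and a b assume ab: "a \<in> carrier ?B" "b \<in> carrier ?B"
    then have ab': "a \<in> regular orbit_source" "b \<in> regular orbit_source" by (simp_all add: carrier)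
    show "src_deriv (wbasis r) (a \<oplus>\<^bsub>?B\<^esub> b) = src_deriv (wbasis r) a \<oplus>\<^bsub>?B\<^esub> src_deriv (wbasis r) b"
      by (rule src_ext) (use rules(1)[OF _ ab'] in \<open>simp_all add: D_ext coord_ring_def\<close>)
    show "src_deriv (wbasis r) (a \<otimes>\<^bsub>?B\<^esub> b) = a \<otimes>\<^bsub>?B\<^esub> src_deriv (wbasis r) b \<oplus>\<^bsub>?B\<^esub> b \<otimes>\<^bsub>?B\<^esub> src_deriv (wbasis r) a"
      by (rule src_ext) (use rules(2)[OF _ ab'] in \<open>simp_all add: D_ext coord_ring_def\<close>)
  next
    fix r and b assume "b \<in> carrier ?B"
    then show "src_deriv (wbasis r) b \<in> carrier ?B" by (rule D_carrier)
  next
    fix r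
    show "src_deriv (wbasis r) \<one>\<^bsub>?B\<^esub> = \<zero>\<^bsub>?B\<^esub>"
      by (rule src_ext) (use rules(3)[OF _ E E] in \<open>simp_all add: D_ext coord_ring_def\<close>)
  next
    fix r s :: "'i cvar" assume "r \<in> ?I"
    then have "wcoord s (wbasis r :: ('k, 'i) witt) = (if r = s then 1 else 0)" by (simp add: wcoord_wbasis)
    then show "src_deriv (wbasis r) (?pb (wcoord s)) = (if r = s then \<one>\<^bsub>?B\<^esub> else \<zero>\<^bsub>?B\<^esub>)"
      by (intro src_ext) (simp_all add: D_ext coord_ring_def src_deriv_pullback[OF intro_rules _ wlin_wcoord])
  qed (use that in blast)

  have w_const: "w (?pb (\<lambda>_. a)) = u (\<lambda>_. a)" for a
  proof -
    have "src_deriv (wbasis r) (expr_fun (EConst a)) = \<zero>\<^bsub>?B\<^esub>" for r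
      by (rule src_ext) (use rules(3)[OF _ E E] in \<open>simp_all add: D_ext coord_ring_def expr_fun_def\<close>)
    then have "w (expr_fun (EConst a)) = w0 (expr_fun (EConst a))" by (intro w(4) E_carrier)
    then have "w (expr_fun (EConst a)) = \<kappa> a" unfolding w0 by simp
    then show ?thesis unfolding E_ring(3) \<kappa>_def .
  qed
  have pb_ops: "?pb (\<lambda>x. f x + g x) = ?pb f \<oplus>\<^bsub>?B\<^esub> ?pb g" "?pb (\<lambda>x. f x * g x) = ?pb f \<otimes>\<^bsub>?B\<^esub> ?pb g" for f g
    by (auto simp: pullback_def coord_ring_def restrict_def)
  have A_ops: "f \<oplus>\<^bsub>?A\<^esub> g = (\<lambda>x. f x + g x)" "f \<otimes>\<^bsub>?A\<^esub> g = (\<lambda>x. f x * g x)" for f g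
    by (simp_all add: coord_ring_def restrict_UNIV)
  have agree_add: "w (?pb (\<lambda>x. f x + g x)) = u (\<lambda>x. f x + g x)"
    if "f \<in> carrier ?A" "g \<in> carrier ?A" "w (?pb f) = u f" "w (?pb g) = u g" for f g
    using Ring.ring_hom_add[OF w(1) pb_carrier[OF that(1)] pb_carrier[OF that(2)]] Ring.ring_hom_add[OF u that(1,2)] that(3,4)
    by (simp add: pb_ops A_ops)
  have agree_mult: "w (?pb (\<lambda>x. f x * g x)) = u (\<lambda>x. f x * g x)"
    if "f \<in> carrier ?A" "g \<in> carrier ?A" "w (?pb f) = u f" "w (?pb g) = u g" for f g
    using Ring.ring_hom_mult[OF w(1) pb_carrier[OF that(1)] pb_carrier[OF that(2)]] Ring.ring_hom_mult[OF u that(1,2)] that(3,4)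
    by (simp add: pb_ops A_ops)
  have closed: "(\<lambda>x. f x + g x) \<in> carrier ?A" "(\<lambda>x. f x * g x) \<in> carrier ?A" if "f \<in> carrier ?A" "g \<in> carrier ?A" for f g
    using that fun_algebra.add[of f witt_functionals g] fun_algebra.mult[of f witt_functionals g]
    unfolding carrier regular_witt_variety by auto
  have agree: "h \<in> carrier ?A \<and> w (?pb h) = u h" if "h \<in> fun_algebra witt_functionals" for h
    using that
  proof induction
    case (const a)
    show ?case using A_const w_const by blast
  next
    case (gen l)
    then have l: "wlin l" by (simp add: witt_functionals_iff)
    have "(\<lambda>D. \<Sum>r\<in>K. wcoord r D * l (wbasis r)) \<in> carrier ?A \<and>
      w (?pb (\<lambda>D. \<Sum>r\<in>K. wcoord r D * l (wbasis r))) = u (\<lambda>D. \<Sum>r\<in>K. wcoord r D * l (wbasis r))"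
      if "finite K" "K \<subseteq> ?I" for K
      using that
    proof (induction K rule: finite_induct)
      case empty
      show ?case using A_const[of 0] w_const[of 0] by simp
    next
      case (insert r K)
      have 1: "(\<lambda>D. wcoord r D * l (wbasis r)) \<in> carrier ?A" by (rule closed(2)[OF y_reg A_const])
      have 2: "w (?pb (\<lambda>D. wcoord r D * l (wbasis r))) = u (\<lambda>D. wcoord r D * l (wbasis r))"
        using insert.prems by (intro agree_mult[OF y_reg A_const _ w_const] w(3)) auto
      show ?case using insert closed(1)[OF 1] agree_add[OF 1 _ 2] by auto
    qed
    from this[of ?I] have "(\<lambda>D. \<Sum>r\<in>?I. wcoord r D * l (wbasis r)) \<in> carrier ?A \<and>
      w (?pb (\<lambda>D. \<Sum>r\<in>?I. wcoord r D * l (wbasis r))) = u (\<lambda>D. \<Sum>r\<in>?I. wcoord r D * l (wbasis r))" by simp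
    moreover have "(\<lambda>D. \<Sum>r\<in>?I. wcoord r D * l (wbasis r)) = l" by (rule ext) (rule wlin_expand[OF l, symmetric])
    ultimately show ?case by (simp only:)
  qed (use closed agree_add agree_mult in blast)+
  show "\<exists>w\<in>Ring.ring_hom ?B C. (\<forall>a\<in>carrier ?A. w (?pb a) = u a) \<and> (\<forall>b\<in>carrier ?B. v b = J +> w b)"
  proof (intro bexI[OF _ w(1)] conjI ballI)
    fix a assume "a \<in> carrier ?A"
    then show "w (?pb a) = u a" using agree by (simp add: carrier regular_witt_variety)
  next
    fix b assume b: "b \<in> carrier ?B"
    then show "v b = J +> w b"
      using w0_lift[OF b] w(2)[OF b] C.quotient_eq_iff_same_a_r_cos[OF J, of "w b" "w0 b"]
        Ring.ring_hom_closed[OF w(1) b] Ring.ring_hom_closed[OF w0_hom b] by simp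
  qed
qed

end

theorem proposition4p9:
  fixes n :: nat
  assumes "n \<ge> 3" and "CARD('i::{finite, linorder}) = n - 1"
    and "CHAR('k::{alg_closed_field, field_prime_char}) > 3"
  shows "(\<forall>g \<in> witt_aut. \<forall>x \<in> (Omega1 :: ('k, 'i) witt set).
      tangent_map orbit_source witt_variety orbit_map ` tangent_space orbit_source (g, x) =
        tangent_space witt_variety (orbit_map (g, x))) \<and>
    smooth_morphism TYPE('c) (orbit_source :: (_ \<times> ('k, 'i) witt, 'k) variety) witt_variety orbit_map"
proof -
  have inf: "infinite (UNIV :: 'k set)" by (rule infinite_alg_closed)
  have p: "CHAR('k) > 2" and card: "CARD('i) \<ge> 2" using assms by simp_all
  note H = inf p card
  show ?thesis
    unfolding smooth_morphism_def
    using tangent_map_surjective[OF H] morphism_orbit_map[OF H] formally_smooth_orbit_map[OF H] finite_type_orbit_map[OF H]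
    by blast
qed

end
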